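(* Suppose $f(s)s\ge\alpha|s|^p-\beta$ for all $s\in\mathbb{R}$ (with constants $p>2$, $\alpha,\beta>0$). Let $$a_1=1,\qquad a_{k+1}=a_k+\frac{p-2}{p},\qquad k\in\mathbb{N}.$$ Then for any $\varepsilon>0$ there exists a family of positive constants $\{C_\varepsilon^{(k)}\}_{k\in\mathbb{N}}$ such that, for every $u_0\in L^2(D)$, every $g\in L^2(D)$ and every $k\in\mathbb{N}$, the solution $u$ of the reaction-diffusion problem in the context satisfies $$\|u(t)\|_{pa_k}^{pa_k}\le C_\varepsilon^{(k)}\left(e^{-\lambda t}\|u_0\|^2+\|g\|_{\frac{pa_{k+1}}{p-1}}^{\frac{pa_{k+1}}{p-1}}+1\right),\qquad t>\varepsilon,$$ where the right-hand side is understood as $+\infty$ if $g\notin L^{\frac{pa_{k+1}}{p-1}}(D)$.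
   Context: Let $D\subset\mathbb{R}^N$ be a bounded smooth domain, $N\in\mathbb{N}$, and $\lambda>0$ a fixed number. The problem is $$\frac{du}{dt}+\lambda u-\Delta u+f(u)=g(x),\qquad u(0)=u_0,\qquad u|_{\partial D}=0,$$ with $g\in L^2(D)$. Throughout, $f\in C^1(\mathbb{R})$ satisfies, for all $s\in\mathbb{R}$, $f'(s)\ge\kappa|s|^{p-2}-l$, $f(s)s\ge\alpha|s|^p-\beta$ and $|f(s)|\le\sigma|s|^{p-1}+\sigma$ with $p>2$ and positive constants $l,\kappa,\alpha,\beta,\sigma$; under these conditions, for each $u_0\in L^2(D)$ the problem has a unique weak solution $u\in C([0,\infty);L^2(D))\cap L^p_{loc}(0,\infty;L^p(D))\cap L^2_{loc}(0,\infty;H_0^1(D))$. The constants may depend on $D,\lambda,f$. Notation: $\|\cdot\|_\gamma$ is the norm of $L^\gamma(D)$ and $\|\cdot\|=\|\cdot\|_2$. *)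

theory Defs
  imports "HOL-Analysis.Analysis"
begin

text \<open>
  The space \<open>\<real>\<^sup>N\<close> is an arbitrary type of class \<open>euclidean_space\<close> (so \<open>N = DIM('a)\<close>).
  Elements of function spaces over \<open>D\<close> are represented by functions on the whole type, whose values
  outside \<open>D\<close> are irrelevant; all measure-theoretic notions refer to \<open>lebesgue_on D\<close>.
\<close>

section \<open>Smooth functions, test functions and smooth domains\<close>

primrec Ck_on :: "nat \<Rightarrow> 'a::euclidean_space set \<Rightarrow> ('a \<Rightarrow> real) \<Rightarrow> bool" where
  "Ck_on 0 S \<phi> \<longleftrightarrow> continuous_on S \<phi>"
| "Ck_on (Suc k) S \<phi> \<longleftrightarrow> (\<forall>x\<in>S. \<phi> differentiable (at x)) \<and>
     (\<forall>v. Ck_on k S (\<lambda>x. frechet_derivative \<phi> (at x) v))"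

definition smooth :: "('a::euclidean_space \<Rightarrow> real) \<Rightarrow> bool" where
  "smooth \<phi> \<longleftrightarrow> (\<forall>k. Ck_on k UNIV \<phi>)"

text \<open>\<open>C\<^sub>c\<^sup>\<infinity>(\<Omega>)\<close>, every element being extended by zero outside \<open>\<Omega>\<close>.\<close>

definition test_functions :: "'a::euclidean_space set \<Rightarrow> ('a \<Rightarrow> real) set" where
  "test_functions \<Omega> =
     {\<phi>. smooth \<phi> \<and> (\<exists>K. compact K \<and> K \<subseteq> \<Omega> \<and> (\<forall>x. x \<notin> K \<longrightarrow> \<phi> x = 0))}"

text \<open>
  The boundary is locally the graph of a smooth function: with respect to the decomposition
  \<open>\<real>\<^sup>N = \<real>e \<oplus> e\<^sup>\<bottom>\<close> for some unit vector \<open>e\<close>, the domain is locally the part lying above a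
  smooth graph over \<open>e\<^sup>\<bottom>\<close>. The map \<open>x \<mapsto> x - (x \<bullet> e) e\<close> is the orthogonal projection onto
  \<open>e\<^sup>\<bottom>\<close>, so only the values of \<open>\<gamma>\<close> on \<open>e\<^sup>\<bottom>\<close> matter.
\<close>

definition bounded_smooth_domain :: "'a::euclidean_space set \<Rightarrow> bool" where
  "bounded_smooth_domain D \<longleftrightarrow>
     D \<noteq> {} \<and> open D \<and> connected D \<and> bounded D \<and>
     (\<forall>x0\<in>frontier D. \<exists>r>0. \<exists>e \<gamma>. norm e = 1 \<and> smooth \<gamma> \<and>
        D \<inter> ball x0 r = {x \<in> ball x0 r. x \<bullet> e > \<gamma> (x - (x \<bullet> e) *\<^sub>R e)})"

section \<open>Lebesgue and Sobolev spaces on the domain\<close>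

text \<open>
  \<open>Lnorm_pow D q v\<close> is \<open>\<parallel>v\<parallel>\<^sub>q\<^sup>q\<close>; it takes the value \<open>\<infinity>\<close> if the measurable function \<open>v\<close> is
  not in \<open>L\<^sup>q(D)\<close>.
\<close>

definition Lnorm_pow :: "'a::euclidean_space set \<Rightarrow> real \<Rightarrow> ('a \<Rightarrow> real) \<Rightarrow> ennreal" where
  "Lnorm_pow D q v = (\<integral>\<^sup>+ x. ennreal (\<bar>v x\<bar> powr q) \<partial>lebesgue_on D)"

definition Lspace :: "'a::euclidean_space set \<Rightarrow> real \<Rightarrow> ('a \<Rightarrow> real) set" where
  "Lspace D q = {v \<in> borel_measurable (lebesgue_on D). Lnorm_pow D q v < \<infinity>}"

definition pairing :: "'a::euclidean_space set \<Rightarrow> ('a \<Rightarrow> real) \<Rightarrow> ('a \<Rightarrow> real) \<Rightarrow> real" where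
  "pairing D v w = (LINT x|lebesgue_on D. v x * w x)"

definition has_weak_gradient ::
    "'a::euclidean_space set \<Rightarrow> ('a \<Rightarrow> real) \<Rightarrow> ('a \<Rightarrow> 'a) \<Rightarrow> bool" where
  "has_weak_gradient D v G \<longleftrightarrow>
     (\<forall>b\<in>Basis. (\<lambda>x. G x \<bullet> b) \<in> Lspace D 2 \<and>
        (\<forall>\<phi>\<in>test_functions D.
           pairing D v (\<lambda>x. frechet_derivative \<phi> (at x) b) = - pairing D (\<lambda>x. G x \<bullet> b) \<phi>))"

definition H1 :: "'a::euclidean_space set \<Rightarrow> ('a \<Rightarrow> real) set" where
  "H1 D = {v \<in> Lspace D 2. \<exists>G. has_weak_gradient D v G}"

text \<open>Weak gradients are unique up to null sets, hence the choice made here is immaterial.\<close>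

definition weak_gradient :: "'a::euclidean_space set \<Rightarrow> ('a \<Rightarrow> real) \<Rightarrow> 'a \<Rightarrow> 'a" where
  "weak_gradient D v = (SOME G. has_weak_gradient D v G)"

text \<open>The square of the \<open>H\<^sup>1(D)\<close> norm; meaningful for \<open>v \<in> H1 D\<close> only.\<close>

definition H1norm_sq :: "'a::euclidean_space set \<Rightarrow> ('a \<Rightarrow> real) \<Rightarrow> ennreal" where
  "H1norm_sq D v = Lnorm_pow D 2 v + Lnorm_pow D 2 (\<lambda>x. norm (weak_gradient D v x))"

text \<open>The closure of the test functions in \<open>H\<^sup>1(D)\<close>.\<close>

definition H10 :: "'a::euclidean_space set \<Rightarrow> ('a \<Rightarrow> real) set" where
  "H10 D = {v \<in> H1 D. \<exists>\<phi>. (\<forall>n. \<phi> n \<in> test_functions D) \<and>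
     (\<lambda>n::nat. H1norm_sq D (\<lambda>x. v x - \<phi> n x)) \<longlonglongrightarrow> 0}"

section \<open>Spaces of functions of time with values in a function space\<close>

text \<open>
  Here \<open>X\<close> is a space of functions on \<open>D\<close> and \<open>M\<close> is a fixed positive power of its norm.
  A function is strongly measurable if almost everywhere it is the norm limit of a sequence of
  simple functions.
\<close>

definition simple_valued ::
    "real set \<Rightarrow> ('a \<Rightarrow> real) set \<Rightarrow> (real \<Rightarrow> 'a \<Rightarrow> real) \<Rightarrow> bool" where
  "simple_valued I X s \<longleftrightarrow> finite (s ` I) \<and> s ` I \<subseteq> X \<and>
     (\<forall>w \<in> s ` I. {t \<in> I. s t = w} \<in> sets lebesgue)"

definition strongly_measurable ::
    "real set \<Rightarrow> ('a \<Rightarrow> real) set \<Rightarrow> (('a \<Rightarrow> real) \<Rightarrow> ennreal) \<Rightarrow> (real \<Rightarrow> 'a \<Rightarrow> real) \<Rightarrow> bool" where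
  "strongly_measurable I X M u \<longleftrightarrow>
     (\<exists>s. (\<forall>n. simple_valued I X (s n)) \<and>
        (AE t in lebesgue_on I. (\<lambda>n::nat. M (\<lambda>x. u t x - s n t x)) \<longlonglongrightarrow> 0))"

text \<open>If \<open>M\<close> is the \<open>q\<close>-th power of the norm of \<open>X\<close>, this is \<open>L\<^sup>q\<^sub>l\<^sub>o\<^sub>c(0,\<infinity>; X)\<close>.\<close>

definition Bochner_loc ::
    "('a \<Rightarrow> real) set \<Rightarrow> (('a \<Rightarrow> real) \<Rightarrow> ennreal) \<Rightarrow> (real \<Rightarrow> 'a \<Rightarrow> real) set" where
  "Bochner_loc X M = {u. \<forall>a b. 0 < a \<and> a < b \<longrightarrow>
     (AE t in lebesgue_on {a..b}. u t \<in> X) \<and>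
     strongly_measurable {a..b} X M u \<and>
     (\<integral>\<^sup>+ t. M (u t) \<partial>lebesgue_on {a..b}) < \<infinity>}"

definition C_L2 :: "'a::euclidean_space set \<Rightarrow> (real \<Rightarrow> 'a \<Rightarrow> real) set" where
  "C_L2 D = {u. (\<forall>t\<ge>0. u t \<in> Lspace D 2) \<and>
     (\<forall>t0\<ge>0. ((\<lambda>t. Lnorm_pow D 2 (\<lambda>x. u t x - u t0 x)) \<longlongrightarrow> 0) (at t0 within {0..}))}"

section \<open>The reaction-diffusion problem\<close>

definition nonlinearity ::
    "real \<Rightarrow> real \<Rightarrow> real \<Rightarrow> real \<Rightarrow> real \<Rightarrow> real \<Rightarrow> (real \<Rightarrow> real) \<Rightarrow> bool" where
  "nonlinearity p l \<kappa> \<alpha> \<beta> \<sigma> f \<longleftrightarrow>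
     (\<forall>s. f differentiable (at s)) \<and> continuous_on UNIV (deriv f) \<and>
     (\<forall>s. deriv f s \<ge> \<kappa> * \<bar>s\<bar> powr (p - 2) - l) \<and>
     (\<forall>s. f s * s \<ge> \<alpha> * \<bar>s\<bar> powr p - \<beta>) \<and>
     (\<forall>s. \<bar>f s\<bar> \<le> \<sigma> * \<bar>s\<bar> powr (p - 1) + \<sigma>)"

text \<open>
  The equation \<open>du/dt + lam u - \<Delta>u + f(u) = g\<close> is required to hold in the sense of distributions on
  \<open>(0,\<infinity>)\<close>, after pairing with any \<open>v \<in> H\<^sub>0\<^sup>1(D) \<inter> L\<^sup>p(D)\<close>. The boundary condition is contained in
  \<open>u(t) \<in> H\<^sub>0\<^sup>1(D)\<close> for almost every \<open>t\<close>; equality at time zero is equality in \<open>L\<^sup>2(D)\<close>.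
\<close>

definition weak_solution ::
    "'a::euclidean_space set \<Rightarrow> real \<Rightarrow> real \<Rightarrow> (real \<Rightarrow> real) \<Rightarrow> ('a \<Rightarrow> real) \<Rightarrow> ('a \<Rightarrow> real) \<Rightarrow>
     (real \<Rightarrow> 'a \<Rightarrow> real) \<Rightarrow> bool" where
  "weak_solution D lam p f g u0 u \<longleftrightarrow>
     u \<in> C_L2 D \<and>
     u \<in> Bochner_loc (Lspace D p) (Lnorm_pow D p) \<and>
     u \<in> Bochner_loc (H10 D) (H1norm_sq D) \<and>
     (AE x in lebesgue_on D. u 0 x = u0 x) \<and>
     (\<forall>v \<in> H10 D \<inter> Lspace D p. \<forall>\<psi> \<in> test_functions {0<..}.
        - (LINT t|lebesgue_on {0<..}. deriv \<psi> t * pairing D (u t) v)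
        + (LINT t|lebesgue_on {0<..}. \<psi> t *
             (lam * pairing D (u t) v
              + (LINT x|lebesgue_on D. weak_gradient D (u t) x \<bullet> weak_gradient D v x)
              + pairing D (\<lambda>x. f (u t x)) v))
        = (LINT t|lebesgue_on {0<..}. \<psi> t * pairing D g v))"

end

theory Submission
  imports Defs
begin

text \<open>
  Testing the equation with \<open>\<Phi>(u)\<close>, where \<open>\<Phi>\<close> is a nondecreasing truncation of \<open>\<bar>s\<bar>\<^sup>q\<^sup>-\<^sup>2 s\<close> with
  \<open>q = p a\<^sub>k\<close>, the diffusion term is nonnegative and the coercivity of \<open>f\<close> absorbs the source, so that
  \<open>d/dt \<parallel>u\<parallel>\<^sub>q\<^sup>q + c \<parallel>u\<parallel>\<^sub>r\<^sup>r \<le> C (\<parallel>g\<parallel>\<^sub>\<rho>\<^sup>\<rho> + 1)\<close> with \<open>r = q + p - 2 = p a\<^sub>k\<^sub>+\<^sub>1\<close> and \<open>\<rho> = r / (p - 1)\<close>, up to the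
  truncation, which is removed at the end by Fatou's lemma. Integrating in time bounds
  \<open>\<integral> \<parallel>u\<parallel>\<^sub>r\<^sup>r\<close> over a short interval by the previous norm, and averaging the inequality of the next level over
  that interval gives the pointwise bound of \<open>\<parallel>u(t)\<parallel>\<^sub>r\<^sup>r\<close>. For \<open>q = 2\<close> the term \<open>\<lambda> u\<close> provides the exponential decay.

  As \<open>du/dt\<close> exists only in a weak sense, the test is made discrete in time: by convexity of the
  antiderivative \<open>F\<close> of \<open>\<Phi>\<close>, \<open>\<integral> F(u(t)) - F(u(s)) \<le> (u(t) - u(s), \<Phi>(u(t)))\<close>, where \<open>\<Phi>(u(t))\<close> is an admissible test function
  which is constant in time. These inequalities are summed over a grid whose mesh tends to zero. The
  gradient term passes to the limit because \<open>\<nabla>u\<close> can be approximated in \<open>L\<^sup>2\<close> by \<open>\<nabla>S\<close>, where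
  \<open>S\<close> is simple in time with test functions as values, and \<open>(\<nabla>S, \<nabla>\<Phi>(u)) = - (\<Delta>S, \<Phi>(u))\<close> only involves
  the continuity of \<open>u\<close> with values in \<open>L\<^sup>2\<close>.
\<close>

section \<open>Smooth functions\<close>

text \<open>The truncation has to meet several requirements at once: boundedness, so that
  \<Phi>(u(t)) lies in L^p and can be paired with the merely integrable f(u(t)); a bounded
  nonnegative derivative, for the chain rule and the sign of the diffusion term; and smoothness, so
  that its composition with a test function is a test function again. Hence it is no cut-off at a
  level but the explicit function \<open>s * trunc_weight m e s\<close>, which tends to s (1 +
  s^2)^m as e \<rightarrow> 0, where 2 m + 2 = q. The resulting bounds do not depend on e.

  Freezing \<Phi>(u) at grid times has a price: its gradient at a single time is controlled only by
  \<nabla>u at that time, and \<nabla>u is merely square integrable in time. Each grid point is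
  therefore chosen in its cell so that |\<nabla>u|^2, integrated over D, does not exceed its mean
  over the cell.

  One constant has to serve all g, u0 and u, so the constants are explicit expressions in the fixed
  parameters. Exponential decay is proved in L^2 only; each further level looks back by a fixed time
  \<delta>, which costs a factor exp(lam \<delta>).\<close>

lemma Ck_on_imp_continuous:
  fixes \<phi> :: "'a::euclidean_space \<Rightarrow> real"
  shows "Ck_on k UNIV \<phi> \<Longrightarrow> continuous_on UNIV \<phi>"
  by (cases k) (auto simp: continuous_on_eq_continuous_at differentiable_imp_continuous_within)

lemma Ck_on_SucD: "Ck_on (Suc k) UNIV \<phi> \<Longrightarrow> Ck_on k UNIV \<phi>"
proof (induction k arbitrary: \<phi>)
  case 0
  then show ?case using Ck_on_imp_continuous[of "Suc 0" \<phi>] by simp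
next
  case (Suc k)
  then show ?case by (metis Ck_on.simps(2))
qed

text \<open>\<open>Ck_on\<close> recurses through \<open>frechet_derivative\<close>. By uniqueness
  of derivatives any closed form of the derivative may be used instead, which turns the closure
  properties below into inductions with the usual rules of differentiation.\<close>

lemma Ck_on_SucI:
  assumes "\<And>x. (\<phi> has_derivative \<phi>' x) (at x)" and "\<And>v. Ck_on k UNIV (\<lambda>x. \<phi>' x v)"
  shows "Ck_on (Suc k) UNIV \<phi>"
proof -
  have "frechet_derivative \<phi> (at x) = \<phi>' x" for x
    using assms(1) frechet_derivative_at by metis
  then show ?thesis using assms by (auto simp: differentiable_def)
qed

lemma Ck_on_SucE:
  assumes "Ck_on (Suc k) UNIV \<phi>"
  obtains \<phi>' where "\<And>x. (\<phi> has_derivative \<phi>' x) (at x)" "\<And>v. Ck_on k UNIV (\<lambda>x. \<phi>' x v)"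
  using that[of "\<lambda>x. frechet_derivative \<phi> (at x)"] assms by (auto simp: frechet_derivative_works)

lemma Ck_on_const: "Ck_on k UNIV (\<lambda>x. c)"
proof (induction k arbitrary: c)
  case (Suc k)
  show ?case by (rule Ck_on_SucI[where \<phi>'="\<lambda>x v. 0"]) (auto intro: Suc)
qed simp

lemma Ck_on_add: "Ck_on k UNIV \<phi> \<Longrightarrow> Ck_on k UNIV \<eta> \<Longrightarrow> Ck_on k UNIV (\<lambda>x. \<phi> x + \<eta> x)"
proof (induction k arbitrary: \<phi> \<eta>)
  case 0 then show ?case by (auto intro: continuous_intros)
next
  case (Suc k)
  obtain p where p: "\<And>x. (\<phi> has_derivative p x) (at x)" "\<And>v. Ck_on k UNIV (\<lambda>x. p x v)"
    using Suc.prems(1) by (metis Ck_on_SucE)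
  obtain q where q: "\<And>x. (\<eta> has_derivative q x) (at x)" "\<And>v. Ck_on k UNIV (\<lambda>x. q x v)"
    using Suc.prems(2) by (metis Ck_on_SucE)
  show ?case
    by (rule Ck_on_SucI[where \<phi>'="\<lambda>x v. p x v + q x v"])
       (auto intro!: derivative_eq_intros p q Suc.IH)
qed

lemma Ck_on_mult: "Ck_on k UNIV \<phi> \<Longrightarrow> Ck_on k UNIV \<eta> \<Longrightarrow> Ck_on k UNIV (\<lambda>x. \<phi> x * \<eta> x)"
proof (induction k arbitrary: \<phi> \<eta>)
  case 0 then show ?case by (auto intro: continuous_intros)
next
  case (Suc k)
  obtain p where p: "\<And>x. (\<phi> has_derivative p x) (at x)" "\<And>v. Ck_on k UNIV (\<lambda>x. p x v)"
    using Suc.prems(1) by (metis Ck_on_SucE)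
  obtain q where q: "\<And>x. (\<eta> has_derivative q x) (at x)" "\<And>v. Ck_on k UNIV (\<lambda>x. q x v)"
    using Suc.prems(2) by (metis Ck_on_SucE)
  show ?case
    by (rule Ck_on_SucI[where \<phi>'="\<lambda>x v. \<phi> x * q x v + p x v * \<eta> x"])
       (auto intro!: derivative_eq_intros p q Suc.IH Ck_on_add Ck_on_SucD[OF Suc.prems(1)] Ck_on_SucD[OF Suc.prems(2)])
qed

text \<open>The exponent is general in the induction because differentiation lowers it by one. A
  positive base admits every real exponent, also negative ones, and this is how quotients are
  treated later.\<close>

lemma Ck_on_powr:
  assumes "\<And>x. \<phi> x > 0"
  shows "Ck_on k UNIV \<phi> \<Longrightarrow> Ck_on k UNIV (\<lambda>x. \<phi> x powr r)"
proof (induction k arbitrary: r)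
  case 0 then show ?case using assms by (auto intro!: continuous_intros simp: less_imp_neq[THEN not_sym])
next
  case (Suc k)
  obtain p where p: "\<And>x. (\<phi> has_derivative p x) (at x)" "\<And>v. Ck_on k UNIV (\<lambda>x. p x v)"
    using Suc.prems(1) by (metis Ck_on_SucE)
  have "((\<lambda>x. \<phi> x powr r) has_derivative (\<lambda>v. (r * \<phi> x powr (r - 1)) * p x v)) (at x)" for x
  proof -
    have "((\<lambda>y. y powr r) has_real_derivative r * \<phi> x powr (r - 1)) (at (\<phi> x))"
      by (rule has_real_derivative_powr) (use assms in auto)
    then have "((\<lambda>y. y powr r) has_derivative (\<lambda>h. (r * \<phi> x powr (r - 1)) * h)) (at (\<phi> x))"
      by (simp add: has_field_derivative_def)
    from diff_chain_at[OF p(1) this] show ?thesis by (simp add: o_def)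
  qed
  then show ?case
    by (rule Ck_on_SucI[where \<phi>'="\<lambda>x v. (r * \<phi> x powr (r - 1)) * p x v"])
       (auto intro!: Ck_on_mult Ck_on_const p Suc.IH Ck_on_SucD[OF Suc.prems])
qed

lemma smoothD:
  assumes "smooth \<phi>"
  shows smooth_differentiable: "\<phi> differentiable (at x)"
    and smooth_has_derivative: "(\<phi> has_derivative frechet_derivative \<phi> (at x)) (at x)"
    and smooth_continuous_on: "continuous_on S \<phi>"
    and smooth_frechet: "smooth (\<lambda>x. frechet_derivative \<phi> (at x) v)"
proof -
  have "Ck_on (Suc 0) UNIV \<phi>" using assms by (simp only: smooth_def)
  then show "\<phi> differentiable (at x)" by simp
  then show "(\<phi> has_derivative frechet_derivative \<phi> (at x)) (at x)"
    by (simp add: frechet_derivative_works)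
  show "continuous_on S \<phi>" 
    using \<open>Ck_on (Suc 0) UNIV \<phi>\<close>[THEN Ck_on_imp_continuous] continuous_on_subset by blast
  show "smooth (\<lambda>x. frechet_derivative \<phi> (at x) v)"
    using assms unfolding smooth_def by (metis Ck_on.simps(2))
qed

lemma smooth_const: "smooth (\<lambda>x. c)" by (simp add: smooth_def Ck_on_const)
lemma smooth_add: "smooth \<phi> \<Longrightarrow> smooth \<eta> \<Longrightarrow> smooth (\<lambda>x. \<phi> x + \<eta> x)" by (simp add: smooth_def Ck_on_add)
lemma smooth_mult: "smooth \<phi> \<Longrightarrow> smooth \<eta> \<Longrightarrow> smooth (\<lambda>x. \<phi> x * \<eta> x)" by (simp add: smooth_def Ck_on_mult)
lemma smooth_powr: "smooth \<phi> \<Longrightarrow> (\<And>x. \<phi> x > 0) \<Longrightarrow> smooth (\<lambda>x. \<phi> x powr r)" by (simp add: smooth_def Ck_on_powr)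
lemma smooth_diff: "smooth \<phi> \<Longrightarrow> smooth \<eta> \<Longrightarrow> smooth (\<lambda>x. \<phi> x - \<eta> x)"
  using smooth_add[of \<phi> "\<lambda>x. (-1) * \<eta> x"] smooth_mult[OF smooth_const[of "-1"], of \<eta>] by simp
lemma smooth_prod: "finite I \<Longrightarrow> (\<And>i. i \<in> I \<Longrightarrow> smooth (\<phi> i)) \<Longrightarrow> smooth (\<lambda>x. \<Prod>i\<in>I. \<phi> i x)"
  by (induction I rule: finite_induct) (auto intro: smooth_const smooth_mult)

lemma smooth_inner: "smooth (\<lambda>x. x \<bullet> b)"
proof -
  have "Ck_on k UNIV (\<lambda>x. x \<bullet> b)" for k
  proof (cases k)
    case (Suc m)
    show ?thesis unfolding Suc
      by (rule Ck_on_SucI[where \<phi>'="\<lambda>x v. v \<bullet> b"]) (auto intro!: derivative_eq_intros Ck_on_const)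
  qed (auto intro: continuous_intros)
  then show ?thesis by (simp add: smooth_def)
qed

section \<open>A smooth step function from 0 to 1\<close>

definition exp_recip :: "nat \<Rightarrow> real \<Rightarrow> real" where
  "exp_recip m x = (if x > 0 then inverse x ^ m * exp (- inverse x) else 0)"

lemma power_le_fact_exp: assumes "y > (0::real)" shows "y ^ n \<le> fact n * exp y"
proof -
  have "(\<Sum>k\<in>{n}. y ^ k /\<^sub>R fact k) \<le> exp y"
    unfolding exp_def
    by (rule sum_le_suminf) (use assms summable_exp_generic[of y] in \<open>auto\<close>)
  then show ?thesis by (simp add: field_simps)
qed

text \<open>The functions x^(-m) exp(-1/x), extended by zero to x \<le> 0, form a family in m so
  that the derivative of a member is a combination of two others; smoothness of all members then
  follows by induction on the order, with m general.\<close>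

lemma exp_recip_has_derivative:
  "(exp_recip m has_real_derivative (- real m * exp_recip (m + 1) x + exp_recip (m + 2) x)) (at x)"
proof -
  consider "x > 0" | "x < 0" | "x = 0" by linarith
  then show ?thesis
  proof cases
    case 1
    have aux: "n = 0" if "x ^ n \<noteq> x * x ^ (n - Suc 0)" for n using that by (cases n) auto
    have "((\<lambda>x. inverse x ^ m * exp (- inverse x)) has_real_derivative
       (- real m * exp_recip (m + 1) x + exp_recip (m + 2) x)) (at x)"
      using 1 aux by (cases m) (auto intro!: derivative_eq_intros simp: exp_recip_def field_simps power2_eq_square)
    moreover have "\<forall>\<^sub>F y in nhds x. exp_recip m y = inverse y ^ m * exp (- inverse y)"
      using eventually_nhds_in_open[of "{0<..}" x] 1 by (auto elim!: eventually_mono simp: exp_recip_def)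
    ultimately show ?thesis by (rule iffD2[OF DERIV_cong_ev[OF refl _ refl], rotated])
  next
    case 2
    have "\<forall>\<^sub>F y in nhds x. exp_recip m y = 0"
      using eventually_nhds_in_open[of "{..<0}" x] 2 by (auto elim!: eventually_mono simp: exp_recip_def)
    moreover have "((\<lambda>x. 0) has_real_derivative (- real m * exp_recip (m + 1) x + exp_recip (m + 2) x)) (at x)"
      using 2 by (simp add: exp_recip_def)
    ultimately show ?thesis by (rule iffD2[OF DERIV_cong_ev[OF refl _ refl]])
  next
    case 3
    \<comment> \<open>For h > 0 the difference quotient at 0 is h^(-m-2) exp(-1/h) times h. With y =
      1/h the first factor is y^(m+2) exp(-y) \<le> (m+2)!, so the derivative at 0 is 0.\<close>
    have b: "\<bar>exp_recip m h / h\<bar> \<le> fact (m + 2) * \<bar>h\<bar>" for h :: real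
    proof (cases "h > 0")
      case True
      have "inverse h ^ (m + 2) \<le> fact (m + 2) * exp (inverse h)" by (rule power_le_fact_exp) (use True in simp)
      then have "inverse h ^ (m + 2) * exp (- inverse h) \<le> fact (m + 2)"
        using mult_right_mono[of _ _ "exp (- inverse h)"] by (metis exp_ge_zero exp_minus_inverse mult.assoc mult.right_neutral)
      then have "inverse h ^ (m + 2) * exp (- inverse h) * h \<le> fact (m + 2) * h"
        using True by (intro mult_right_mono) auto
      moreover have "exp_recip m h / h = inverse h ^ (m + 2) * exp (- inverse h) * h"
        using True by (simp add: exp_recip_def field_simps power2_eq_square)
      ultimately show ?thesis using True by (simp add: exp_recip_def)
    next
      case False
      then have "\<bar>exp_recip m h / h\<bar> = 0" by (simp add: exp_recip_def)
      also have "0 \<le> fact (m + 2) * \<bar>h\<bar>" by (intro mult_nonneg_nonneg) auto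
      finally show ?thesis .
    qed
    have "((\<lambda>h. exp_recip m h / h) \<longlongrightarrow> 0) (at 0)"
    proof (rule Lim_null_comparison)
      show "\<forall>\<^sub>F h in at 0. norm (exp_recip m h / h) \<le> fact (m + 2) * \<bar>h\<bar>" using b by simp
      show "((\<lambda>h::real. fact (m + 2) * \<bar>h\<bar>) \<longlongrightarrow> 0) (at 0)" by (auto intro!: tendsto_eq_intros)
    qed
    then show ?thesis using 3 by (simp add: DERIV_def exp_recip_def)
  qed
qed

lemma smooth_exp_recip: assumes "smooth \<phi>" shows "smooth (\<lambda>x. exp_recip m (\<phi> x))"
proof -
  have "Ck_on k UNIV (\<lambda>x. exp_recip m (\<phi> x))" for k
  proof (induction k arbitrary: m)
    case 0
    have "continuous_on UNIV (exp_recip m)"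
      using exp_recip_has_derivative by (meson DERIV_isCont continuous_at_imp_continuous_on)
    then have "continuous_on UNIV (exp_recip m \<circ> \<phi>)"
      by (intro continuous_on_compose smooth_continuous_on[OF assms]) (auto intro: continuous_on_subset)
    then show ?case by (simp add: o_def)
  next
    case (Suc k)
    obtain p where p: "\<And>x. (\<phi> has_derivative p x) (at x)" "\<And>v. Ck_on k UNIV (\<lambda>x. p x v)"
      using assms unfolding smooth_def by (metis Ck_on_SucE)
    have "((\<lambda>x. exp_recip m (\<phi> x)) has_derivative
        (\<lambda>v. (- real m * exp_recip (m + 1) (\<phi> x) + exp_recip (m + 2) (\<phi> x)) * p x v)) (at x)" for x
      using diff_chain_at[OF p(1) exp_recip_has_derivative[of m "\<phi> x", unfolded has_field_derivative_def]]
      by (simp add: o_def)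
    then show ?case
      by (rule Ck_on_SucI) (intro Ck_on_mult Ck_on_add Ck_on_const p Suc)
  qed
  then show ?thesis by (simp add: smooth_def)
qed

text \<open>The classical quotient r(x) / (r(x) + r(1 - x)), where r(x) = exp(-1/x) for x > 0 and
  r(x) = 0 otherwise. The division is written as a power with exponent -1, so that
  \<open>smooth_powr\<close> applies to the positive denominator.\<close>

definition smooth_step :: "real \<Rightarrow> real" where
  "smooth_step x = exp_recip 0 x * (exp_recip 0 x + exp_recip 0 (1 - x)) powr (-1)"

lemma exp_recip_0_nonneg: "exp_recip 0 x \<ge> 0" by (simp add: exp_recip_def)
lemma smooth_step_denom_pos: "exp_recip 0 x + exp_recip 0 (1 - x) > 0"
proof (cases "x > 0")
  case True
  then have "exp_recip 0 x > 0" by (simp add: exp_recip_def)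
  then show ?thesis using exp_recip_0_nonneg[of "1 - x"] by linarith
next
  case False
  then have "exp_recip 0 (1 - x) > 0" by (simp add: exp_recip_def)
  then show ?thesis using exp_recip_0_nonneg[of x] by linarith
qed

lemma smooth_smooth_step: "smooth \<phi> \<Longrightarrow> smooth (\<lambda>x. smooth_step (\<phi> x))"
  unfolding smooth_step_def
  by (intro smooth_mult smooth_exp_recip smooth_powr smooth_add smooth_diff smooth_const smooth_step_denom_pos)

lemma smooth_step_le_0: "x \<le> 0 \<Longrightarrow> smooth_step x = 0"
  by (simp add: smooth_step_def exp_recip_def)

lemma smooth_step_ge_1: "x \<ge> 1 \<Longrightarrow> smooth_step x = 1"
  by (simp add: smooth_step_def exp_recip_def powr_minus)

lemma smooth_step_bounds: "0 \<le> smooth_step x" "smooth_step x \<le> 1"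
  using exp_recip_0_nonneg[of x] exp_recip_0_nonneg[of "1 - x"] smooth_step_denom_pos[of x]
  by (auto simp: smooth_step_def powr_minus divide_simps)

section \<open>The fundamental lemma of the calculus of variations\<close>

lemma box_bump:
  fixes a b :: "'a::euclidean_space"
  obtains \<phi> where "\<And>n. \<phi> n \<in> test_functions (box a b)" "\<And>n x. 0 \<le> \<phi> n x \<and> \<phi> n x \<le> 1"
    "\<And>x. (\<lambda>n. \<phi> n x) \<longlonglongrightarrow> indicat_real (box a b) x"
proof -
  \<comment> \<open>The shift by -1 makes each factor vanish within distance 1/(n+1) of its face, so
    the product is supported in a compact box inside the open one. At a fixed interior point all
    factors equal 1 for large n.\<close>
  define s where "s n i x = smooth_step (real (Suc n) * (x \<bullet> i - a \<bullet> i) - 1) *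
     smooth_step (real (Suc n) * (b \<bullet> i - x \<bullet> i) - 1)" for n i and x :: 'a
  define \<phi> where "\<phi> n x = (\<Prod>i\<in>Basis. s n i x)" for n x
  have b: "0 \<le> s n i x" "s n i x \<le> 1" for n i x
    by (auto simp: s_def intro!: mult_nonneg_nonneg mult_le_one smooth_step_bounds)
  have sm: "smooth (\<phi> n)" for n
    unfolding \<phi>_def s_def
    by (intro smooth_prod smooth_mult smooth_smooth_step smooth_diff smooth_const smooth_inner finite_Basis)
  have supp: "\<phi> n x = 0" if nx: "x \<notin> cbox (a + inverse (real (Suc n)) *\<^sub>R One) (b - inverse (real (Suc n)) *\<^sub>R One)" for n x
  proof -
    obtain i where i: "i \<in> Basis" "x \<bullet> i < a \<bullet> i + inverse (real (Suc n)) \<or> x \<bullet> i > b \<bullet> i - inverse (real (Suc n))"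
      using nx by (force simp: mem_box inner_simps not_le)
    have "s n i x = 0"
    proof (cases "x \<bullet> i < a \<bullet> i + inverse (real (Suc n))")
      case True
      then have "x \<bullet> i - a \<bullet> i < inverse (real (Suc n))" by linarith
      then have "real (Suc n) * (x \<bullet> i - a \<bullet> i) - 1 \<le> 0"
        by (simp add: field_simps del: of_nat_Suc)
      then show ?thesis by (simp add: s_def smooth_step_le_0 del: of_nat_Suc)
    next
      case False
      then have "b \<bullet> i - x \<bullet> i < inverse (real (Suc n))" using i by linarith
      then have "real (Suc n) * (b \<bullet> i - x \<bullet> i) - 1 \<le> 0"
        by (simp add: field_simps del: of_nat_Suc)
      then show ?thesis by (simp add: s_def smooth_step_le_0 del: of_nat_Suc)
    qed
    then show ?thesis using i unfolding \<phi>_def by (intro prod_zero) auto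
  qed
  have sub: "cbox (a + inverse (real (Suc n)) *\<^sub>R One) (b - inverse (real (Suc n)) *\<^sub>R One) \<subseteq> box a b" for n
    unfolding subset_box by (auto simp: inner_simps simp del: of_nat_Suc)
  have lim: "(\<lambda>n. \<phi> n x) \<longlonglongrightarrow> indicat_real (box a b) x" for x
  proof (cases "x \<in> box a b")
    case True
    have big: "\<forall>\<^sub>F n in sequentially. real (Suc n) * c - 1 \<ge> 1" if "c > 0" for c
    proof -
      have "filterlim (\<lambda>n. real (Suc n) * c) at_top sequentially"
        using that by (intro filterlim_at_top_mult_tendsto_pos[OF tendsto_const] 
           filterlim_compose[OF filterlim_real_sequentially filterlim_Suc]) auto
      then have "\<forall>\<^sub>F n in sequentially. real (Suc n) * c \<ge> 2" by (simp add: filterlim_at_top)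
      then show ?thesis by eventually_elim simp
    qed
    have "\<forall>\<^sub>F n in sequentially. \<forall>i\<in>Basis. s n i x = 1"
    proof (rule eventually_ball_finite[OF finite_Basis], rule ballI)
      fix i :: 'a assume "i \<in> Basis"
      then have "x \<bullet> i - a \<bullet> i > 0" "b \<bullet> i - x \<bullet> i > 0" using True by (auto simp: mem_box)
      from big[OF this(1)] big[OF this(2)] show "\<forall>\<^sub>F n in sequentially. s n i x = 1"
        by eventually_elim (simp add: s_def smooth_step_ge_1)
    qed
    then have "\<forall>\<^sub>F n in sequentially. \<phi> n x = 1" by eventually_elim (simp add: \<phi>_def)
    then show ?thesis using True by (simp add: tendsto_eventually)
  next
    case False
    then have "\<phi> n x = 0" for n using supp sub by blast
    then show ?thesis using False by simp
  qed
  show ?thesis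
  proof
    show "\<phi> n \<in> test_functions (box a b)" for n
      unfolding test_functions_def
      by (intro CollectI conjI exI[of _ "cbox (a + inverse (real (Suc n)) *\<^sub>R One) (b - inverse (real (Suc n)) *\<^sub>R One)"]
          allI impI sm supp sub compact_cbox)
    show "0 \<le> \<phi> n x \<and> \<phi> n x \<le> 1" for n x
      by (auto simp: \<phi>_def b intro!: prod_nonneg prod_le_1)
  qed (rule lim)
qed

lemma test_functions_mono: "U \<subseteq> V \<Longrightarrow> test_functions U \<subseteq> test_functions V"
  by (auto simp: test_functions_def)

lemma test_functions_smooth: "\<phi> \<in> test_functions U \<Longrightarrow> smooth \<phi>"
  by (simp add: test_functions_def)

lemma test_functions_zero: "(\<lambda>x. 0) \<in> test_functions U"
  by (auto simp: test_functions_def smooth_const intro: exI[of _ "{}"])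

lemma test_functions_mult_left:
  assumes "\<phi> \<in> test_functions U" "smooth \<eta>" shows "(\<lambda>x. \<eta> x * \<phi> x) \<in> test_functions U"
  using assms by (auto simp: test_functions_def intro!: smooth_mult)

lemma test_functions_add:
  assumes "\<phi> \<in> test_functions U" "\<eta> \<in> test_functions U"
  shows "(\<lambda>x. \<phi> x + \<eta> x) \<in> test_functions U"
proof -
  obtain K L where "compact K" "K \<subseteq> U" "\<forall>x. x \<notin> K \<longrightarrow> \<phi> x = 0" "compact L" "L \<subseteq> U" "\<forall>x. x \<notin> L \<longrightarrow> \<eta> x = 0"
    using assms by (auto simp: test_functions_def)
  then have "compact (K \<union> L) \<and> K \<union> L \<subseteq> U \<and> (\<forall>x. x \<notin> K \<union> L \<longrightarrow> \<phi> x + \<eta> x = 0)" by auto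
  then show ?thesis using assms smooth_add unfolding test_functions_def by blast
qed

lemma test_functions_indicator:
  fixes U :: "'a::euclidean_space set"
  assumes "open U"
  obtains \<phi> where "\<And>n::nat. \<phi> n \<in> test_functions U" "\<And>n x. 0 \<le> \<phi> n x \<and> \<phi> n x \<le> 1"
    "\<And>x. (\<lambda>n. \<phi> n x) \<longlonglongrightarrow> indicat_real U x"
proof -
  obtain \<D> where D: "countable \<D>" "\<D> \<subseteq> Pow U" "\<And>X. X \<in> \<D> \<Longrightarrow> \<exists>a b. X = box a b" "\<Union>\<D> = U"
    using open_countable_Union_open_box[OF assms] by metis
  \<comment> \<open>The empty box is added so that the enumeration also makes sense when the
    countable family is empty.\<close>
  define B where "B = from_nat_into (insert {} \<D>)"
  have rB: "range B = insert {} \<D>" unfolding B_def by (rule range_from_nat_into) (use D in auto)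
  have "\<exists>a b. B i = box a b" for i
  proof -
    have "B i \<in> insert {} \<D>" using rB by blast
    moreover have "box 0 0 = ({}::'a set)" by (simp add: box_eq_empty)
    ultimately show ?thesis using D(3) by (metis insert_iff)
  qed
  then have "\<exists>\<phi>. (\<forall>n. \<phi> n \<in> test_functions (B i)) \<and> (\<forall>n x. 0 \<le> \<phi> n x \<and> \<phi> n x \<le> 1) \<and>
     (\<forall>x. (\<lambda>n. \<phi> n x) \<longlonglongrightarrow> indicat_real (B i) x)" for i
    using box_bump by metis
  then obtain \<phi> where p: "\<And>i n. \<phi> i n \<in> test_functions (B i)"
     "\<And>i n x. 0 \<le> \<phi> i n x \<and> \<phi> i n x \<le> 1"
     "\<And>i x. (\<lambda>n. \<phi> i n x) \<longlonglongrightarrow> indicat_real (B i) x" by metis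
  \<comment> \<open>A smooth substitute for the maximum of finitely many bumps: it stays in [0,1],
    vanishes where all of them vanish, and is at least \<open>\<phi> i n\<close> for each i <
    n.\<close>
  define f where "f n x = 1 - (\<Prod>i<n. 1 - \<phi> i n x)" for n x
  have BU: "B i \<subseteq> U" for i using rB D(2) by blast
  have b: "0 \<le> (\<Prod>i<n. 1 - \<phi> i n x)" "(\<Prod>i<n. 1 - \<phi> i n x) \<le> 1" for n x
    using p(2) by (auto intro!: prod_nonneg prod_le_1 simp: )
  show ?thesis
  proof
    fix n
    have "(\<lambda>x. 1 - (\<Prod>i<m. 1 - \<phi> i n x)) \<in> test_functions U" for m
    proof (induction m)
      case 0 show ?case using test_functions_zero by simp
    next
      case (Suc m)
      have "smooth (\<lambda>x. \<Prod>i<m. 1 - \<phi> i n x)"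
        using p(1) by (intro smooth_prod smooth_diff smooth_const) (auto intro: test_functions_smooth)
      moreover have "\<phi> m n \<in> test_functions U" using p(1) test_functions_mono[OF BU] by blast
      ultimately have "(\<lambda>x. (1 - (\<Prod>i<m. 1 - \<phi> i n x)) + (\<Prod>i<m. 1 - \<phi> i n x) * \<phi> m n x) \<in> test_functions U"
        by (intro test_functions_add test_functions_mult_left Suc.IH)
      moreover have "(\<lambda>x. (1 - (\<Prod>i<m. 1 - \<phi> i n x)) + (\<Prod>i<m. 1 - \<phi> i n x) * \<phi> m n x)
         = (\<lambda>x. 1 - (\<Prod>i<Suc m. 1 - \<phi> i n x))" by (auto simp: algebra_simps)
      ultimately show ?case by simp
    qed
    then show "f n \<in> test_functions U" unfolding f_def by blast
    show "0 \<le> f n x \<and> f n x \<le> 1" for x using b by (simp add: f_def)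
  next
    fix x
    show "(\<lambda>n. f n x) \<longlonglongrightarrow> indicat_real U x"
    proof (cases "x \<in> U")
      case False
      then have "\<phi> i n x = 0" for i n using p(1)[of i n] BU[of i] by (auto simp: test_functions_def)
      then show ?thesis using False by (simp add: f_def)
    next
      case True
      then obtain j where j: "x \<in> B j" using D(4) rB by auto
      have "(\<lambda>n. \<phi> j n x) \<longlonglongrightarrow> 1" using p(3)[of j x] j by simp
      moreover have "\<forall>\<^sub>F n in sequentially. \<phi> j n x \<le> f n x"
        using eventually_gt_at_top[of j]
      proof eventually_elim
        case (elim n)
        have "(\<Prod>i<n. 1 - \<phi> i n x) = (1 - \<phi> j n x) * (\<Prod>i\<in>{..<n}-{j}. 1 - \<phi> i n x)"
          using elim by (intro prod.remove) auto
        also have "\<dots> \<le> (1 - \<phi> j n x) * 1"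
          using p(2) by (intro mult_left_mono prod_le_1) auto
        finally show ?case by (simp add: f_def)
      qed
      moreover have "\<forall>\<^sub>F n in sequentially. f n x \<le> 1" using b by (simp add: f_def)
      ultimately show ?thesis using True tendsto_sandwich[of "\<lambda>n. \<phi> j n x" "\<lambda>n. f n x" sequentially "\<lambda>n. 1" 1] by simp
    qed
  qed
qed

lemma smooth_borel_measurable: "smooth \<phi> \<Longrightarrow> \<phi> \<in> borel_measurable (lebesgue_on D)"
  using smooth_continuous_on[of \<phi> UNIV]
  by (intro measurable_restrict_space1 measurable_completion) (simp add: borel_measurable_continuous_onI)

text \<open>By dominated convergence the identity extends from test functions to indicators of open
  subsets of D, then to D intersected with countable intersections of open sets, and hence to every
  measurable subset of D, which differs from such a set by a null set. The sets where w is positive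
  and where it is negative give the claim.\<close>

lemma fundamental_lemma:
  fixes D :: "'a::euclidean_space set"
  assumes D: "open D" and w: "integrable (lebesgue_on D) w"
    and test: "\<And>\<phi>. \<phi> \<in> test_functions D \<Longrightarrow> (LINT x|lebesgue_on D. w x * \<phi> x) = 0"
  shows "AE x in lebesgue_on D. w x = 0"
proof -
  have [measurable]: "w \<in> borel_measurable (lebesgue_on D)" using w by auto
  have [simp]: "D \<in> sets lebesgue" using D by auto
  have sp: "space (lebesgue_on D) = D" by (simp add: space_restrict_space)
  have mA: "A \<inter> D \<in> sets (lebesgue_on D)" if "A \<in> sets lebesgue" for A
    using that by (auto simp: sets_restrict_space)
  have ind: "indicat_real A \<in> borel_measurable (lebesgue_on D)" if "A \<in> sets lebesgue" for A
    using that by (intro measurable_restrict_space1 borel_measurable_indicator)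
  have dct: "(LINT x|lebesgue_on D. w x * indicat_real A x) = 0"
    if A: "A \<in> sets lebesgue" and \<phi>: "\<And>n. \<phi> n \<in> borel_measurable (lebesgue_on D)"
      "\<And>n x. 0 \<le> \<phi> n x \<and> \<phi> n x \<le> 1" "\<And>x. (\<lambda>n. \<phi> n x) \<longlonglongrightarrow> indicat_real A x"
      "\<And>n::nat. (LINT x|lebesgue_on D. w x * \<phi> n x) = 0" for A and \<phi> :: "nat \<Rightarrow> 'a \<Rightarrow> real"
  proof -
    note [measurable] = \<phi>(1) ind[OF A]
    have "(\<lambda>n. LINT x|lebesgue_on D. w x * \<phi> n x) \<longlonglongrightarrow> (LINT x|lebesgue_on D. w x * indicat_real A x)"
    proof (rule integral_dominated_convergence[where w="\<lambda>x. \<bar>w x\<bar>"])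
      show "AE x in lebesgue_on D. (\<lambda>n. w x * \<phi> n x) \<longlonglongrightarrow> w x * indicat_real A x"
        using \<phi>(3) by (intro AE_I2 tendsto_mult) auto
      show "AE x in lebesgue_on D. norm (w x * \<phi> n x) \<le> \<bar>w x\<bar>" for n
        using \<phi>(2)[of n] by (intro AE_I2) (auto simp: abs_mult intro: mult_left_le)
    qed (use w in auto)
    then show ?thesis using \<phi>(4) LIMSEQ_unique[OF tendsto_const[of 0]] by auto
  qed
  have op: "(LINT x|lebesgue_on D. w x * indicat_real U x) = 0" if U: "open U" "U \<subseteq> D" for U
  proof -
    obtain \<phi> where "\<And>n::nat. \<phi> n \<in> test_functions U" "\<And>n x. 0 \<le> \<phi> n x \<and> \<phi> n x \<le> 1"
      "\<And>x. (\<lambda>n. \<phi> n x) \<longlonglongrightarrow> indicat_real U x"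
      using test_functions_indicator[OF U(1)] by metis
    then show ?thesis
      using U subsetD[OF test_functions_mono[OF U(2)]] test
      by (intro dct[of U \<phi>]) (auto intro: smooth_borel_measurable test_functions_smooth)
  qed
  have meas: "(LINT x|lebesgue_on D. w x * indicat_real S x) = 0" if S: "S \<in> sets lebesgue" "S \<subseteq> D" for S
  proof -
    obtain C T where C: "gdelta C" "T \<in> null_sets lebesgue" "S \<union> T = C" "disjnt S T"
      using lebesgue_set_almost_gdelta[OF S(1)] by metis
    have Cs: "C \<in> sets lebesgue" unfolding C(3)[symmetric] using S(1) null_setsD2[OF C(2)] by (rule sets.Un)
    obtain F where F: "\<And>n::nat. open (F n)" "C = (\<Inter>n. F n)"
      using C(1) by (auto elim!: gdelta.cases)
    define V where "V n = D \<inter> (\<Inter>i\<le>n. F i)" for n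
    have V: "open (V n)" "V n \<subseteq> D" for n unfolding V_def using D F by auto
    have "(LINT x|lebesgue_on D. w x * indicat_real (C \<inter> D) x) = 0"
    proof (rule dct[where \<phi>="\<lambda>n. indicat_real (V n)"])
      show "C \<inter> D \<in> sets lebesgue" using Cs by (intro sets.Int) auto
      show "indicat_real (V n) \<in> borel_measurable (lebesgue_on D)" for n using V by (intro ind) auto
      show "(\<lambda>n. indicat_real (V n) x) \<longlonglongrightarrow> indicat_real (C \<inter> D) x" for x
      proof (cases "x \<in> C \<inter> D")
        case True
        then have "x \<in> V n" for n by (auto simp: V_def F)
        then show ?thesis using True by simp
      next
        case False
        show ?thesis
        proof (cases "x \<in> D")
          case True
          then obtain k where k: "x \<notin> F k" using False F by auto
          have "\<forall>\<^sub>F n in sequentially. indicat_real (V n) x = 0"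
            using eventually_ge_at_top[of k] by eventually_elim (use k in \<open>auto simp: V_def indicator_def\<close>)
          then show ?thesis using False by (simp add: tendsto_eventually)
        qed (use False in \<open>simp add: V_def\<close>)
      qed
    qed (use op V in auto)
    moreover have "(LINT x|lebesgue_on D. w x * indicat_real (C \<inter> D) x) = (LINT x|lebesgue_on D. w x * indicat_real S x)"
    proof (rule integral_cong_AE)
      have "AE x in lebesgue. x \<notin> T" using C(2) by (rule AE_not_in)
      then have "AE x in lebesgue_on D. x \<notin> T" by (auto simp: AE_restrict_space_iff elim: eventually_mono)
      then show "AE x in lebesgue_on D. w x * indicat_real (C \<inter> D) x = w x * indicat_real S x"
        by eventually_elim (use C S in \<open>auto simp: indicator_def\<close>)
      have "C \<inter> D \<in> sets lebesgue" using Cs by (intro sets.Int) auto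
      from ind[OF this] ind[OF S(1)] show
         "(\<lambda>x. w x * indicat_real (C \<inter> D) x) \<in> borel_measurable (lebesgue_on D)"
         "(\<lambda>x. w x * indicat_real S x) \<in> borel_measurable (lebesgue_on D)" by auto
    qed
    ultimately show ?thesis by simp
  qed
  have half: "AE x in lebesgue_on D. v x \<le> 0" 
    if v: "integrable (lebesgue_on D) v" "\<And>S. S \<in> sets lebesgue \<Longrightarrow> S \<subseteq> D \<Longrightarrow> (LINT x|lebesgue_on D. v x * indicat_real S x) = 0" for v :: "'a \<Rightarrow> real"
  proof -
    have [measurable]: "v \<in> borel_measurable (lebesgue_on D)" using v by auto
    define S where "S = {x\<in>space (lebesgue_on D). v x > 0}"
    have S': "S \<in> sets (lebesgue_on D)" unfolding S_def by measurable
    then have S: "S \<in> sets lebesgue" "S \<subseteq> D" using sets_restrict_space_iff[of D lebesgue S] S_def sp by auto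
    have "integrable (lebesgue_on D) (\<lambda>x. v x * indicat_real S x)"
      using integrable_mult_indicator[OF S' v(1)] by (simp add: mult.commute)
    moreover have "AE x in lebesgue_on D. 0 \<le> v x * indicat_real S x"
      by (intro AE_I2) (auto simp: S_def indicator_def)
    ultimately have "AE x in lebesgue_on D. v x * indicat_real S x = 0"
      using integral_nonneg_eq_0_iff_AE v(2)[OF S] by blast
    moreover have "AE x in lebesgue_on D. x \<in> D" by (rule AE_I2) (simp add: sp)
    ultimately show ?thesis by eventually_elim (auto simp: S_def sp indicator_def split: if_splits)
  qed
  have "AE x in lebesgue_on D. w x \<le> 0" using half[OF w meas] .
  moreover have "AE x in lebesgue_on D. - w x \<le> 0" using half[of "\<lambda>x. - w x"] w meas by simp
  ultimately show ?thesis by eventually_elim auto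
qed

section \<open>Square integrable functions\<close>

text \<open>Values in a Euclidean space are allowed so that the same lemmas serve solutions and
  their gradients. For real functions over \<open>lebesgue_on D\<close> this is membership in
  \<open>Lspace D 2\<close>.\<close>

definition square_integrable :: "'a measure \<Rightarrow> ('a \<Rightarrow> 'b::euclidean_space) \<Rightarrow> bool" where
  "square_integrable M G \<longleftrightarrow> G \<in> borel_measurable M \<and> integrable M (\<lambda>x. (norm (G x))\<^sup>2)"

lemma square_integrableD:
  assumes "square_integrable M G"
  shows "G \<in> borel_measurable M" "integrable M (\<lambda>x. (norm (G x))\<^sup>2)"
  using assms by (auto simp: square_integrable_def)

lemma square_integrable_bound:
  fixes G :: "'a \<Rightarrow> 'b::euclidean_space" and H :: "'a \<Rightarrow> 'c::euclidean_space"
  assumes "square_integrable M G" "H \<in> borel_measurable M" "\<And>x. x \<in> space M \<Longrightarrow> norm (H x) \<le> c * norm (G x)"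
  shows "square_integrable M H"
proof -
  have "integrable M (\<lambda>x. c\<^sup>2 * (norm (G x))\<^sup>2)" using assms(1) by (simp add: square_integrable_def)
  moreover have "AE x in M. norm ((norm (H x))\<^sup>2) \<le> norm (c\<^sup>2 * (norm (G x))\<^sup>2)"
  proof (rule AE_I2)
    fix x assume "x \<in> space M"
    from power_mono[OF assms(3)[OF this], of 2]
    show "norm ((norm (H x))\<^sup>2) \<le> norm (c\<^sup>2 * (norm (G x))\<^sup>2)" by (simp add: power_mult_distrib)
  qed
  moreover have "(\<lambda>x. (norm (H x))\<^sup>2) \<in> borel_measurable M" using assms(2) by measurable
  ultimately show ?thesis
    using assms(2) Bochner_Integration.integrable_bound unfolding square_integrable_def by blast
qed

lemma square_integrable_add:
  fixes G H :: "'a \<Rightarrow> 'b::euclidean_space"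
  assumes "square_integrable M G" "square_integrable M H"
  shows "square_integrable M (\<lambda>x. G x + H x)"
proof -
  note [measurable] = assms[THEN square_integrableD(1)]
  have i: "integrable M (\<lambda>x. 2 * (norm (G x))\<^sup>2 + 2 * (norm (H x))\<^sup>2)"
    using assms by (simp add: square_integrable_def)
  have "(norm (G x + H x))\<^sup>2 \<le> 2 * (norm (G x))\<^sup>2 + 2 * (norm (H x))\<^sup>2" for x
  proof -
    have "(norm (G x + H x))\<^sup>2 \<le> (norm (G x) + norm (H x))\<^sup>2"
      by (intro power_mono norm_triangle_ineq) auto
    also have "\<dots> \<le> 2 * (norm (G x))\<^sup>2 + 2 * (norm (H x))\<^sup>2"
      using sum_squares_bound[of "norm (G x)" "norm (H x)"] by (simp add: power2_sum)
    finally show ?thesis .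
  qed
  then show ?thesis unfolding square_integrable_def
    by (auto intro!: Bochner_Integration.integrable_bound[OF i] AE_I2)
qed

lemma square_integrable_scaleR:
  "square_integrable M G \<Longrightarrow> square_integrable M (\<lambda>x. c *\<^sub>R G x)"
  by (auto simp: square_integrable_def power_mult_distrib)

lemma square_integrable_diff:
  "square_integrable M G \<Longrightarrow> square_integrable M H \<Longrightarrow> square_integrable M (\<lambda>x. G x - H x)"
  using square_integrable_add[OF _ square_integrable_scaleR[of M H "-1"], of G] by simp

lemma square_integrable_zero: "square_integrable M (\<lambda>x. 0)" by (simp add: square_integrable_def)

lemma integrable_inner:
  assumes "square_integrable M G" "square_integrable M H"
  shows "integrable M (\<lambda>x. G x \<bullet> H x)"
proof -
  note [measurable] = assms[THEN square_integrableD(1)]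
  have i: "integrable M (\<lambda>x. (norm (G x))\<^sup>2 + (norm (H x))\<^sup>2)" using assms by (simp add: square_integrable_def)
  have "\<bar>G x \<bullet> H x\<bar> \<le> (norm (G x))\<^sup>2 + (norm (H x))\<^sup>2" for x
    using Cauchy_Schwarz_ineq2[of "G x" "H x"] sum_squares_bound[of "norm (G x)" "norm (H x)"]
      mult_nonneg_nonneg[of "norm (G x)" "norm (H x)"] by auto
  then show ?thesis by (auto intro!: Bochner_Integration.integrable_bound[OF i] AE_I2)
qed

lemma square_integrable_real_mult:
  fixes u v :: "'a \<Rightarrow> real"
  assumes "square_integrable M u" "square_integrable M v"
  shows "integrable M (\<lambda>x. u x * v x)"
  using integrable_inner[OF assms] by simp

lemma integral_norm_sq_add:
  assumes "square_integrable M G" "square_integrable M H"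
  shows "(\<integral>x. (norm (G x + t *\<^sub>R H x))\<^sup>2 \<partial>M) =
    (\<integral>x. (norm (G x))\<^sup>2 \<partial>M) + 2 * t * (\<integral>x. G x \<bullet> H x \<partial>M) + t\<^sup>2 * (\<integral>x. (norm (H x))\<^sup>2 \<partial>M)"
proof -
  have "(norm (G x + t *\<^sub>R H x))\<^sup>2 = (norm (G x))\<^sup>2 + (2 * t) * (G x \<bullet> H x) + t\<^sup>2 * (norm (H x))\<^sup>2" for x
    unfolding power2_norm_eq_inner by (simp add: inner_simps inner_commute power2_eq_square algebra_simps)
  then show ?thesis using integrable_inner[OF assms] assms[THEN square_integrableD(2)] by simp
qed

text \<open>The quadratic polynomial in t given by the integral of |G + t H|^2 is nonnegative. If
  its leading coefficient vanishes it is affine and must be constant; otherwise it is evaluated at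
  its minimum.\<close>

lemma Cauchy_Schwarz_integral:
  assumes "square_integrable M G" "square_integrable M H"
  shows "\<bar>\<integral>x. G x \<bullet> H x \<partial>M\<bar> \<le> sqrt (\<integral>x. (norm (G x))\<^sup>2 \<partial>M) * sqrt (\<integral>x. (norm (H x))\<^sup>2 \<partial>M)"
proof -
  let ?A = "\<integral>x. (norm (G x))\<^sup>2 \<partial>M" and ?B = "\<integral>x. G x \<bullet> H x \<partial>M" and ?C = "\<integral>x. (norm (H x))\<^sup>2 \<partial>M"
  have q: "0 \<le> ?A + 2 * t * ?B + t\<^sup>2 * ?C" for t
    unfolding integral_norm_sq_add[OF assms, symmetric] by simp
  have C: "?C \<ge> 0" by simp
  have "?B\<^sup>2 \<le> ?A * ?C"
  proof (cases "?C = 0")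
    case True
    have "?B = 0"
    proof (rule ccontr)
      assume "?B \<noteq> 0"
      \<comment> \<open>At this t the polynomial would take the value -1.\<close>
      then show False using q[of "- (?A + 1) / (2 * ?B)"] True by (simp add: field_simps)
    qed
    then show ?thesis using True by simp
  next
    case False
    then have C': "?C > 0" using C by linarith
    have "A + 2 * (- b / c) * b + (- b / c)\<^sup>2 * c = A - b\<^sup>2 / c" if "c > 0" for A b c :: real
      using that by (simp add: field_simps power2_eq_square)
    from q[of "- ?B / ?C", unfolded this[OF C']] have "?B\<^sup>2 / ?C \<le> ?A" by linarith
    then show ?thesis by (simp only: pos_divide_le_eq[OF C'])
  qed
  then have "sqrt (?B\<^sup>2) \<le> sqrt (?A * ?C)" by (rule real_sqrt_le_mono)
  then show ?thesis by (simp add: real_sqrt_mult)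
qed

lemma tendsto_integral_inner:
  assumes "\<And>n. square_integrable M (G n)" "square_integrable M H" "square_integrable M W"
    and "((\<lambda>n. \<integral>x. (norm (G n x - H x))\<^sup>2 \<partial>M) \<longlongrightarrow> 0) F"
  shows "((\<lambda>n. \<integral>x. G n x \<bullet> W x \<partial>M) \<longlongrightarrow> (\<integral>x. H x \<bullet> W x \<partial>M)) F"
proof (rule Lim_transform_bound[where f="\<lambda>n. \<integral>x. (G n x - H x) \<bullet> W x \<partial>M" and 
    g="\<lambda>n. sqrt (\<integral>x. (norm (G n x - H x))\<^sup>2 \<partial>M) * sqrt (\<integral>x. (norm (W x))\<^sup>2 \<partial>M)", THEN LIM_zero_cancel[OF tendsto_cong[THEN iffD1, rotated]]])
  show "\<forall>\<^sub>F n in F. norm (\<integral>x. (G n x - H x) \<bullet> W x \<partial>M)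
     \<le> norm (sqrt (\<integral>x. (norm (G n x - H x))\<^sup>2 \<partial>M) * sqrt (\<integral>x. (norm (W x))\<^sup>2 \<partial>M))"
    using Cauchy_Schwarz_integral[OF square_integrable_diff[OF assms(1,2)] assms(3)] 
    by (auto intro!: always_eventually intro: order_trans[OF _ abs_ge_self])
  show "((\<lambda>n. sqrt (\<integral>x. (norm (G n x - H x))\<^sup>2 \<partial>M) * sqrt (\<integral>x. (norm (W x))\<^sup>2 \<partial>M)) \<longlongrightarrow> 0) F"
    using assms(4) by (auto intro!: tendsto_eq_intros)
  show "\<forall>\<^sub>F n in F. (\<integral>x. (G n x - H x) \<bullet> W x \<partial>M) = (\<integral>x. G n x \<bullet> W x \<partial>M) - (\<integral>x. H x \<bullet> W x \<partial>M)"
    using integrable_inner[OF assms(1,3)] integrable_inner[OF assms(2,3)]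
    by (auto simp: inner_diff_left intro!: always_eventually)
qed

lemma tendsto_integral_norm_sq:
  assumes "\<And>n. square_integrable M (G n)" "square_integrable M H" 
    and "((\<lambda>n. \<integral>x. (norm (G n x - H x))\<^sup>2 \<partial>M) \<longlongrightarrow> 0) F"
  shows "((\<lambda>n. \<integral>x. (norm (G n x))\<^sup>2 \<partial>M) \<longlongrightarrow> (\<integral>x. (norm (H x))\<^sup>2 \<partial>M)) F"
proof -
  have "(\<integral>x. (norm (G n x))\<^sup>2 \<partial>M) = (\<integral>x. (norm (G n x - H x))\<^sup>2 \<partial>M)
     + 2 * ((\<integral>x. G n x \<bullet> H x \<partial>M) - (\<integral>x. (norm (H x))\<^sup>2 \<partial>M)) + (\<integral>x. (norm (H x))\<^sup>2 \<partial>M)" for n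
  proof -
    have "(norm (G n x - H x))\<^sup>2 = (norm (G n x))\<^sup>2 - 2 * (G n x \<bullet> H x) + (norm (H x))\<^sup>2" for x
      by (simp add: power2_norm_eq_inner inner_simps inner_commute)
    then show ?thesis
      using integrable_inner[OF assms(1,2)] assms(1,2)[THEN square_integrableD(2)] by simp
  qed
  moreover have "((\<lambda>n. \<integral>x. G n x \<bullet> H x \<partial>M) \<longlongrightarrow> (\<integral>x. (norm (H x))\<^sup>2 \<partial>M)) F"
    using tendsto_integral_inner[OF assms(1,2,2,3)] by (simp add: power2_norm_eq_inner)
  ultimately show ?thesis using assms(3) by (auto intro!: tendsto_eq_intros)
qed

lemma Lspace_2_iff: "v \<in> Lspace D 2 \<longleftrightarrow> square_integrable (lebesgue_on D) v"
proof -
  have *: "\<bar>v x\<bar> powr 2 = (norm (v x))\<^sup>2" for x :: 'a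
    by (cases "v x = 0") (auto simp: powr_numeral)
  show ?thesis
    unfolding Lspace_def square_integrable_def Lnorm_pow_def *
    by (auto simp: integrable_iff_bounded)
qed

lemma Lnorm_pow_2:
  assumes "square_integrable (lebesgue_on D) v"
  shows "Lnorm_pow D 2 v = ennreal (\<integral>x. (norm (v x))\<^sup>2 \<partial>lebesgue_on D)"
proof -
  have *: "\<bar>v x\<bar> powr 2 = (norm (v x))\<^sup>2" for x
    by (cases "v x = 0") (auto simp: powr_numeral)
  show ?thesis unfolding Lnorm_pow_def *
    using square_integrableD(2)[OF assms] by (intro nn_integral_eq_integral) auto
qed

lemma square_integrable_components:
  fixes G :: "'a \<Rightarrow> 'b::euclidean_space"
  shows "square_integrable M G \<longleftrightarrow> (\<forall>b\<in>Basis. square_integrable M (\<lambda>x. G x \<bullet> b))"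
proof
  assume G: "square_integrable M G"
  then show "\<forall>b\<in>Basis. square_integrable M (\<lambda>x. G x \<bullet> b)"
    using square_integrableD(1)[OF G]
    by (auto intro!: square_integrable_bound[OF G, where c=1] Basis_le_norm borel_measurable_inner)
next
  assume *: "\<forall>b\<in>Basis. square_integrable M (\<lambda>x. G x \<bullet> b)"
  have "G \<in> borel_measurable M"
    using * square_integrableD(1) by (subst borel_measurable_euclidean_space) auto
  moreover have "(norm (G x))\<^sup>2 = (\<Sum>b\<in>Basis. (norm (G x \<bullet> b))\<^sup>2)" for x
    unfolding power2_norm_eq_inner by (subst euclidean_inner) (simp add: power2_eq_square)
  ultimately show "square_integrable M G"
    using * square_integrableD(2) by (auto simp: square_integrable_def)
qed

section \<open>Classical gradients and integration by parts for test functions\<close>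

definition gradient :: "('a::euclidean_space \<Rightarrow> real) \<Rightarrow> 'a \<Rightarrow> 'a" where
  "gradient \<phi> x = (\<Sum>b\<in>Basis. frechet_derivative \<phi> (at x) b *\<^sub>R b)"

lemma gradient_inner_Basis: "b \<in> Basis \<Longrightarrow> gradient \<phi> x \<bullet> b = frechet_derivative \<phi> (at x) b"
  by (simp add: gradient_def)

lemma has_weak_gradient_iff:
  "has_weak_gradient D v G \<longleftrightarrow> square_integrable (lebesgue_on D) G \<and>
     (\<forall>\<phi>\<in>test_functions D. \<forall>b\<in>Basis. (LINT x|lebesgue_on D. v x * frechet_derivative \<phi> (at x) b)
        = - (LINT x|lebesgue_on D. (G x \<bullet> b) * \<phi> x))"
  unfolding has_weak_gradient_def Lspace_2_iff square_integrable_components[of _ G] pairing_def by auto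

lemma frechet_derivative_test:
  assumes "\<phi> \<in> test_functions D"
  shows "(\<lambda>x. frechet_derivative \<phi> (at x) b) \<in> test_functions D"
proof -
  obtain K where K: "compact K" "K \<subseteq> D" "\<And>x. x \<notin> K \<Longrightarrow> \<phi> x = 0" and s: "smooth \<phi>"
    using assms by (auto simp: test_functions_def)
  have "frechet_derivative \<phi> (at x) b = 0" if "x \<notin> K" for x
  proof -
    have "(\<phi> has_derivative (\<lambda>_. 0)) (at x)"
    proof (rule has_derivative_transform_within_open[where f="\<lambda>_. 0" and s="- K"])
      show "open (- K)" using K by (simp add: open_Compl compact_imp_closed)
    qed (use that K in auto)
    then show ?thesis using frechet_derivative_at by metis
  qed
  then show ?thesis using K s smooth_frechet unfolding test_functions_def by blast
qed

lemma test_functions_bounded: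
  assumes "\<phi> \<in> test_functions D"
  obtains B where "B > 0" "\<And>x. \<bar>\<phi> x\<bar> \<le> B"
proof -
  obtain K where K: "compact K" "\<And>x. x \<notin> K \<Longrightarrow> \<phi> x = 0" and s: "smooth \<phi>"
    using assms by (auto simp: test_functions_def)
  have "bounded (\<phi> ` K)" using K s by (intro compact_imp_bounded compact_continuous_image smooth_continuous_on)
  then obtain B where "B > 0" "\<forall>x\<in>K. \<bar>\<phi> x\<bar> \<le> B" by (auto simp: bounded_pos)
  then show ?thesis using K(2) by (intro that[of B]) (metis abs_zero less_imp_le)+
qed

lemma line_has_derivative:
  fixes \<phi> :: "'a::euclidean_space \<Rightarrow> real"
  assumes "smooth \<phi>"
  shows "((\<lambda>s. \<phi> (x + s *\<^sub>R b)) has_real_derivative frechet_derivative \<phi> (at (x + s *\<^sub>R b)) b) (at s)"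
proof -
  let ?f = "frechet_derivative \<phi> (at (x + s *\<^sub>R b))"
  have h: "(\<phi> has_derivative ?f) (at (x + s *\<^sub>R b))" using smooth_has_derivative[OF assms] .
  have "((\<lambda>s. x + s *\<^sub>R b) has_derivative (\<lambda>t. t *\<^sub>R b)) (at s)"
    by (auto intro!: derivative_eq_intros)
  from diff_chain_at[OF this h]
  have "((\<lambda>s. \<phi> (x + s *\<^sub>R b)) has_derivative (\<lambda>t. ?f (t *\<^sub>R b))) (at s)" by (simp add: o_def)
  moreover have "?f (t *\<^sub>R b) = ?f b * t" for t
    using linear_scale[OF has_derivative_linear[OF h]] by simp
  ultimately show ?thesis by (simp add: has_field_derivative_def)
qed

text \<open>Translation invariance of Lebesgue measure makes the integral of every difference
  quotient in direction b zero. The quotients converge pointwise to the directional derivative; the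
  mean value theorem bounds them by a constant, and steps of length at most 1 keep their supports in
  one ball.\<close>

lemma integral_frechet_derivative_test:
  fixes \<phi> :: "'a::euclidean_space \<Rightarrow> real"
  assumes "\<phi> \<in> test_functions UNIV"
  shows "(\<integral>x. frechet_derivative \<phi> (at x) b \<partial>lborel) = 0"
proof -
  let ?d = "\<lambda>x. frechet_derivative \<phi> (at x) b"
  obtain K where K: "compact K" "\<And>x. x \<notin> K \<Longrightarrow> \<phi> x = 0" and s: "smooth \<phi>"
    using assms by (auto simp: test_functions_def)
  obtain B where B: "B > 0" "\<And>x. \<bar>?d x\<bar> \<le> B" using test_functions_bounded[OF frechet_derivative_test[OF assms]] by metis
  obtain R where R: "\<And>x. x \<in> K \<Longrightarrow> norm x \<le> R" using compact_imp_bounded[OF K(1)] by (auto simp: bounded_iff)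
  have [measurable]: "\<phi> \<in> borel_measurable borel" using smooth_continuous_on[OF s] by (rule borel_measurable_continuous_onI)
  have [measurable]: "?d \<in> borel_measurable borel"
    using smooth_continuous_on[OF smooth_frechet[OF s]] by (rule borel_measurable_continuous_onI)
  have i\<phi>: "integrable lborel \<phi>"
  proof -
    obtain C where "\<And>x. \<bar>\<phi> x\<bar> \<le> C" using test_functions_bounded[OF assms] by metis
    then show ?thesis using K emeasure_compact_finite[OF K(1)] 
      by (intro integrableI_bounded_set[where A=K and B=C]) (auto intro: AE_I2 borel_compact)
  qed
  define t where "t n = inverse (real (Suc n))" for n
  have t: "t n > 0" "t n \<le> 1" for n by (auto simp: t_def field_simps)
  have t0: "t \<longlonglongrightarrow> 0" unfolding t_def by (rule LIMSEQ_inverse_real_of_nat)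
  define q where "q n x = (\<phi> (x + t n *\<^sub>R b) - \<phi> x) / t n" for n x
  have shift: "integrable lborel (\<lambda>x. \<phi> (x + c)) \<and> (\<integral>x. \<phi> (x + c) \<partial>lborel) = (\<integral>x. \<phi> x \<partial>lborel)" for c
    using lborel_distr_plus[of c] integral_distr[of "(+) c" lborel borel \<phi>] integrable_distr_eq[of "(+) c" lborel borel \<phi>] i\<phi>
    by (simp add: add.commute)
  have "(\<integral>x. q n x \<partial>lborel) = 0" for n
    using shift[of "t n *\<^sub>R b"] i\<phi> by (simp add: q_def)
  moreover have "(\<lambda>n. \<integral>x. q n x \<partial>lborel) \<longlonglongrightarrow> (\<integral>x. ?d x \<partial>lborel)"
  proof (rule integral_dominated_convergence[where w="\<lambda>x. B * indicator (cball 0 (R + norm b)) x"])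
    show "integrable lborel (\<lambda>x. B * indicator (cball 0 (R + norm b)) x)"
      by (intro integrable_mult_right integrable_real_indicator) (auto simp: emeasure_bounded_finite[unfolded infinity_ennreal_def])
    show "AE x in lborel. (\<lambda>n. q n x) \<longlonglongrightarrow> ?d x"
    proof (rule AE_I2)
      fix x
      have "((\<lambda>h. (\<phi> (x + h *\<^sub>R b) - \<phi> x) / h) \<longlongrightarrow> ?d x) (at 0)"
        using line_has_derivative[OF s, of x b 0] by (simp add: DERIV_def)
      then show "(\<lambda>n. q n x) \<longlonglongrightarrow> ?d x"
        unfolding q_def by (rule filterlim_compose) (use t t0 in \<open>auto simp: filterlim_at less_imp_neq[THEN not_sym]\<close>)
    qed
    show "AE x in lborel. norm (q n x) \<le> B * indicator (cball 0 (R + norm b)) x" for n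
    proof (rule AE_I2)
      fix x
      show "norm (q n x) \<le> B * indicator (cball 0 (R + norm b)) x"
      proof (cases "norm x \<le> R + norm b")
        case True
        obtain z where z: "\<phi> (x + t n *\<^sub>R b) - \<phi> (x + 0 *\<^sub>R b) = (t n - 0) * ?d (x + z *\<^sub>R b)"
          using MVT2[of 0 "t n" "\<lambda>s. \<phi> (x + s *\<^sub>R b)" "\<lambda>s. ?d (x + s *\<^sub>R b)"] t[of n] line_has_derivative[OF s] by blast
        then have "q n x = ?d (x + z *\<^sub>R b)" using t[of n] by (simp add: q_def)
        then show ?thesis using B(2) True by simp
      next
        case False
        have "x \<notin> K" using False R[of x] by (smt (verit) norm_ge_zero)
        moreover have "x + t n *\<^sub>R b \<notin> K"
        proof
          assume "x + t n *\<^sub>R b \<in> K"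
          then have "norm (x + t n *\<^sub>R b) \<le> R" by (rule R)
          moreover have "norm x \<le> norm (x + t n *\<^sub>R b) + norm (t n *\<^sub>R b)" by (metis add_diff_cancel_right' norm_triangle_ineq4)
          moreover have "norm (t n *\<^sub>R b) \<le> norm b" using t[of n] by (simp add: mult_left_le_one_le)
          ultimately show False using False by linarith
        qed
        ultimately show ?thesis using K B by (simp add: q_def)
      qed
    qed
  qed (auto simp: q_def)
  ultimately show ?thesis using LIMSEQ_unique[OF tendsto_const[of 0]] by auto
qed

lemma frechet_derivative_mult_smooth:
  assumes "smooth \<phi>" "smooth \<eta>"
  shows "frechet_derivative (\<lambda>x. \<phi> x * \<eta> x) (at x) b =
    \<phi> x * frechet_derivative \<eta> (at x) b + frechet_derivative \<phi> (at x) b * \<eta> x"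
  using frechet_derivative_at[OF has_derivative_mult[OF smooth_has_derivative[OF assms(1)] smooth_has_derivative[OF assms(2)]], symmetric]
  by simp

section \<open>The space \<open>H\<^sub>0\<^sup>1(D)\<close>\<close>

lemma test_square_integrable:
  assumes "\<phi> \<in> test_functions UNIV" "finite_measure (lebesgue_on D)"
  shows "square_integrable (lebesgue_on D) \<phi>"
proof -
  obtain B where "\<And>x. \<bar>\<phi> x\<bar> \<le> B" using test_functions_bounded[OF assms(1)] by metis
  then have B: "norm (\<phi> x) \<le> B * norm (1::real)" for x by simp
  have "square_integrable (lebesgue_on D) (\<lambda>x. 1::real)"
    using assms(2) by (simp add: square_integrable_def finite_measure.integrable_const)
  then show ?thesis
    by (rule square_integrable_bound[where c=B])
      (use assms B in \<open>auto intro: smooth_borel_measurable test_functions_smooth\<close>)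
qed

locale bounded_open =
  fixes D :: "'a::euclidean_space set"
  assumes open_D: "open D" and bounded_D: "bounded D"
begin

abbreviation "L \<equiv> lebesgue_on D"

lemma D_sets[simp]: "D \<in> sets lebesgue" using open_D by auto

lemma space_L[simp]: "space L = D" by (simp add: space_restrict_space)

sublocale L: finite_measure L
proof
  have "emeasure L (space L) = emeasure lborel D" using open_D by (simp add: emeasure_restrict_space)
  also have "\<dots> < \<infinity>" using bounded_D by (rule emeasure_bounded_finite)
  finally show "emeasure L (space L) \<noteq> \<infinity>" by simp
qed

lemma test_UNIV: "\<phi> \<in> test_functions D \<Longrightarrow> \<phi> \<in> test_functions UNIV"
  using test_functions_mono[of D UNIV] by auto

lemma test_sq: "\<phi> \<in> test_functions D \<Longrightarrow> square_integrable L \<phi>"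
  using test_square_integrable test_UNIV L.finite_measure_axioms by blast

lemma frechet_test_sq: "\<phi> \<in> test_functions D \<Longrightarrow> square_integrable L (\<lambda>x. frechet_derivative \<phi> (at x) b)"
  by (intro test_sq frechet_derivative_test)

lemma gradient_sq: "\<phi> \<in> test_functions D \<Longrightarrow> square_integrable L (gradient \<phi>)"
  unfolding square_integrable_components[of _ "gradient \<phi>"] using frechet_test_sq by (simp add: gradient_inner_Basis)

lemma integral_L_frechet_derivative:
  assumes "\<phi> \<in> test_functions D"
  shows "(\<integral>x. frechet_derivative \<phi> (at x) b \<partial>L) = 0"
proof -
  have s: "smooth \<phi>" using assms by (rule test_functions_smooth)
  have "(\<integral>x. frechet_derivative \<phi> (at x) b \<partial>L) = (\<integral>x. indicator D x *\<^sub>R frechet_derivative \<phi> (at x) b \<partial>lebesgue)"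
    by (intro integral_restrict_space) auto
  also have "(\<lambda>x. indicator D x *\<^sub>R frechet_derivative \<phi> (at x) b) = (\<lambda>x. frechet_derivative \<phi> (at x) b)"
    using frechet_derivative_test[OF assms, of b] by (fastforce simp: test_functions_def indicator_def fun_eq_iff)
  also have "(\<integral>x. frechet_derivative \<phi> (at x) b \<partial>lebesgue) = (\<integral>x. frechet_derivative \<phi> (at x) b \<partial>lborel)"
    using smooth_continuous_on[OF smooth_frechet[OF s]] 
    by (intro integral_completion) (simp add: borel_measurable_continuous_onI)
  also have "\<dots> = 0" by (rule integral_frechet_derivative_test[OF test_UNIV[OF assms]])
  finally show ?thesis .
qed

lemma integration_by_parts_test:
  assumes "\<phi> \<in> test_functions D" "\<eta> \<in> test_functions D"
  shows "(\<integral>x. \<phi> x * frechet_derivative \<eta> (at x) b \<partial>L) = - (\<integral>x. frechet_derivative \<phi> (at x) b * \<eta> x \<partial>L)"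
proof -
  have s: "smooth \<phi>" "smooth \<eta>" using assms by (auto dest: test_functions_smooth)
  have "(\<integral>x. frechet_derivative (\<lambda>x. \<phi> x * \<eta> x) (at x) b \<partial>L) = 0"
    by (intro integral_L_frechet_derivative test_functions_mult_left assms s)
  then have "(\<integral>x. \<phi> x * frechet_derivative \<eta> (at x) b + frechet_derivative \<phi> (at x) b * \<eta> x \<partial>L) = 0"
    by (simp add: frechet_derivative_mult_smooth[OF s])
  moreover have "integrable L (\<lambda>x. \<phi> x * frechet_derivative \<eta> (at x) b)"
      "integrable L (\<lambda>x. frechet_derivative \<phi> (at x) b * \<eta> x)"
    using assms by (auto intro!: square_integrable_real_mult test_sq frechet_test_sq)
  ultimately show ?thesis by simp
qed

text \<open>Since \<open>weak_gradient\<close> is an arbitrary choice, this is what allows integrals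
  of it to be computed from any weak gradient at hand, such as the classical gradient of a test
  function or the one given by the chain rule.\<close>

lemma weak_gradient_unique:
  assumes "has_weak_gradient D v G" "has_weak_gradient D v H"
  shows "AE x in L. G x = H x"
proof -
  have sq: "square_integrable L G" "square_integrable L H" using assms by (auto simp: has_weak_gradient_iff)
  have b1: "square_integrable L (\<lambda>x. b)" for b :: 'a by (simp add: square_integrable_def)
  have "AE x in L. (G x - H x) \<bullet> b = 0" if b: "b \<in> Basis" for b
  proof (rule fundamental_lemma[OF open_D])
    show "integrable L (\<lambda>x. (G x - H x) \<bullet> b)"
      by (intro integrable_inner square_integrable_diff sq b1)
  next
    fix \<phi> assume \<phi>: "\<phi> \<in> test_functions D"
    have sc: "square_integrable L (\<lambda>x. G x \<bullet> b)" "square_integrable L (\<lambda>x. H x \<bullet> b)"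
      using sq b square_integrable_components[of L G] square_integrable_components[of L H] by auto
    have "integrable L (\<lambda>x. (G x \<bullet> b) * \<phi> x)" "integrable L (\<lambda>x. (H x \<bullet> b) * \<phi> x)"
      using sc \<phi> by (auto intro!: square_integrable_real_mult test_sq)
    moreover have "(\<integral>x. (G x \<bullet> b) * \<phi> x \<partial>L) = (\<integral>x. (H x \<bullet> b) * \<phi> x \<partial>L)"
      using assms \<phi> b unfolding has_weak_gradient_iff by fastforce
    ultimately show "(\<integral>x. ((G x - H x) \<bullet> b) * \<phi> x \<partial>L) = 0"
      by (simp add: inner_diff_left left_diff_distrib)
  qed
  then have "AE x in L. \<forall>b\<in>Basis. (G x - H x) \<bullet> b = 0"
    by (intro AE_finite_allI) auto
  then show ?thesis by eventually_elim (auto intro: euclidean_eqI simp: inner_diff_left)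
qed

lemma H1_iff: "v \<in> H1 D \<longleftrightarrow> square_integrable L v \<and> has_weak_gradient D v (weak_gradient D v)"
  unfolding H1_def Lspace_2_iff weak_gradient_def using someI_ex[of "has_weak_gradient D v"] by auto

lemma weak_gradient_sq: "v \<in> H1 D \<Longrightarrow> square_integrable L (weak_gradient D v)"
  by (simp add: H1_iff has_weak_gradient_iff)

lemma has_weak_gradient_diff:
  assumes "has_weak_gradient D v G" "has_weak_gradient D w H" "square_integrable L v" "square_integrable L w"
  shows "has_weak_gradient D (\<lambda>x. v x - w x) (\<lambda>x. G x - H x)"
  unfolding has_weak_gradient_iff
proof (intro conjI ballI)
  have sq: "square_integrable L G" "square_integrable L H" using assms by (auto simp: has_weak_gradient_iff)
  then show "square_integrable L (\<lambda>x. G x - H x)" by (rule square_integrable_diff)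
  fix \<phi> b assume \<phi>: "\<phi> \<in> test_functions D" and b: "b \<in> (Basis::'a set)"
  have sc: "square_integrable L (\<lambda>x. G x \<bullet> b)" "square_integrable L (\<lambda>x. H x \<bullet> b)"
    using sq b square_integrable_components[of L G] square_integrable_components[of L H] by auto
  have i: "integrable L (\<lambda>x. (G x \<bullet> b) * \<phi> x)" "integrable L (\<lambda>x. (H x \<bullet> b) * \<phi> x)"
    "integrable L (\<lambda>x. v x * frechet_derivative \<phi> (at x) b)" "integrable L (\<lambda>x. w x * frechet_derivative \<phi> (at x) b)"
    using sc \<phi> assms(3,4) by (auto intro!: square_integrable_real_mult test_sq frechet_test_sq)
  have "(\<integral>x. v x * frechet_derivative \<phi> (at x) b \<partial>L) = - (\<integral>x. (G x \<bullet> b) * \<phi> x \<partial>L)"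
    "(\<integral>x. w x * frechet_derivative \<phi> (at x) b \<partial>L) = - (\<integral>x. (H x \<bullet> b) * \<phi> x \<partial>L)"
    using assms \<phi> b by (auto simp: has_weak_gradient_iff)
  then show "(\<integral>x. (v x - w x) * frechet_derivative \<phi> (at x) b \<partial>L) = - (\<integral>x. ((G x - H x) \<bullet> b) * \<phi> x \<partial>L)"
    using i by (simp add: inner_diff_left left_diff_distrib)
qed

lemma has_weak_gradient_test: "\<phi> \<in> test_functions D \<Longrightarrow> has_weak_gradient D \<phi> (gradient \<phi>)"
  using integration_by_parts_test by (simp add: has_weak_gradient_iff gradient_sq gradient_inner_Basis)

text \<open>Replaces the chosen gradient inside the norm by any known one. Convergence in the H^1
  norm thereby becomes convergence of two real integrals.\<close>

lemma H1norm_sq_eq: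
  assumes "square_integrable L v" "has_weak_gradient D v G"
  shows "H1norm_sq D v = ennreal ((\<integral>x. (norm (v x))\<^sup>2 \<partial>L) + (\<integral>x. (norm (G x))\<^sup>2 \<partial>L))"
proof -
  have v: "v \<in> H1 D" using assms by (auto simp: H1_def Lspace_2_iff)
  then have wg: "has_weak_gradient D v (weak_gradient D v)" by (simp add: H1_iff)
  note sq = weak_gradient_sq[OF v]
  have G: "square_integrable L G" using assms by (simp add: has_weak_gradient_iff)
  note [measurable] = square_integrableD(1)[OF G] square_integrableD(1)[OF sq]
  have "square_integrable L (\<lambda>x. norm (weak_gradient D v x))"
    using sq by (auto simp: square_integrable_def)
  then have "Lnorm_pow D 2 (\<lambda>x. norm (weak_gradient D v x)) = ennreal (\<integral>x. (norm (weak_gradient D v x))\<^sup>2 \<partial>L)"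
    by (simp add: Lnorm_pow_2)
  also have "(\<integral>x. (norm (weak_gradient D v x))\<^sup>2 \<partial>L) = (\<integral>x. (norm (G x))\<^sup>2 \<partial>L)"
    using weak_gradient_unique[OF wg assms(2)] by (intro integral_cong_AE) auto
  finally show ?thesis unfolding H1norm_sq_def Lnorm_pow_2[OF assms(1)] by simp
qed

lemma ennreal_add_tendsto_0:
  assumes "\<And>n. a n \<ge> (0::real)" "\<And>n. b n \<ge> 0"
  shows "((\<lambda>n. ennreal (a n + b n)) \<longlongrightarrow> 0) F \<longleftrightarrow> (a \<longlongrightarrow> 0) F \<and> (b \<longlongrightarrow> 0) F"
proof -
  have "((\<lambda>n. ennreal (a n + b n)) \<longlongrightarrow> ennreal 0) F \<longleftrightarrow> ((\<lambda>n. a n + b n) \<longlongrightarrow> 0) F"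
    by (intro tendsto_ennreal_iff) (auto simp: assms)
  also have "\<dots> \<longleftrightarrow> (a \<longlongrightarrow> 0) F \<and> (b \<longlongrightarrow> 0) F"
  proof
    assume *: "((\<lambda>n. a n + b n) \<longlongrightarrow> 0) F"
    have "(a \<longlongrightarrow> 0) F" by (rule tendsto_sandwich[OF _ _ tendsto_const *]) (auto simp: assms)
    moreover have "(b \<longlongrightarrow> 0) F" by (rule tendsto_sandwich[OF _ _ tendsto_const *]) (auto simp: assms)
    ultimately show "(a \<longlongrightarrow> 0) F \<and> (b \<longlongrightarrow> 0) F" ..
  next
    assume "(a \<longlongrightarrow> 0) F \<and> (b \<longlongrightarrow> 0) F" then show "((\<lambda>n. a n + b n) \<longlongrightarrow> 0) F"
      using tendsto_add_zero by blast
  qed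
  finally show ?thesis by simp
qed

lemma H10_approx:
  assumes "v \<in> H10 D"
  obtains \<phi> where "\<And>n::nat. \<phi> n \<in> test_functions D" "(\<lambda>n. \<integral>x. (norm (v x - \<phi> n x))\<^sup>2 \<partial>L) \<longlonglongrightarrow> 0"
    "(\<lambda>n. \<integral>x. (norm (weak_gradient D v x - gradient (\<phi> n) x))\<^sup>2 \<partial>L) \<longlonglongrightarrow> 0"
proof -
  have v: "square_integrable L v" "has_weak_gradient D v (weak_gradient D v)"
    using assms by (auto simp: H10_def H1_iff)
  obtain \<phi> where \<phi>: "\<And>n::nat. \<phi> n \<in> test_functions D" "(\<lambda>n. H1norm_sq D (\<lambda>x. v x - \<phi> n x)) \<longlonglongrightarrow> 0"
    using assms by (auto simp: H10_def)
  have eq: "H1norm_sq D (\<lambda>x. v x - \<phi> n x) = ennreal ((\<integral>x. (norm (v x - \<phi> n x))\<^sup>2 \<partial>L)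
      + (\<integral>x. (norm (weak_gradient D v x - gradient (\<phi> n) x))\<^sup>2 \<partial>L))" for n
    by (intro H1norm_sq_eq square_integrable_diff has_weak_gradient_diff has_weak_gradient_test v \<phi> test_sq)
  have "(\<lambda>n. \<integral>x. (norm (v x - \<phi> n x))\<^sup>2 \<partial>L) \<longlonglongrightarrow> 0 \<and>
    (\<lambda>n. \<integral>x. (norm (weak_gradient D v x - gradient (\<phi> n) x))\<^sup>2 \<partial>L) \<longlonglongrightarrow> 0"
    using \<phi>(2) unfolding eq by (subst (asm) ennreal_add_tendsto_0) auto
  then show ?thesis using \<phi>(1) that[of \<phi>] by blast
qed

text \<open>The weak gradient is a closed operator: in the integration by parts formula of \<phi> n
  against a fixed test function both sides are L^2 pairings, and both converge.\<close>

lemma H10_intro: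
  assumes v: "square_integrable L v" and G: "square_integrable L G"
    and \<phi>: "\<And>n::nat. \<phi> n \<in> test_functions D" and lim: "(\<lambda>n. \<integral>x. (norm (\<phi> n x - v x))\<^sup>2 \<partial>L) \<longlonglongrightarrow> 0"
    "(\<lambda>n. \<integral>x. (norm (gradient (\<phi> n) x - G x))\<^sup>2 \<partial>L) \<longlonglongrightarrow> 0"
  shows "v \<in> H10 D" "has_weak_gradient D v G"
proof -
  show wg: "has_weak_gradient D v G"
    unfolding has_weak_gradient_iff
  proof (intro conjI ballI G)
    fix \<eta> b assume \<eta>: "\<eta> \<in> test_functions D" and b: "b \<in> (Basis::'a set)"
    have sqb: "square_integrable L (\<lambda>x. \<eta> x *\<^sub>R b)"
      by (rule square_integrable_bound[OF test_sq[OF \<eta>], where c=1]) 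
        (use b in \<open>auto intro!: borel_measurable_scaleR square_integrableD(1)[OF test_sq[OF \<eta>]]\<close>)
    have "(\<lambda>n. \<integral>x. gradient (\<phi> n) x \<bullet> (\<eta> x *\<^sub>R b) \<partial>L) \<longlonglongrightarrow> (\<integral>x. G x \<bullet> (\<eta> x *\<^sub>R b) \<partial>L)"
      by (intro tendsto_integral_inner gradient_sq \<phi> G sqb lim)
    from tendsto_minus[OF this] have "(\<lambda>n. - (\<integral>x. gradient (\<phi> n) x \<bullet> (\<eta> x *\<^sub>R b) \<partial>L)) \<longlonglongrightarrow> - (\<integral>x. G x \<bullet> (\<eta> x *\<^sub>R b) \<partial>L)" .
    moreover have "(\<lambda>n. \<integral>x. \<phi> n x \<bullet> frechet_derivative \<eta> (at x) b \<partial>L) \<longlonglongrightarrow> (\<integral>x. v x \<bullet> frechet_derivative \<eta> (at x) b \<partial>L)"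
      by (intro tendsto_integral_inner test_sq frechet_test_sq \<phi> \<eta> v lim)
    moreover have "(\<integral>x. \<phi> n x \<bullet> frechet_derivative \<eta> (at x) b \<partial>L) = - (\<integral>x. gradient (\<phi> n) x \<bullet> (\<eta> x *\<^sub>R b) \<partial>L)" for n
      using integration_by_parts_test[OF \<phi> \<eta>] b by (simp add: gradient_inner_Basis mult.commute)
    ultimately have "(\<integral>x. v x \<bullet> frechet_derivative \<eta> (at x) b \<partial>L) = - (\<integral>x. G x \<bullet> (\<eta> x *\<^sub>R b) \<partial>L)"
      by (simp add: LIMSEQ_unique)
    then show "(\<integral>x. v x * frechet_derivative \<eta> (at x) b \<partial>L) = - (\<integral>x. (G x \<bullet> b) * \<eta> x \<partial>L)"
      by (simp add: mult.commute)
  qed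
  have "H1norm_sq D (\<lambda>x. v x - \<phi> n x) = ennreal ((\<integral>x. (norm (v x - \<phi> n x))\<^sup>2 \<partial>L)
      + (\<integral>x. (norm (G x - gradient (\<phi> n) x))\<^sup>2 \<partial>L))" for n
    by (intro H1norm_sq_eq square_integrable_diff has_weak_gradient_diff has_weak_gradient_test v \<phi> wg test_sq)
  moreover have "(\<lambda>n. ennreal ((\<integral>x. (norm (v x - \<phi> n x))\<^sup>2 \<partial>L)
      + (\<integral>x. (norm (G x - gradient (\<phi> n) x))\<^sup>2 \<partial>L))) \<longlonglongrightarrow> 0"
    using lim by (subst ennreal_add_tendsto_0) (auto simp: norm_minus_commute power2_commute)
  ultimately have "(\<lambda>n. H1norm_sq D (\<lambda>x. v x - \<phi> n x)) \<longlonglongrightarrow> 0" by (simp only:)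
  then show "v \<in> H10 D" using v wg \<phi> unfolding H10_def H1_def Lspace_2_iff by blast
qed

text \<open>The function \<Phi> (\<phi> n x) is a test function whenever \<phi> n is one: smoothness
  is preserved, and \<Phi> 0 = 0 keeps the support. The values converge by the Lipschitz bound, the
  gradients because \<Phi>' is bounded and continuous.\<close>

lemma H10_compose:
  fixes \<Phi> \<Phi>' :: "real \<Rightarrow> real"
  assumes v: "v \<in> H10 D"
    and der: "\<And>s. (\<Phi> has_real_derivative \<Phi>' s) (at s)" and cont: "continuous_on UNIV \<Phi>'"
    and bnd: "\<And>s. \<bar>\<Phi>' s\<bar> \<le> K" and zero: "\<Phi> 0 = 0"
    and sm: "\<And>\<phi>::'a \<Rightarrow> real. smooth \<phi> \<Longrightarrow> smooth (\<lambda>x. \<Phi> (\<phi> x))"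
  shows "(\<lambda>x. \<Phi> (v x)) \<in> H10 D" "has_weak_gradient D (\<lambda>x. \<Phi> (v x)) (\<lambda>x. \<Phi>' (v x) *\<^sub>R weak_gradient D v x)"
proof -
  let ?G = "weak_gradient D v"
  have vs: "square_integrable L v" and G: "square_integrable L ?G"
    using v by (auto simp: H10_def H1_iff has_weak_gradient_iff)
  have K: "K \<ge> 0" using bnd[of 0] by linarith
  have [measurable]: "\<Phi>' \<in> borel_measurable borel" using cont by (rule borel_measurable_continuous_onI)
  have c\<Phi>: "continuous_on UNIV \<Phi>" using der by (meson DERIV_isCont continuous_at_imp_continuous_on)
  have [measurable]: "\<Phi> \<in> borel_measurable borel" using c\<Phi> by (rule borel_measurable_continuous_onI)
  note [measurable] = square_integrableD(1)[OF vs] square_integrableD(1)[OF G]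
  have lip: "\<bar>\<Phi> x - \<Phi> y\<bar> \<le> K * \<bar>x - y\<bar>" for x y
    using field_differentiable_bound[of UNIV \<Phi> \<Phi>' K x y] der bnd by simp
  obtain \<phi>0 where \<phi>0: "\<And>n::nat. \<phi>0 n \<in> test_functions D" "(\<lambda>n. \<integral>x. (norm (v x - \<phi>0 n x))\<^sup>2 \<partial>L) \<longlonglongrightarrow> 0"
    "(\<lambda>n. \<integral>x. (norm (?G x - gradient (\<phi>0 n) x))\<^sup>2 \<partial>L) \<longlonglongrightarrow> 0"
    using H10_approx[OF v] by blast
  \<comment> \<open>L^2 convergence yields convergence almost everywhere only along a subsequence,
    and the latter is what dominated convergence of \<Phi>' (\<phi> n x) requires.\<close>
  have "\<exists>r. strict_mono r \<and> (AE x in L. (\<lambda>n. (norm (v x - \<phi>0 (r n) x))\<^sup>2) \<longlonglongrightarrow> 0)"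
  proof (rule tendsto_L1_AE_subseq)
    show "integrable L (\<lambda>x. (norm (v x - \<phi>0 n x))\<^sup>2)" for n
      by (intro square_integrableD(2) square_integrable_diff vs test_sq \<phi>0)
  qed (use \<phi>0(2) in simp)
  then obtain r where r: "strict_mono r" "AE x in L. (\<lambda>n. (norm (v x - \<phi>0 (r n) x))\<^sup>2) \<longlonglongrightarrow> 0" by blast
  define \<phi> where "\<phi> n = \<phi>0 (r n)" for n
  have \<phi>: "\<And>n. \<phi> n \<in> test_functions D" using \<phi>0 by (simp add: \<phi>_def)
  have \<phi>v: "(\<lambda>n. \<integral>x. (norm (v x - \<phi> n x))\<^sup>2 \<partial>L) \<longlonglongrightarrow> 0"
    using LIMSEQ_subseq_LIMSEQ[OF \<phi>0(2) r(1)] by (simp add: o_def \<phi>_def)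
  have \<phi>G: "(\<lambda>n. \<integral>x. (norm (?G x - gradient (\<phi> n) x))\<^sup>2 \<partial>L) \<longlonglongrightarrow> 0"
    using LIMSEQ_subseq_LIMSEQ[OF \<phi>0(3) r(1)] by (simp add: o_def \<phi>_def)
  have ae: "AE x in L. (\<lambda>n. \<phi> n x) \<longlonglongrightarrow> v x"
    using r(2)
  proof eventually_elim
    case (elim x)
    then have "(\<lambda>n. sqrt ((norm (v x - \<phi> n x))\<^sup>2)) \<longlonglongrightarrow> sqrt 0" unfolding \<phi>_def by (rule tendsto_real_sqrt)
    then have "(\<lambda>n. norm (v x - \<phi> n x)) \<longlonglongrightarrow> 0" by simp
    then have "(\<lambda>n. v x - \<phi> n x) \<longlonglongrightarrow> 0" by (simp only: tendsto_norm_zero_iff)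
    from tendsto_diff[OF tendsto_const[of "v x"] this] show ?case by simp
  qed
  note [measurable] = square_integrableD(1)[OF test_sq[OF \<phi>]] square_integrableD(1)[OF gradient_sq[OF \<phi>]]
  define \<psi> where "\<psi> n x = \<Phi> (\<phi> n x)" for n x
  have \<psi>: "\<psi> n \<in> test_functions D" for n
    using \<phi>[of n] sm zero unfolding test_functions_def \<psi>_def by auto
  have grad: "gradient (\<psi> n) x = \<Phi>' (\<phi> n x) *\<^sub>R gradient (\<phi> n) x" for n x
  proof -
    have "(\<phi> n has_derivative frechet_derivative (\<phi> n) (at x)) (at x)"
      using \<phi> by (intro smooth_has_derivative test_functions_smooth)
    from diff_chain_at[OF this der[unfolded has_field_derivative_def]]
    have "(\<psi> n has_derivative (\<lambda>h. \<Phi>' (\<phi> n x) * frechet_derivative (\<phi> n) (at x) h)) (at x)"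
      by (simp add: o_def \<psi>_def[abs_def])
    from frechet_derivative_at[OF this, symmetric] show ?thesis
      by (simp add: gradient_def scaleR_sum_right)
  qed
  have sq1: "square_integrable L (\<lambda>x. \<Phi> (v x))"
    by (rule square_integrable_bound[OF vs, where c=K]) (use lip[of _ 0] zero in auto)
  have sq2: "square_integrable L (\<lambda>x. \<Phi>' (v x) *\<^sub>R ?G x)"
    by (rule square_integrable_bound[OF G, where c=K]) (use bnd in \<open>auto intro: mult_right_mono\<close>)
  have lim1: "(\<lambda>n. \<integral>x. (norm (\<psi> n x - \<Phi> (v x)))\<^sup>2 \<partial>L) \<longlonglongrightarrow> 0"
  proof (rule Lim_null_comparison)
    have "(\<integral>x. (norm (\<psi> n x - \<Phi> (v x)))\<^sup>2 \<partial>L) \<le> (\<integral>x. K\<^sup>2 * (norm (v x - \<phi> n x))\<^sup>2 \<partial>L)" for n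
    proof (rule integral_mono)
      show "integrable L (\<lambda>x. (norm (\<psi> n x - \<Phi> (v x)))\<^sup>2)"
        by (intro square_integrableD(2) square_integrable_diff test_sq \<psi> sq1)
      show "integrable L (\<lambda>x. K\<^sup>2 * (norm (v x - \<phi> n x))\<^sup>2)"
        by (intro integrable_mult_right square_integrableD(2) square_integrable_diff test_sq \<phi> vs)
      show "(norm (\<psi> n x - \<Phi> (v x)))\<^sup>2 \<le> K\<^sup>2 * (norm (v x - \<phi> n x))\<^sup>2" for x
        using power_mono[OF lip[of "\<phi> n x" "v x"], of 2] by (simp add: \<psi>_def power_mult_distrib power2_commute)
    qed
    then show "\<forall>\<^sub>F n in sequentially. norm (\<integral>x. (norm (\<psi> n x - \<Phi> (v x)))\<^sup>2 \<partial>L) \<le> K\<^sup>2 * (\<integral>x. (norm (v x - \<phi> n x))\<^sup>2 \<partial>L)"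
      by simp
    show "(\<lambda>n. K\<^sup>2 * (\<integral>x. (norm (v x - \<phi> n x))\<^sup>2 \<partial>L)) \<longlonglongrightarrow> 0"
      using tendsto_mult_right_zero[OF \<phi>v] by simp
  qed
  have lim3: "(\<lambda>n. \<integral>x. (\<Phi>' (\<phi> n x) - \<Phi>' (v x))\<^sup>2 * (norm (?G x))\<^sup>2 \<partial>L) \<longlonglongrightarrow> (\<integral>x. 0 \<partial>L)"
  proof (rule integral_dominated_convergence[where w="\<lambda>x. (2 * K)\<^sup>2 * (norm (?G x))\<^sup>2"])
    show "AE x in L. (\<lambda>n. (\<Phi>' (\<phi> n x) - \<Phi>' (v x))\<^sup>2 * (norm (?G x))\<^sup>2) \<longlonglongrightarrow> 0"
      using ae
    proof eventually_elim
      case (elim x)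
      have "isCont \<Phi>' (v x)" using cont by (simp add: continuous_on_eq_continuous_at)
      then have "(\<lambda>n. \<Phi>' (\<phi> n x)) \<longlonglongrightarrow> \<Phi>' (v x)" using elim isCont_tendsto_compose by blast
      then show ?case by (auto intro!: tendsto_eq_intros)
    qed
    show "AE x in L. norm ((\<Phi>' (\<phi> n x) - \<Phi>' (v x))\<^sup>2 * (norm (?G x))\<^sup>2) \<le> (2 * K)\<^sup>2 * (norm (?G x))\<^sup>2" for n
    proof (rule AE_I2)
      fix x
      have "\<bar>\<Phi>' (\<phi> n x) - \<Phi>' (v x)\<bar> \<le> \<bar>2 * K\<bar>" using bnd[of "\<phi> n x"] bnd[of "v x"] by linarith
      then have "(\<Phi>' (\<phi> n x) - \<Phi>' (v x))\<^sup>2 \<le> (2 * K)\<^sup>2" by (simp only: abs_le_square_iff)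
      then show "norm ((\<Phi>' (\<phi> n x) - \<Phi>' (v x))\<^sup>2 * (norm (?G x))\<^sup>2) \<le> (2 * K)\<^sup>2 * (norm (?G x))\<^sup>2"
        by (simp add: abs_mult mult_right_mono)
    qed
  qed (use square_integrableD(2)[OF G] in auto)
  have lim2: "(\<lambda>n. \<integral>x. (norm (gradient (\<psi> n) x - \<Phi>' (v x) *\<^sub>R ?G x))\<^sup>2 \<partial>L) \<longlonglongrightarrow> 0"
  proof (rule Lim_null_comparison)
    let ?u = "\<lambda>n x. 2 * K\<^sup>2 * (norm (?G x - gradient (\<phi> n) x))\<^sup>2 + 2 * ((\<Phi>' (\<phi> n x) - \<Phi>' (v x))\<^sup>2 * (norm (?G x))\<^sup>2)"
    have i1: "integrable L (\<lambda>x. (norm (?G x - gradient (\<phi> n) x))\<^sup>2)" for n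
      by (intro square_integrableD(2) square_integrable_diff gradient_sq \<phi> G)
    have i2: "integrable L (\<lambda>x. (\<Phi>' (\<phi> n x) - \<Phi>' (v x))\<^sup>2 * (norm (?G x))\<^sup>2)" for n
    proof -
      have "square_integrable L (\<lambda>x. (\<Phi>' (\<phi> n x) - \<Phi>' (v x)) *\<^sub>R ?G x)"
      proof (rule square_integrable_bound[OF G, where c="2*K"])
        fix x show "norm ((\<Phi>' (\<phi> n x) - \<Phi>' (v x)) *\<^sub>R ?G x) \<le> 2 * K * norm (?G x)"
          using bnd[of "\<phi> n x"] bnd[of "v x"] by (simp add: mult_right_mono)
      qed auto
      then show ?thesis by (simp add: square_integrable_def power_mult_distrib)
    qed
    have "(\<integral>x. (norm (gradient (\<psi> n) x - \<Phi>' (v x) *\<^sub>R ?G x))\<^sup>2 \<partial>L) \<le> (\<integral>x. ?u n x \<partial>L)" for n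
    proof (rule integral_mono)
      show "integrable L (\<lambda>x. (norm (gradient (\<psi> n) x - \<Phi>' (v x) *\<^sub>R ?G x))\<^sup>2)"
        by (intro square_integrableD(2) square_integrable_diff gradient_sq \<psi> sq2)
      show "integrable L (?u n)" using i1 i2 by simp
      fix x
      \<comment> \<open>The first term is small because the gradients converge and \<Phi>' is
        bounded. The second one contains the fixed function \<nabla>v and is handled by dominated
        convergence.\<close>
      have "gradient (\<psi> n) x - \<Phi>' (v x) *\<^sub>R ?G x = - (\<Phi>' (\<phi> n x) *\<^sub>R (?G x - gradient (\<phi> n) x)) + (\<Phi>' (\<phi> n x) - \<Phi>' (v x)) *\<^sub>R ?G x"
        by (simp add: grad algebra_simps)
      also have "norm \<dots> \<le> \<bar>\<Phi>' (\<phi> n x)\<bar> * norm (?G x - gradient (\<phi> n) x) + \<bar>\<Phi>' (\<phi> n x) - \<Phi>' (v x)\<bar> * norm (?G x)"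
        by (rule order_trans[OF norm_triangle_ineq]) simp
      also have "\<dots> \<le> K * norm (?G x - gradient (\<phi> n) x) + \<bar>\<Phi>' (\<phi> n x) - \<Phi>' (v x)\<bar> * norm (?G x)"
        using bnd by (intro add_mono mult_right_mono) auto
      finally have "(norm (gradient (\<psi> n) x - \<Phi>' (v x) *\<^sub>R ?G x))\<^sup>2 \<le> (K * norm (?G x - gradient (\<phi> n) x) + \<bar>\<Phi>' (\<phi> n x) - \<Phi>' (v x)\<bar> * norm (?G x))\<^sup>2"
        by (intro power_mono) auto
      also have "\<dots> \<le> 2 * (K * norm (?G x - gradient (\<phi> n) x))\<^sup>2 + 2 * (\<bar>\<Phi>' (\<phi> n x) - \<Phi>' (v x)\<bar> * norm (?G x))\<^sup>2"
        using sum_squares_bound[of "K * norm (?G x - gradient (\<phi> n) x)" "\<bar>\<Phi>' (\<phi> n x) - \<Phi>' (v x)\<bar> * norm (?G x)"]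
        unfolding power2_sum by linarith
      also have "\<dots> = ?u n x" by (simp add: power_mult_distrib)
      finally show "(norm (gradient (\<psi> n) x - \<Phi>' (v x) *\<^sub>R ?G x))\<^sup>2 \<le> ?u n x" .
    qed
    then show "\<forall>\<^sub>F n in sequentially. norm (\<integral>x. (norm (gradient (\<psi> n) x - \<Phi>' (v x) *\<^sub>R ?G x))\<^sup>2 \<partial>L) \<le> 
        2 * K\<^sup>2 * (\<integral>x. (norm (?G x - gradient (\<phi> n) x))\<^sup>2 \<partial>L) + 2 * (\<integral>x. (\<Phi>' (\<phi> n x) - \<Phi>' (v x))\<^sup>2 * (norm (?G x))\<^sup>2 \<partial>L)"
      using i1 i2 by simp
    show "(\<lambda>n. 2 * K\<^sup>2 * (\<integral>x. (norm (?G x - gradient (\<phi> n) x))\<^sup>2 \<partial>L) + 2 * (\<integral>x. (\<Phi>' (\<phi> n x) - \<Phi>' (v x))\<^sup>2 * (norm (?G x))\<^sup>2 \<partial>L)) \<longlonglongrightarrow> 0"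
      using tendsto_add[OF tendsto_mult_right_zero[OF \<phi>G, of "2 * K\<^sup>2"] tendsto_mult_right_zero[of _ _ 2]] lim3 by simp
  qed
  show "(\<lambda>x. \<Phi> (v x)) \<in> H10 D" "has_weak_gradient D (\<lambda>x. \<Phi> (v x)) (\<lambda>x. \<Phi>' (v x) *\<^sub>R ?G x)"
    using H10_intro[OF sq1 sq2 \<psi> lim1 lim2] by auto
qed

end

section \<open>Distributional derivatives in time\<close>

lemma tendsto_subsequence_criterion:
  fixes x :: "nat \<Rightarrow> real"
  assumes "\<And>r::nat \<Rightarrow> nat. strict_mono r \<Longrightarrow> \<exists>s. strict_mono s \<and> (\<lambda>n. x (r (s n))) \<longlonglongrightarrow> l"
  shows "x \<longlonglongrightarrow> l"
proof (rule ccontr)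
  assume "\<not> x \<longlonglongrightarrow> l"
  then obtain e where e: "e > 0" "\<not> (\<forall>\<^sub>F n in sequentially. dist (x n) l < e)"
    by (auto simp: tendsto_iff)
  then have "\<exists>\<^sub>F n in sequentially. dist (x n) l \<ge> e" by (simp add: not_eventually not_less)
  then have "infinite {n. dist (x n) l \<ge> e}"
    by (simp add: frequently_cofinite flip: cofinite_eq_sequentially)
  then obtain r :: "nat \<Rightarrow> nat" where r: "strict_mono r" "\<And>n. r n \<in> {n. dist (x n) l \<ge> e}"
    using infinite_enumerate by blast
  obtain s where "strict_mono s" "(\<lambda>n. x (r (s n))) \<longlonglongrightarrow> l" using assms[OF r(1)] by blast
  then have "\<forall>\<^sub>F n in sequentially. dist (x (r (s n))) l < e" using e(1) by (auto simp: tendsto_iff)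
  then obtain n where "dist (x (r (s n))) l < e" by (auto simp: eventually_sequentially)
  then show False using r(2)[of "s n"] by auto
qed

text \<open>Every subsequence has a further subsequence converging almost everywhere; as the limit
  of the integrals is always the same, the whole sequence converges. The bound on \<Psi> is what
  lets z be merely integrable.\<close>

lemma tendsto_integral_compose_L2:
  fixes z :: "'a \<Rightarrow> real" and \<Psi> :: "real \<Rightarrow> real"
  assumes v: "\<And>n. square_integrable M (v n)" "square_integrable M w"
    and lim: "(\<lambda>n. \<integral>x. (norm (v n x - w x))\<^sup>2 \<partial>M) \<longlonglongrightarrow> 0"
    and z: "integrable M z" and \<Psi>: "continuous_on UNIV \<Psi>" "\<And>s. \<bar>\<Psi> s\<bar> \<le> B"
  shows "(\<lambda>n. \<integral>x. z x * \<Psi> (v n x) \<partial>M) \<longlonglongrightarrow> (\<integral>x. z x * \<Psi> (w x) \<partial>M)"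
proof (rule tendsto_subsequence_criterion)
  fix r :: "nat \<Rightarrow> nat" assume r: "strict_mono r"
  have "(\<lambda>n. \<integral>x. (norm (v (r n) x - w x))\<^sup>2 \<partial>M) \<longlonglongrightarrow> 0"
    using LIMSEQ_subseq_LIMSEQ[OF lim r] by (simp add: o_def)
  then have "\<exists>s. strict_mono s \<and> (AE x in M. (\<lambda>n. (norm (v (r (s n)) x - w x))\<^sup>2) \<longlonglongrightarrow> 0)"
    by (intro tendsto_L1_AE_subseq square_integrableD(2) square_integrable_diff v) simp
  then obtain s where s: "strict_mono s" "AE x in M. (\<lambda>n. (norm (v (r (s n)) x - w x))\<^sup>2) \<longlonglongrightarrow> 0" by blast
  note [measurable] = square_integrableD(1)[OF v(1)] square_integrableD(1)[OF v(2)] borel_measurable_integrable[OF z]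
    borel_measurable_continuous_onI[OF \<Psi>(1)]
  have "(\<lambda>n. \<integral>x. z x * \<Psi> (v (r (s n)) x) \<partial>M) \<longlonglongrightarrow> (\<integral>x. z x * \<Psi> (w x) \<partial>M)"
  proof (rule integral_dominated_convergence[where w="\<lambda>x. \<bar>z x\<bar> * B"])
    show "AE x in M. (\<lambda>n. z x * \<Psi> (v (r (s n)) x)) \<longlonglongrightarrow> z x * \<Psi> (w x)"
      using s(2)
    proof eventually_elim
      case (elim x)
      from tendsto_real_sqrt[OF elim] have "(\<lambda>n. norm (v (r (s n)) x - w x)) \<longlonglongrightarrow> 0" by simp
      then have "(\<lambda>n. v (r (s n)) x) \<longlonglongrightarrow> w x" by (simp only: tendsto_norm_zero_iff LIM_zero_iff)
      moreover have "isCont \<Psi> (w x)" using \<Psi>(1) by (simp add: continuous_on_eq_continuous_at)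
      ultimately show ?case by (intro tendsto_mult tendsto_const) (rule isCont_tendsto_compose)
    qed
    show "AE x in M. norm (z x * \<Psi> (v (r (s n)) x)) \<le> \<bar>z x\<bar> * B" for n
      using \<Psi>(2) by (intro AE_I2) (simp add: abs_mult mult_left_mono)
  qed (use z in auto)
  then show "\<exists>s. strict_mono s \<and> (\<lambda>n. \<integral>x. z x * \<Psi> (v (r (s n)) x) \<partial>M) \<longlonglongrightarrow> (\<integral>x. z x * \<Psi> (w x) \<partial>M)"
    using s(1) by blast
qed

text \<open>Completeness of Lebesgue measure. It is meant for functions of time built from
  \<open>weak_gradient D (u t)\<close>, whose form is known for almost every t only.\<close>

lemma borel_measurable_AE_cong:
  fixes f g :: "'a::euclidean_space \<Rightarrow> real"
  assumes S: "S \<in> sets lebesgue" and f: "f \<in> borel_measurable (lebesgue_on S)"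
    and ae: "AE x in lebesgue_on S. f x = g x"
  shows "g \<in> borel_measurable (lebesgue_on S)"
proof -
  have "(\<lambda>x. f x * indicator S x) \<in> borel_measurable lebesgue"
    using f S by (subst (asm) borel_measurable_restrict_space_iff) (auto simp: mult.commute)
  moreover have "AE x in lebesgue. f x * indicator S x = g x * indicator S x"
    using ae S by (auto simp: AE_restrict_space_iff indicator_def elim!: eventually_mono)
  ultimately have "(\<lambda>x. g x * indicator S x) \<in> borel_measurable lebesgue" by (rule borel_measurable_AE)
  then show ?thesis using S by (subst borel_measurable_restrict_space_iff) (auto simp: mult.commute)
qed

lemma borel_measurable_AE_LIMSEQ:
  fixes f :: "nat \<Rightarrow> 'a::euclidean_space \<Rightarrow> real"
  assumes S: "S \<in> sets lebesgue" and f: "\<And>n. f n \<in> borel_measurable (lebesgue_on S)"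
    and lim: "AE x in lebesgue_on S. (\<lambda>n. f n x) \<longlonglongrightarrow> g x"
  shows "g \<in> borel_measurable (lebesgue_on S)"
proof (rule borel_measurable_AE_cong[OF S])
  show "(\<lambda>x. lim (\<lambda>n. f n x)) \<in> borel_measurable (lebesgue_on S)" using f by measurable
  show "AE x in lebesgue_on S. lim (\<lambda>n. f n x) = g x"
    using lim by eventually_elim (rule limI)
qed

lemma integral_lebesgue_on_subset:
  fixes f :: "'a::euclidean_space \<Rightarrow> real"
  assumes "A \<subseteq> B" "A \<in> sets lebesgue" "B \<in> sets lebesgue" "\<And>x. x \<in> B - A \<Longrightarrow> f x = 0"
  shows "(LINT x|lebesgue_on B. f x) = (LINT x|lebesgue_on A. f x)"
proof -
  have "(\<lambda>x. indicat_real B x *\<^sub>R f x) = (\<lambda>x. indicat_real A x *\<^sub>R f x)"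
    using assms(1,4) by (auto simp: indicator_def fun_eq_iff)
  then show ?thesis using assms(2,3) by (simp add: integral_restrict_space)
qed

lemma integrable_lebesgue_on_subset:
  fixes f :: "'a::euclidean_space \<Rightarrow> real"
  assumes "integrable (lebesgue_on B) f" "A \<subseteq> B" "A \<in> sets lebesgue" "B \<in> sets lebesgue"
  shows "integrable (lebesgue_on A) f"
proof -
  have "integrable lebesgue (\<lambda>x. indicat_real B x *\<^sub>R f x)"
    using assms by (simp add: integrable_restrict_space)
  from integrable_mult_indicator[OF assms(3) this]
  have "integrable lebesgue (\<lambda>x. indicat_real A x *\<^sub>R indicat_real B x *\<^sub>R f x)" .
  also have "(\<lambda>x. indicat_real A x *\<^sub>R indicat_real B x *\<^sub>R f x) = (\<lambda>x. indicat_real A x *\<^sub>R f x)"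
    using assms(2) by (auto simp: indicator_def fun_eq_iff)
  finally show ?thesis using assms by (simp add: integrable_restrict_space)
qed

section \<open>From distributional to integrated equations in time\<close>

definition smooth_step_deriv :: "real \<Rightarrow> real" where
  "smooth_step_deriv x = frechet_derivative smooth_step (at x) 1"

lemma smooth_id: "smooth (\<lambda>x::real. x)"
  using smooth_inner[of "1::real"] by simp

lemma smooth_step_props:
  shows DERIV_smooth_step: "(smooth_step has_real_derivative smooth_step_deriv x) (at x)"
    and continuous_smooth_step_deriv: "continuous_on S smooth_step_deriv"
    and smooth_step_deriv_eq_0: "x \<notin> {0..1} \<Longrightarrow> smooth_step_deriv x = 0"
proof -
  have s: "smooth smooth_step" using smooth_smooth_step[OF smooth_id] .
  have "((\<lambda>t. smooth_step (0 + t *\<^sub>R 1)) has_real_derivative frechet_derivative smooth_step (at (0 + x *\<^sub>R 1)) 1) (at x)"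
    by (rule line_has_derivative[OF s])
  then show d: "(smooth_step has_real_derivative smooth_step_deriv x) (at x)" by (simp add: smooth_step_deriv_def)
  show "continuous_on S smooth_step_deriv"
    using smooth_continuous_on[OF smooth_frechet[OF s]] by (simp add: smooth_step_deriv_def[abs_def])
  assume "x \<notin> {0..1}"
  then consider "x < 0" | "x > 1" by fastforce
  then have "(smooth_step has_real_derivative 0) (at x)"
  proof cases
    case 1
    have "\<forall>\<^sub>F y in nhds x. smooth_step y = 0"
      using eventually_nhds_in_open[of "{..<0}" x] 1 by (auto elim!: eventually_mono simp: smooth_step_le_0)
    then show ?thesis by (rule iffD2[OF DERIV_cong_ev[OF refl _ refl]]) simp
  next
    case 2
    have "\<forall>\<^sub>F y in nhds x. smooth_step y = 1"
      using eventually_nhds_in_open[of "{1<..}" x] 2 by (auto elim!: eventually_mono simp: smooth_step_ge_1)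
    then show ?thesis by (rule iffD2[OF DERIV_cong_ev[OF refl _ refl]]) simp
  qed
  then show "smooth_step_deriv x = 0" using d DERIV_unique by blast
qed

text \<open>The derivative of the rescaled step is an approximate identity on [c, c + 1/(n+1)]: its
  integral is 1 by the fundamental theorem of calculus, and being bounded by (n+1) B on an interval
  of length 1/(n+1) it has L^1 norm at most B.\<close>

lemma smooth_step_kernel:
  fixes h :: "real \<Rightarrow> real"
  assumes c: "continuous_on {c..c+1} h"
  shows "(\<lambda>n. LINT x|lebesgue_on {c..c+1}. (real (Suc n) * smooth_step_deriv (real (Suc n) * (x - c))) * h x) \<longlonglongrightarrow> h c"
proof -
  define K where "K n x = real (Suc n) * smooth_step_deriv (real (Suc n) * (x - c))" for n x
  have contK: "continuous_on S (K n)" for S n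
    unfolding K_def by (intro continuous_intros continuous_on_compose2[OF continuous_smooth_step_deriv[of UNIV]]) auto
  have K1: "(LINT x|lebesgue_on {c..c+1}. K n x) = 1" for n
  proof -
    have "((\<lambda>x. smooth_step (real (Suc n) * (x - c))) has_real_derivative K n x) (at x)" for x
    proof -
      have "((\<lambda>x. real (Suc n) * (x - c)) has_real_derivative real (Suc n)) (at x)"
        by (auto intro!: derivative_eq_intros)
      from DERIV_chain2[OF DERIV_smooth_step this] show ?thesis by (simp only: K_def mult.commute)
    qed
    then have "(K n has_integral (smooth_step (real (Suc n) * (c + 1 - c)) - smooth_step (real (Suc n) * (c - c)))) {c..c+1}"
      by (intro fundamental_theorem_of_calculus) 
        (auto simp flip: has_real_derivative_iff_has_vector_derivative intro: has_field_derivative_at_within simp del: of_nat_Suc)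
    then have "integral {c..c+1} (K n) = 1"
      by (simp add: integral_unique smooth_step_ge_1 smooth_step_le_0)
    then show ?thesis using lebesgue_integral_eq_integral[OF continuous_imp_integrable_real[OF contK]] by simp
  qed
  obtain B where B: "B > 0" "\<And>x. \<bar>smooth_step_deriv x\<bar> \<le> B"
  proof -
    have "bounded (smooth_step_deriv ` {0..1})" by (intro compact_imp_bounded compact_continuous_image continuous_smooth_step_deriv compact_Icc)
    then obtain B where "B > 0" "\<forall>x\<in>{0..1}. \<bar>smooth_step_deriv x\<bar> \<le> B" by (auto simp: bounded_pos)
    then show ?thesis using smooth_step_deriv_eq_0 by (intro that[of B]) (metis abs_zero less_imp_le)+
  qed
  have "(\<lambda>n. LINT x|lebesgue_on {c..c+1}. K n x * h x) \<longlonglongrightarrow> h c"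
  proof (rule LIMSEQ_I)
    fix e :: real assume e: "e > 0"
    \<comment> \<open>The final estimate is B * e' = e / 2.\<close>
    define e' where "e' = e / (2 * B)"
    have e': "e' > 0" using e B by (simp add: e'_def)
    obtain d where d: "d > 0" "\<And>x. x \<in> {c..c+1} \<Longrightarrow> \<bar>x - c\<bar> < d \<Longrightarrow> \<bar>h x - h c\<bar> < e'"
      using c[unfolded continuous_on_iff, rule_format, of c e'] e' by (auto simp: dist_real_def)
    obtain N where N: "inverse (real (Suc N)) < d" using d(1) reals_Archimedean by blast
    have "norm ((LINT x|lebesgue_on {c..c+1}. K n x * h x) - h c) < e" if n: "n \<ge> N" for n
    proof -
      have dn: "inverse (real (Suc n)) < d" using N n by (smt (verit) inverse_of_nat_le of_nat_le_iff le_imp_inverse_le of_nat_0_less_iff zero_less_Suc Suc_le_mono)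
      let ?c = "c + inverse (real (Suc n))"
      have ih: "integrable (lebesgue_on {c..c+1}) (\<lambda>x. K n x * h x)" "integrable (lebesgue_on {c..c+1}) (\<lambda>x. K n x * h c)"
        by (intro continuous_imp_integrable_real continuous_intros contK c)+
      then have id: "integrable (lebesgue_on {c..c+1}) (\<lambda>x. K n x * (h x - h c))" by (simp add: right_diff_distrib)
      have z: "K n x = 0" if "x \<notin> {c..?c}" for x
      proof -
        have "real (Suc n) * (x - c) \<notin> {0..1}"
        proof (cases "x < c")
          case True then have "real (Suc n) * (x - c) < 0" by (intro mult_pos_neg) auto
          then show ?thesis by simp
        next
          case False
          then have "x - c > inverse (real (Suc n))" using that by auto
          then have "real (Suc n) * (x - c) > 1" by (simp add: field_simps del: of_nat_Suc)
          then show ?thesis by simp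
        qed
        then show ?thesis by (simp add: K_def smooth_step_deriv_eq_0)
      qed
      have le1: "inverse (real (Suc n)) \<le> 1" by (simp add: field_simps)
      have "(LINT x|lebesgue_on {c..c+1}. K n x * h x) - h c = (LINT x|lebesgue_on {c..c+1}. K n x * (h x - h c))"
        using ih K1[of n] by (simp add: right_diff_distrib)
      also have "\<dots> = (LINT x|lebesgue_on {c..?c}. K n x * (h x - h c))"
        by (rule integral_lebesgue_on_subset) (use le1 z in auto)
      also have "norm \<dots> \<le> (LINT x|lebesgue_on {c..?c}. real (Suc n) * B * e')"
      proof (rule Bochner_Integration.integral_norm_bound_integral)
        show "integrable (lebesgue_on {c..?c}) (\<lambda>x. K n x * (h x - h c))"
          by (rule integrable_subinterval[OF id]) (use le1 in auto)
        show "integrable (lebesgue_on {c..?c}) (\<lambda>x. real (Suc n) * B * e')" by (intro continuous_imp_integrable_real continuous_intros)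
        fix x assume "x \<in> space (lebesgue_on {c..?c})"
        then have x: "x \<in> {c..?c}" by simp
        have "\<bar>h x - h c\<bar> \<le> e'" using d(2)[of x] x dn le1 by force
        moreover have "\<bar>K n x\<bar> \<le> real (Suc n) * B" using B by (simp add: K_def abs_mult mult_left_mono)
        ultimately show "norm (K n x * (h x - h c)) \<le> real (Suc n) * B * e'"
          unfolding real_norm_def abs_mult using B by (intro mult_mono) auto
      qed
      also have "\<dots> = B * e'" by (simp add: measure_restrict_space)
      also have "\<dots> < e" using e B by (simp add: e'_def)
      finally show ?thesis .
    qed
    then show "\<exists>no. \<forall>n\<ge>no. norm ((LINT x|lebesgue_on {c..c+1}. K n x * h x) - h c) < e" by blast
  qed
  then show ?thesis by (simp add: K_def)
qed

text \<open>The identity, which says h' = - w, is tested with the difference of two steps rising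
  just after s and just after t, a smooth approximation of the indicator of (s, t]. The derivative
  of this test function is a difference of two kernels as above, so the continuity of h produces the
  values h s and h t.\<close>

lemma du_Bois_Reymond:
  fixes h w :: "real \<Rightarrow> real"
  assumes h: "continuous_on {0<..} h" and w: "\<And>a b. 0 < a \<Longrightarrow> a < b \<Longrightarrow> integrable (lebesgue_on {a..b}) w"
    and eq: "\<And>\<psi>. \<psi> \<in> test_functions {0<..} \<Longrightarrow>
      (LINT t|lebesgue_on {0<..}. deriv \<psi> t * h t) = (LINT t|lebesgue_on {0<..}. \<psi> t * w t)"
    and st: "0 < s" "s < t"
  shows "h t - h s = - (LINT \<tau>|lebesgue_on {s..t}. w \<tau>)"
proof -
  define \<psi> where "\<psi> n x = smooth_step (real (Suc n) * (x - s)) - smooth_step (real (Suc n) * (x - t))" for n x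
  define K where "K c n x = real (Suc n) * smooth_step_deriv (real (Suc n) * (x - c))" for c n x
  have contK: "continuous_on S (K c n)" for S c n
    unfolding K_def by (intro continuous_intros continuous_on_compose2[OF continuous_smooth_step_deriv[of UNIV]]) auto
  have K0: "K c n x = 0" if "x \<notin> {c..c+1}" for c n x
  proof -
    have "real (Suc n) * (x - c) \<notin> {0..1}"
    proof (cases "x < c")
      case True then have "real (Suc n) * (x - c) < 0" by (intro mult_pos_neg) auto
      then show ?thesis by simp
    next
      case False
      then have "x - c > 1" using that by auto
      then have "1 * 1 < real (Suc n) * (x - c)" by (intro mult_le_less_imp_less) auto
      then show ?thesis by simp
    qed
    then show ?thesis by (simp add: K_def smooth_step_deriv_eq_0)
  qed
  have psi0: "\<psi> n x = 0" if "x \<notin> {s..t+1}" for n x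
  proof (cases "x < s")
    case True
    then have "real (Suc n) * (x - s) \<le> 0" "real (Suc n) * (x - t) \<le> 0" using st by (auto intro!: mult_nonneg_nonpos simp del: of_nat_Suc)
    then show ?thesis by (simp add: \<psi>_def smooth_step_le_0)
  next
    case False
    then have "x - t \<ge> 1" "x - s \<ge> 1" using that st by auto
    then have "real (Suc n) * (x - s) \<ge> 1 * 1" "real (Suc n) * (x - t) \<ge> 1 * 1" by (intro mult_mono; simp)+
    then show ?thesis by (simp add: \<psi>_def smooth_step_ge_1)
  qed
  have sub: "{s..t+1} \<subseteq> {0<..}" using st by auto
  have test: "\<psi> n \<in> test_functions {0<..}" for n
    unfolding test_functions_def
  proof (intro CollectI conjI exI[of _ "{s..t+1}"] allI impI)
    show "smooth (\<psi> n)" unfolding \<psi>_def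
      by (intro smooth_diff smooth_smooth_step smooth_mult smooth_const smooth_id)
  qed (use sub psi0 in auto)
  have der: "deriv (\<psi> n) x = K s n x - K t n x" for n x
  proof (rule DERIV_imp_deriv)
    have "((\<lambda>x. smooth_step (real (Suc n) * (x - c))) has_real_derivative K c n x) (at x)" for c
    proof -
      have "((\<lambda>x. real (Suc n) * (x - c)) has_real_derivative real (Suc n)) (at x)"
        by (auto intro!: derivative_eq_intros)
      from DERIV_chain2[OF DERIV_smooth_step this] show ?thesis by (simp only: K_def mult.commute)
    qed
    then show "(\<psi> n has_real_derivative K s n x - K t n x) (at x)"
      unfolding \<psi>_def by (intro DERIV_diff)
  qed
  have lhs: "(LINT x|lebesgue_on {0<..}. deriv (\<psi> n) x * h x) = (LINT x|lebesgue_on {s..s+1}. K s n x * h x) - (LINT x|lebesgue_on {t..t+1}. K t n x * h x)" for n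
  proof -
    have hc: "continuous_on {s..t+1} h" using h continuous_on_subset sub by blast
    have i: "integrable (lebesgue_on {s..t+1}) (\<lambda>x. K c n x * h x)" for c
      by (intro continuous_imp_integrable_real continuous_intros contK hc)
    have "(LINT x|lebesgue_on {0<..}. deriv (\<psi> n) x * h x) = (LINT x|lebesgue_on {s..t+1}. deriv (\<psi> n) x * h x)"
      by (rule integral_lebesgue_on_subset[OF sub]) (use st in \<open>auto simp: der K0\<close>)
    also have "\<dots> = (LINT x|lebesgue_on {s..t+1}. K s n x * h x) - (LINT x|lebesgue_on {s..t+1}. K t n x * h x)"
      using i by (simp add: der left_diff_distrib)
    also have "(LINT x|lebesgue_on {s..t+1}. K s n x * h x) = (LINT x|lebesgue_on {s..s+1}. K s n x * h x)"
      by (rule integral_lebesgue_on_subset) (use st K0 in auto)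
    also have "(LINT x|lebesgue_on {s..t+1}. K t n x * h x) = (LINT x|lebesgue_on {t..t+1}. K t n x * h x)"
      by (rule integral_lebesgue_on_subset) (use st K0 in auto)
    finally show ?thesis .
  qed
  have limL: "(\<lambda>n. LINT x|lebesgue_on {0<..}. deriv (\<psi> n) x * h x) \<longlonglongrightarrow> h s - h t"
    unfolding lhs K_def using st 
    by (intro tendsto_diff smooth_step_kernel continuous_on_subset[OF h]) auto
  have wI: "integrable (lebesgue_on {s..t+1}) w" using w st by simp
  have "(LINT x|lebesgue_on {0<..}. \<psi> n x * w x) = (LINT x|lebesgue_on {s..t+1}. \<psi> n x * w x)" for n
    by (rule integral_lebesgue_on_subset[OF sub]) (use st psi0 in auto)
  moreover have "(\<lambda>n. LINT x|lebesgue_on {s..t+1}. \<psi> n x * w x) \<longlonglongrightarrow> (LINT x|lebesgue_on {s..t+1}. indicat_real {s<..t} x * w x)"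
  proof (rule integral_dominated_convergence[where w="\<lambda>x. \<bar>w x\<bar>"])
    have [measurable]: "\<psi> n \<in> borel_measurable (lebesgue_on {s..t+1})" for n
      using test test_functions_smooth smooth_borel_measurable by blast
    have [measurable]: "w \<in> borel_measurable (lebesgue_on {s..t+1})" using wI by auto
    show "(\<lambda>x. \<psi> n x * w x) \<in> borel_measurable (lebesgue_on {s..t+1})" for n by measurable
    have "indicat_real {s<..t} \<in> borel_measurable (lebesgue_on {s..t+1})"
      by (intro measurable_restrict_space1 borel_measurable_indicator) auto
    then show "(\<lambda>x. indicat_real {s<..t} x * w x) \<in> borel_measurable (lebesgue_on {s..t+1})" by measurable
    have big: "\<forall>\<^sub>F n in sequentially. smooth_step (real (Suc n) * (x - c)) = 1" if "x > c" for x c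
    proof -
      have "filterlim (\<lambda>n. real (Suc n) * (x - c)) at_top sequentially"
        using that by (intro filterlim_at_top_mult_tendsto_pos[OF tendsto_const] 
           filterlim_compose[OF filterlim_real_sequentially filterlim_Suc]) auto
      then have "\<forall>\<^sub>F n in sequentially. real (Suc n) * (x - c) \<ge> 1" by (simp add: filterlim_at_top)
      then show ?thesis by eventually_elim (rule smooth_step_ge_1)
    qed
    have small: "smooth_step (real (Suc n) * (x - c)) = 0" if "x \<le> c" for x c n
      by (intro smooth_step_le_0 mult_nonneg_nonpos) (use that in auto)
    have "(\<lambda>n. \<psi> n x) \<longlonglongrightarrow> indicat_real {s<..t} x" for x
    proof -
      consider "x \<le> s" | "s < x" "x \<le> t" | "t < x" by linarith
      then show ?thesis
      proof cases
        case 1 then show ?thesis using st small[of x s] small[of x t] by (simp add: \<psi>_def)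
      next
        case 2
        have "\<forall>\<^sub>F n in sequentially. \<psi> n x = 1"
          using big[OF 2(1)] by eventually_elim (use small[OF 2(2)] in \<open>simp add: \<psi>_def\<close>)
        then show ?thesis using 2 by (simp add: tendsto_eventually)
      next
        case 3
        then have "s < x" using st by simp
        have "\<forall>\<^sub>F n in sequentially. \<psi> n x = 0"
          using big[OF \<open>s < x\<close>] big[OF 3] by eventually_elim (simp add: \<psi>_def)
        then show ?thesis using 3 by (simp add: tendsto_eventually)
      qed
    qed
    then show "AE x in lebesgue_on {s..t+1}. (\<lambda>n. \<psi> n x * w x) \<longlonglongrightarrow> indicat_real {s<..t} x * w x"
      by (intro AE_I2 tendsto_mult tendsto_const)
    have "\<bar>\<psi> n x\<bar> \<le> 1" for n x
      using smooth_step_bounds[of "real (Suc n) * (x - s)"] smooth_step_bounds[of "real (Suc n) * (x - t)"]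
      unfolding \<psi>_def by linarith
    then show "AE x in lebesgue_on {s..t+1}. norm (\<psi> n x * w x) \<le> \<bar>w x\<bar>" for n
      by (intro AE_I2) (simp add: abs_mult mult_left_le_one_le)
  qed (use wI in auto)
  ultimately have limR: "(\<lambda>n. LINT x|lebesgue_on {0<..}. \<psi> n x * w x) \<longlonglongrightarrow> (LINT x|lebesgue_on {s..t+1}. indicat_real {s<..t} x * w x)" by simp
  have "(LINT x|lebesgue_on {s..t+1}. indicat_real {s<..t} x * w x) = (LINT x|lebesgue_on {s<..t}. indicat_real {s<..t} x * w x)"
    by (rule integral_lebesgue_on_subset) auto
  also have "\<dots> = (LINT x|lebesgue_on {s<..t}. w x)" by (rule Bochner_Integration.integral_cong) auto
  also have "\<dots> = (LINT x|lebesgue_on {s..t}. w x)"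
  proof -
    have i1: "integrable (lebesgue_on {s..t}) w" using w st by simp
    have i2: "integrable (lebesgue_on {s<..t}) w" by (rule integrable_lebesgue_on_subset[OF i1]) auto
    have "integral\<^sup>L (lebesgue_on {s..t}) w = integral {s..t} w" "integral\<^sup>L (lebesgue_on {s<..t}) w = integral {s<..t} w"
      by (rule lebesgue_integral_eq_integral[OF i1], simp, rule lebesgue_integral_eq_integral[OF i2], simp)
    moreover have "integral {s<..t} w = integral {s..t} w"
    proof (rule integral_spike_set)
      have "{x \<in> {s<..t} - {s..t}. w x \<noteq> 0} \<union> {x \<in> {s..t} - {s<..t}. w x \<noteq> 0} \<subseteq> {s}" by auto
      then show "negligible {x \<in> {s<..t} - {s..t}. w x \<noteq> 0}" "negligible {x \<in> {s..t} - {s<..t}. w x \<noteq> 0}"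
        using negligible_subset[of "{s}"] by auto
    qed
    ultimately show ?thesis by simp
  qed
  finally have "h s - h t = (LINT x|lebesgue_on {s..t}. w x)" using LIMSEQ_unique[OF limL] limR eq[OF test] by simp
  then show ?thesis by linarith
qed

section \<open>Measurability in time of weak solutions\<close>

lemma powr_le_powr_plus_1:
  fixes x :: real
  assumes "0 \<le> x" "0 \<le> a" "a \<le> b" shows "x powr a \<le> x powr b + 1"
proof (cases "x \<le> 1")
  case True
  then have "x powr a \<le> 1" using assms powr_mono2[of a x 1] by simp
  then show ?thesis using powr_ge_zero[of x b] by linarith
next
  case False
  then have "x powr a \<le> x powr b" using assms by (intro powr_mono) auto
  then show ?thesis by simp
qed

text \<open>A function with finitely many values remains simple under composition with an arbitrary
  functional \<open>c\<close>, for instance one that involves \<open>weak_gradient\<close>.\<close>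

lemma borel_measurable_simple_valued:
  assumes "simple_valued I X s" "I \<in> sets lebesgue"
  shows "(\<lambda>t. c (s t) :: real) \<in> borel_measurable (lebesgue_on I)"
proof -
  have "simple_function (lebesgue_on I) s"
    unfolding simple_function_def
  proof (intro conjI ballI)
    show "finite (s ` space (lebesgue_on I))" using assms by (simp add: simple_valued_def space_restrict_space)
    fix w assume "w \<in> s ` space (lebesgue_on I)"
    then have "{t \<in> I. s t = w} \<in> sets lebesgue" using assms by (auto simp: simple_valued_def space_restrict_space)
    moreover have "s -` {w} \<inter> space (lebesgue_on I) = {t \<in> I. s t = w}" by (auto simp: space_restrict_space)
    ultimately show "s -` {w} \<inter> space (lebesgue_on I) \<in> sets (lebesgue_on I)"
      using assms(2) by (auto simp: sets_restrict_space_iff)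
  qed
  then have "simple_function (lebesgue_on I) (c \<circ> s)" by (rule simple_function_compose)
  then show ?thesis using borel_measurable_simple_function by (fastforce simp: o_def)
qed

text \<open>One fixed solution with its data. Constants that have to be uniform over all solutions,
  such as \<open>source_const\<close> and \<open>smoothing_const\<close>, are defined outside this
  locale.\<close>

locale rd_solution = bounded_open D
  for D :: "'a::euclidean_space set" +
  fixes lam p l \<kappa> \<alpha> \<beta> \<sigma> :: real and f :: "real \<Rightarrow> real" and g u0 :: "'a \<Rightarrow> real"
    and u :: "real \<Rightarrow> 'a \<Rightarrow> real"
  assumes lam: "lam > 0" and p: "p > 2" and \<alpha>: "\<alpha> > 0" and \<beta>: "\<beta> > 0" and \<sigma>: "\<sigma> > 0"
    and f: "nonlinearity p l \<kappa> \<alpha> \<beta> \<sigma> f" and g: "g \<in> Lspace D 2"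
    and sol: "weak_solution D lam p f g u0 u"
begin

lemma f_cont: "continuous_on S f"
  using f by (auto simp: nonlinearity_def intro!: continuous_at_imp_continuous_on differentiable_imp_continuous_within)

lemma f_measurable[measurable]: "f \<in> borel_measurable borel"
  by (rule borel_measurable_continuous_onI[OF f_cont])

text \<open>The exponent p - 1 is raised to p, so that f (u t x) is integrable over D as soon as u t
  is in L^p. This suffices for pairings with bounded functions.\<close>

lemma f_growth: "\<bar>f s\<bar> \<le> \<sigma> * \<bar>s\<bar> powr p + 2 * \<sigma>"
proof -
  have "\<bar>f s\<bar> \<le> \<sigma> * \<bar>s\<bar> powr (p - 1) + \<sigma>" using f by (simp add: nonlinearity_def)
  also have "\<dots> \<le> \<sigma> * (\<bar>s\<bar> powr p + 1) + \<sigma>"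
    using \<sigma> p by (intro add_right_mono mult_left_mono powr_le_powr_plus_1) auto
  finally show ?thesis by (simp add: algebra_simps)
qed

lemma g_sq: "square_integrable L g" using g by (simp add: Lspace_2_iff)

lemma sq_imp_integrable: "square_integrable L v \<Longrightarrow> integrable L v" for v :: "'a \<Rightarrow> real"
  using integrable_inner[of L v "\<lambda>x. 1"] by (simp add: square_integrable_def)

lemma u_sq: "t \<ge> 0 \<Longrightarrow> square_integrable L (u t)"
  using sol by (auto simp: weak_solution_def C_L2_def Lspace_2_iff)

lemma u_measurable: "t \<ge> 0 \<Longrightarrow> u t \<in> borel_measurable L"
  using u_sq square_integrableD by blast

lemma u_tendsto:
  assumes "\<And>n. t n \<ge> 0" "c \<ge> 0" "t \<longlonglongrightarrow> c"
  shows "(\<lambda>n. \<integral>x. (norm (u (t n) x - u c x))\<^sup>2 \<partial>L) \<longlonglongrightarrow> 0"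
proof -
  let ?d = "\<lambda>r. Lnorm_pow D 2 (\<lambda>x. u r x - u c x)"
  have d: "?d r = ennreal (\<integral>x. (norm (u r x - u c x))\<^sup>2 \<partial>L)" if "r \<ge> 0" for r
    by (intro Lnorm_pow_2 square_integrable_diff u_sq that assms)
  have "(?d \<longlongrightarrow> 0) (at c within {0..})" using sol assms(2) by (auto simp: weak_solution_def C_L2_def)
  \<comment> \<open>The limit in \<open>C_L2\<close> omits the point c itself. As the expression
    vanishes there, it is continuous at c, and the sequence t may take the value c.\<close>
  then have "continuous (at c within {0..}) ?d" using d[OF assms(2)] by (simp add: continuous_within)
  then have "(\<lambda>n. ?d (t n)) \<longlonglongrightarrow> ?d c"
    using assms(1,3) unfolding continuous_within_sequentially o_def by auto
  then have "(\<lambda>n. ennreal (\<integral>x. (norm (u (t n) x - u c x))\<^sup>2 \<partial>L)) \<longlonglongrightarrow> ennreal 0"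
    using d[OF assms(1)] d[OF assms(2)] by simp
  then show ?thesis by (subst (asm) tendsto_ennreal_iff) auto
qed

lemma continuous_compose:
  fixes z :: "'a \<Rightarrow> real" and \<Psi> :: "real \<Rightarrow> real"
  assumes "integrable L z" "continuous_on UNIV \<Psi>" "\<And>s. \<bar>\<Psi> s\<bar> \<le> B"
  shows "continuous_on {0..} (\<lambda>t. \<integral>x. z x * \<Psi> (u t x) \<partial>L)"
  unfolding continuous_on_sequentially o_def
proof (intro allI ballI impI, elim conjE)
  fix t c assume "c \<in> {0::real..}" "\<forall>n. t n \<in> {0::real..}" "t \<longlonglongrightarrow> c"
  then show "(\<lambda>n. \<integral>x. z x * \<Psi> (u (t n) x) \<partial>L) \<longlonglongrightarrow> (\<integral>x. z x * \<Psi> (u c x) \<partial>L)"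
    by (intro tendsto_integral_compose_L2[where B=B] u_sq u_tendsto assms) auto
qed

lemma continuous_inner_u:
  assumes "square_integrable L v"
  shows "continuous_on {0..} (\<lambda>t. \<integral>x. u t x * v x \<partial>L)"
  unfolding continuous_on_sequentially o_def
proof (intro allI ballI impI, elim conjE)
  fix t c assume "c \<in> {0::real..}" "\<forall>n. t n \<in> {0::real..}" "t \<longlonglongrightarrow> c"
  then show "(\<lambda>n. \<integral>x. u (t n) x * v x \<partial>L) \<longlonglongrightarrow> (\<integral>x. u c x * v x \<partial>L)"
    using tendsto_integral_inner[OF _ _ assms u_tendsto[of t c]] u_sq by auto
qed

lemma lipschitz_continuous_on:
  fixes F :: "real \<Rightarrow> real"
  assumes lip: "\<And>x y. \<bar>F x - F y\<bar> \<le> K * \<bar>x - y\<bar>"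
  shows "continuous_on UNIV F"
proof -
  have "(F \<longlongrightarrow> F x) (at x)" for x
  proof (rule LIM_zero_cancel, rule Lim_null_comparison)
    show "\<forall>\<^sub>F y in at x. norm (F y - F x) \<le> K * \<bar>y - x\<bar>" using lip by simp
    show "((\<lambda>y. K * \<bar>y - x\<bar>) \<longlongrightarrow> 0) (at x)" by (auto intro!: tendsto_eq_intros)
  qed
  then show ?thesis by (simp add: continuous_on_def)
qed

lemma lipschitz_integrable:
  fixes F :: "real \<Rightarrow> real"
  assumes lip: "\<And>x y. \<bar>F x - F y\<bar> \<le> K * \<bar>x - y\<bar>" and v: "square_integrable L v"
  shows "integrable L (\<lambda>x. F (v x))"
proof -
  note [measurable] = borel_measurable_continuous_onI[OF lipschitz_continuous_on[OF lip]] square_integrableD(1)[OF v]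
  have "integrable L (\<lambda>x. K * \<bar>v x\<bar> + \<bar>F 0\<bar>)" using sq_imp_integrable[OF v] by simp
  moreover have "AE x in L. norm (F (v x)) \<le> norm (K * \<bar>v x\<bar> + \<bar>F 0\<bar>)"
    using lip[of _ 0] by (intro AE_I2) (smt (verit, best) diff_zero real_norm_def)
  moreover have "(\<lambda>x. F (v x)) \<in> borel_measurable L" by measurable
  ultimately show ?thesis using Bochner_Integration.integrable_bound by blast
qed

text \<open>The energies are integrals of functions F of linear growth, to which the result for
  bounded functions does not apply. Cauchy-Schwarz against the constant 1 on D estimates their
  difference by the L^2 distance.\<close>

lemma continuous_lipschitz:
  fixes F :: "real \<Rightarrow> real"
  assumes lip: "\<And>x y. \<bar>F x - F y\<bar> \<le> K * \<bar>x - y\<bar>"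
  shows "continuous_on {0..} (\<lambda>t. \<integral>x. F (u t x) \<partial>L)"
  unfolding continuous_on_sequentially o_def
proof (intro allI ballI impI, elim conjE)
  fix t c assume tc: "c \<in> {0::real..}" "\<forall>n. t n \<in> {0::real..}" "t \<longlonglongrightarrow> c"
  have K: "K \<ge> 0" using lip[of 1 0] by auto
  have one: "square_integrable L (\<lambda>x. 1::real)" by (simp add: square_integrable_def)
  show "(\<lambda>n. \<integral>x. F (u (t n) x) \<partial>L) \<longlonglongrightarrow> (\<integral>x. F (u c x) \<partial>L)"
  proof (rule LIM_zero_cancel, rule Lim_null_comparison)
    let ?b = "\<lambda>n. K * (sqrt (\<integral>x. (norm (u (t n) x - u c x))\<^sup>2 \<partial>L) * sqrt (\<integral>x. (norm (1::real))\<^sup>2 \<partial>L))"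
    have "norm ((\<integral>x. F (u (t n) x) \<partial>L) - (\<integral>x. F (u c x) \<partial>L)) \<le> ?b n" for n
    proof -
      have sq: "square_integrable L (u (t n))" "square_integrable L (u c)" using u_sq tc by auto
      have i: "integrable L (\<lambda>x. F (u (t n) x))" "integrable L (\<lambda>x. F (u c x))"
        using lipschitz_integrable[OF lip] sq by auto
      have sd: "square_integrable L (\<lambda>x. \<bar>u (t n) x - u c x\<bar>)"
        by (rule square_integrable_bound[OF square_integrable_diff[OF sq], where c=1])
          (use square_integrableD(1)[OF square_integrable_diff[OF sq]] in auto)
      have "norm ((\<integral>x. F (u (t n) x) \<partial>L) - (\<integral>x. F (u c x) \<partial>L)) = norm (\<integral>x. F (u (t n) x) - F (u c x) \<partial>L)"
        using i by simp
      also have "\<dots> \<le> (\<integral>x. K * \<bar>u (t n) x - u c x\<bar> \<partial>L)"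
        by (rule Bochner_Integration.integral_norm_bound_integral) 
          (use i lip sq_imp_integrable[OF sd] in auto)
      also have "\<dots> = K * (\<integral>x. \<bar>u (t n) x - u c x\<bar> \<bullet> 1 \<partial>L)" by simp
      also have "\<dots> \<le> K * (sqrt (\<integral>x. (norm \<bar>u (t n) x - u c x\<bar>)\<^sup>2 \<partial>L) * sqrt (\<integral>x. (norm (1::real))\<^sup>2 \<partial>L))"
        using Cauchy_Schwarz_integral[OF sd one] K by (intro mult_left_mono) auto
      finally show ?thesis by simp
    qed
    then show "\<forall>\<^sub>F n in sequentially. norm ((\<integral>x. F (u (t n) x) \<partial>L) - (\<integral>x. F (u c x) \<partial>L)) \<le> ?b n" by simp
    have "(\<lambda>n. \<integral>x. (norm (u (t n) x - u c x))\<^sup>2 \<partial>L) \<longlonglongrightarrow> 0" using u_tendsto tc by auto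
    from tendsto_real_sqrt[OF this]
    have "(\<lambda>n. sqrt (\<integral>x. (norm (u (t n) x - u c x))\<^sup>2 \<partial>L)) \<longlonglongrightarrow> 0" by (simp only: real_sqrt_zero)
    then show "?b \<longlonglongrightarrow> 0" by (intro tendsto_mult_right_zero tendsto_mult_left_zero)
  qed
qed

text \<open>The times at which u t has a weak gradient and a finite p-th power integral; at other
  times \<open>weak_gradient D (u t)\<close> may be meaningless. Almost every time in a compact
  subinterval of (0, \<infinity>) is good.\<close>

definition good :: "real \<Rightarrow> bool" where "good t \<longleftrightarrow> t > 0 \<and> u t \<in> H10 D \<and> u t \<in> Lspace D p"

lemma AE_good:
  assumes "0 < a" "a < b" shows "AE t in lebesgue_on {a..b}. good t"
proof -
  have "AE t in lebesgue_on {a..b}. u t \<in> H10 D" "AE t in lebesgue_on {a..b}. u t \<in> Lspace D p"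
    using sol assms by (auto simp: weak_solution_def Bochner_loc_def)
  moreover have "AE t in lebesgue_on {a..b}. t > 0" using assms by (intro AE_I2) auto
  ultimately show ?thesis by eventually_elim (simp add: good_def)
qed

lemma goodD:
  assumes "good t"
  shows "t > 0" "u t \<in> H10 D" "square_integrable L (weak_gradient D (u t))" "integrable L (\<lambda>x. \<bar>u t x\<bar> powr p)"
    "has_weak_gradient D (u t) (weak_gradient D (u t))"
proof -
  show t: "t > 0" and h: "u t \<in> H10 D" using assms by (auto simp: good_def)
  show "square_integrable L (weak_gradient D (u t))" "has_weak_gradient D (u t) (weak_gradient D (u t))"
    using h by (auto simp: H10_def H1_iff has_weak_gradient_iff)
  have "u t \<in> Lspace D p" using assms by (simp add: good_def)
  then show "integrable L (\<lambda>x. \<bar>u t x\<bar> powr p)"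
    by (auto simp: Lspace_def Lnorm_pow_def integrable_iff_bounded)
qed

lemma grad_approx:
  assumes "0 < a" "a < b"
  obtains s where "\<And>n. simple_valued {a..b} (H10 D) (s n)"
    "AE t in lebesgue_on {a..b}. (\<lambda>n::nat. \<integral>x. (norm (weak_gradient D (s n t) x - weak_gradient D (u t) x))\<^sup>2 \<partial>L) \<longlonglongrightarrow> 0"
proof -
  have "strongly_measurable {a..b} (H10 D) (H1norm_sq D) u"
    using sol assms by (auto simp: weak_solution_def Bochner_loc_def)
  then obtain s where s: "\<And>n. simple_valued {a..b} (H10 D) (s n)"
    "AE t in lebesgue_on {a..b}. (\<lambda>n::nat. H1norm_sq D (\<lambda>x. u t x - s n t x)) \<longlonglongrightarrow> 0"
    by (auto simp: strongly_measurable_def)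
  have "AE t in lebesgue_on {a..b}. t \<in> {a..b}" by (rule AE_I2) auto
  with s(2) AE_good[OF assms] 
  have "AE t in lebesgue_on {a..b}. (\<lambda>n::nat. \<integral>x. (norm (weak_gradient D (s n t) x - weak_gradient D (u t) x))\<^sup>2 \<partial>L) \<longlonglongrightarrow> 0"
  proof eventually_elim
    case (elim t)
    have "s n t \<in> H10 D" for n using s(1)[of n] elim by (auto simp: simple_valued_def)
    then have h: "square_integrable L (s n t)" "has_weak_gradient D (s n t) (weak_gradient D (s n t))" for n
      by (auto simp: H10_def H1_iff)
    have eq: "H1norm_sq D (\<lambda>x. u t x - s n t x) = ennreal ((\<integral>x. (norm (u t x - s n t x))\<^sup>2 \<partial>L)
       + (\<integral>x. (norm (weak_gradient D (u t) x - weak_gradient D (s n t) x))\<^sup>2 \<partial>L))" for n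
      using goodD[OF elim(2)] by (intro H1norm_sq_eq square_integrable_diff has_weak_gradient_diff h u_sq) auto
    have "(\<lambda>n. \<integral>x. (norm (weak_gradient D (u t) x - weak_gradient D (s n t) x))\<^sup>2 \<partial>L) \<longlonglongrightarrow> 0"
      using elim(1) unfolding eq by (subst (asm) ennreal_add_tendsto_0) auto
    then show ?case by (simp add: norm_minus_commute)
  qed
  then show ?thesis using s(1) that by blast
qed

text \<open>Along the simple-valued approximations the distance takes finitely many values, hence is
  measurable in time, and it converges for almost every t. Distances to a fixed field W suffice,
  since inner products are recovered from them by polarization.\<close>

lemma grad_dist_measurable:
  assumes "0 < a" "a < b" and W: "square_integrable L W"
  shows "(\<lambda>t. \<integral>x. (norm (weak_gradient D (u t) x - W x))\<^sup>2 \<partial>L) \<in> borel_measurable (lebesgue_on {a..b})"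
proof -
  obtain s where s: "\<And>n. simple_valued {a..b} (H10 D) (s n)"
    "AE t in lebesgue_on {a..b}. (\<lambda>n::nat. \<integral>x. (norm (weak_gradient D (s n t) x - weak_gradient D (u t) x))\<^sup>2 \<partial>L) \<longlonglongrightarrow> 0"
    using grad_approx[OF assms(1,2)] by blast
  have m: "(\<lambda>t. \<integral>x. (norm (weak_gradient D (s n t) x - W x))\<^sup>2 \<partial>L) \<in> borel_measurable (lebesgue_on {a..b})" for n
    by (rule borel_measurable_simple_valued[OF s(1), where c="\<lambda>v. \<integral>x. (norm (weak_gradient D v x - W x))\<^sup>2 \<partial>L"]) auto
  have "AE t in lebesgue_on {a..b}. t \<in> {a..b}" by (rule AE_I2) auto
  with s(2) AE_good[OF assms(1,2)] 
  have "AE t in lebesgue_on {a..b}. (\<lambda>n. \<integral>x. (norm (weak_gradient D (s n t) x - W x))\<^sup>2 \<partial>L)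
     \<longlonglongrightarrow> (\<integral>x. (norm (weak_gradient D (u t) x - W x))\<^sup>2 \<partial>L)"
  proof eventually_elim
    case (elim t)
    have "s n t \<in> H10 D" for n using s(1)[of n] elim by (auto simp: simple_valued_def)
    then have "square_integrable L (weak_gradient D (s n t))" for n
      by (auto simp: H10_def H1_iff has_weak_gradient_iff)
    with goodD(3)[OF elim(2)] W elim(1) show ?case
      by (intro tendsto_integral_norm_sq square_integrable_diff) auto
  qed
  then show ?thesis by (intro borel_measurable_AE_LIMSEQ[OF _ m]) auto
qed

definition Ngrad :: "real \<Rightarrow> real" where "Ngrad t = (\<integral>x. (norm (weak_gradient D (u t) x))\<^sup>2 \<partial>L)"

lemma Ngrad_nonneg: "Ngrad t \<ge> 0" by (simp add: Ngrad_def)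

lemma Ngrad_integrable:
  assumes "0 < a" "a < b" shows "integrable (lebesgue_on {a..b}) Ngrad"
proof (rule integrableI_nonneg)
  show "Ngrad \<in> borel_measurable (lebesgue_on {a..b})"
    using grad_dist_measurable[OF assms square_integrable_zero] by (simp add: Ngrad_def[abs_def])
  have "AE t in lebesgue_on {a..b}. ennreal (Ngrad t) \<le> H1norm_sq D (u t)"
    using AE_good[OF assms]
  proof eventually_elim
    case (elim t)
    have "H1norm_sq D (u t) = ennreal ((\<integral>x. (norm (u t x))\<^sup>2 \<partial>L) + Ngrad t)"
      unfolding Ngrad_def using goodD[OF elim] u_sq by (intro H1norm_sq_eq) auto
    then show ?case by (simp add: ennreal_leI)
  qed
  then have "(\<integral>\<^sup>+ t. ennreal (Ngrad t) \<partial>lebesgue_on {a..b}) \<le> (\<integral>\<^sup>+ t. H1norm_sq D (u t) \<partial>lebesgue_on {a..b})"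
    by (rule nn_integral_mono_AE)
  also have "\<dots> < \<infinity>" using sol assms by (auto simp: weak_solution_def Bochner_loc_def)
  finally show "(\<integral>\<^sup>+ t. ennreal (Ngrad t) \<partial>lebesgue_on {a..b}) < \<infinity>" .
qed (auto simp: Ngrad_nonneg)

text \<open>
  Joint measurability of \<open>(t, x) \<mapsto> u t x\<close> is not available, since \<open>u\<close> is a function of time with values in
  representatives of classes of functions. Measurability in time therefore comes from
  the continuity in \<open>L\<^sup>2\<close>, by cutting off the integrand.
\<close>

lemma Lnorm_pow_measurable:
  assumes "0 \<le> a" and q: "q > 0"
  shows "(\<lambda>t. Lnorm_pow D q (u t)) \<in> borel_measurable (lebesgue_on {a..b})"
proof -
  define h where "h n t = (\<integral>x. 1 * (min \<bar>u t x\<bar> (real n) powr q) \<partial>L)" for n t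
  have ch: "continuous_on {0..} (h n)" for n unfolding h_def
  proof (rule continuous_compose[where B="real n powr q"])
    show "continuous_on UNIV (\<lambda>s. min \<bar>s\<bar> (real n) powr q)" using q by (intro continuous_on_powr' continuous_intros) auto
    show "\<bar>min \<bar>s\<bar> (real n) powr q\<bar> \<le> real n powr q" for s using q by (auto intro!: powr_mono2)
  qed auto
  have "(\<lambda>n. ennreal (h n t)) \<longlonglongrightarrow> Lnorm_pow D q (u t)" if t: "t \<ge> 0" for t
  proof -
    note [measurable] = u_measurable[OF t]
    have "ennreal (h n t) = (\<integral>\<^sup>+x. ennreal (min \<bar>u t x\<bar> (real n) powr q) \<partial>L)" for n
    proof -
      have "integrable L (\<lambda>x. min \<bar>u t x\<bar> (real n) powr q)"
        by (rule L.integrable_const_bound[where B="real n powr q"]) (use q in \<open>auto intro!: AE_I2 powr_mono2\<close>)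
      then show ?thesis by (simp add: h_def nn_integral_eq_integral)
    qed
    moreover have "(\<lambda>n. \<integral>\<^sup>+x. ennreal (min \<bar>u t x\<bar> (real n) powr q) \<partial>L) \<longlonglongrightarrow> (\<integral>\<^sup>+x. ennreal (\<bar>u t x\<bar> powr q) \<partial>L)"
    proof (rule nn_integral_LIMSEQ)
      show "incseq (\<lambda>n x. ennreal (min \<bar>u t x\<bar> (real n) powr q))"
        using q by (intro incseq_SucI le_funI ennreal_leI powr_mono2) auto
      show "(\<lambda>n. ennreal (min \<bar>u t x\<bar> (real n) powr q)) \<longlonglongrightarrow> ennreal (\<bar>u t x\<bar> powr q)" for x
      proof (rule tendsto_eventually)
        obtain N where "\<bar>u t x\<bar> \<le> real N" using real_arch_simple by blast
        then show "\<forall>\<^sub>F n in sequentially. ennreal (min \<bar>u t x\<bar> (real n) powr q) = ennreal (\<bar>u t x\<bar> powr q)"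
          by (intro eventually_mono[OF eventually_ge_at_top[of N]]) (simp add: min_absorb1)
      qed
    qed auto
    ultimately show ?thesis by (simp add: Lnorm_pow_def)
  qed
  moreover have "h n \<in> borel_measurable (lebesgue_on {a..b})" for n
    using ch assms by (intro continuous_imp_measurable_on_sets_lebesgue continuous_on_subset[OF ch]) auto
  ultimately have lim: "\<And>t. t \<ge> 0 \<Longrightarrow> (\<lambda>n. ennreal (h n t)) \<longlonglongrightarrow> Lnorm_pow D q (u t)"
    and [measurable]: "\<And>n. h n \<in> borel_measurable (lebesgue_on {a..b})" by blast+
  show ?thesis
  proof (rule borel_measurable_LIMSEQ_order)
    show "(\<lambda>t. ennreal (h n t)) \<in> borel_measurable (lebesgue_on {a..b})" for n by measurable
    fix t assume "t \<in> space (lebesgue_on {a..b})"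
    then show "(\<lambda>n. ennreal (h n t)) \<longlonglongrightarrow> Lnorm_pow D q (u t)" using assms by (intro lim) simp
  qed
qed

definition Pint :: "real \<Rightarrow> real" where "Pint t = (\<integral>x. \<bar>u t x\<bar> powr p \<partial>L)"

lemma Pint_nonneg: "Pint t \<ge> 0" by (simp add: Pint_def)

lemma Pint_eq: "good t \<Longrightarrow> Lnorm_pow D p (u t) = ennreal (Pint t)"
  unfolding Lnorm_pow_def Pint_def by (intro nn_integral_eq_integral goodD) auto

lemma Pint_integrable:
  assumes "0 < a" "a < b" shows "integrable (lebesgue_on {a..b}) Pint"
proof (rule integrableI_nonneg)
  have [measurable]: "(\<lambda>t. Lnorm_pow D p (u t)) \<in> borel_measurable (lebesgue_on {a..b})"
    by (rule Lnorm_pow_measurable) (use assms p in auto)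
  have "(\<lambda>t. enn2real (Lnorm_pow D p (u t))) \<in> borel_measurable (lebesgue_on {a..b})" by measurable
  moreover have "AE t in lebesgue_on {a..b}. enn2real (Lnorm_pow D p (u t)) = Pint t"
    using AE_good[OF assms] by eventually_elim (simp add: Pint_eq Pint_nonneg)
  ultimately show "Pint \<in> borel_measurable (lebesgue_on {a..b})" by (rule borel_measurable_AE_cong[rotated]) simp
  have "(\<integral>\<^sup>+ t. ennreal (Pint t) \<partial>lebesgue_on {a..b}) = (\<integral>\<^sup>+ t. Lnorm_pow D p (u t) \<partial>lebesgue_on {a..b})"
    using AE_good[OF assms] by (intro nn_integral_cong_AE) (auto elim!: eventually_mono simp: Pint_eq)
  also have "\<dots> < \<infinity>" using sol assms by (auto simp: weak_solution_def Bochner_loc_def)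
  finally show "(\<integral>\<^sup>+ t. ennreal (Pint t) \<partial>lebesgue_on {a..b}) < \<infinity>" .
qed (auto simp: Pint_nonneg)

text \<open>The zero-order part of the equation, which becomes du/dt - \<Delta>u = - R. Only its L^1
  norm over D is controlled, by the function \<open>Rb\<close> of time; therefore it is always
  paired with bounded functions.\<close>

definition R :: "real \<Rightarrow> 'a \<Rightarrow> real" where "R t x = lam * u t x + f (u t x) - g x"
definition Rb :: "real \<Rightarrow> real" where
  "Rb t = (lam + \<sigma>) * Pint t + ((lam + 2 * \<sigma>) * measure L D + (\<integral>x. \<bar>g x\<bar> \<partial>L))"

lemma Rb_integrable: "0 < a \<Longrightarrow> a < b \<Longrightarrow> integrable (lebesgue_on {a..b}) Rb"
  unfolding Rb_def[abs_def]
  by (intro Bochner_Integration.integrable_add integrable_mult_right Pint_integrable) (auto intro: continuous_imp_integrable_real)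

lemma fu_integrable:
  assumes "good t" shows "integrable L (\<lambda>x. f (u t x))"
proof -
  note [measurable] = u_measurable[OF less_imp_le[OF goodD(1)[OF assms]]]
  have "integrable L (\<lambda>x. \<sigma> * \<bar>u t x\<bar> powr p + 2 * \<sigma>)" using goodD(4)[OF assms] by simp
  then show ?thesis
    by (rule Bochner_Integration.integrable_bound) (use f_growth \<sigma> in \<open>auto intro!: AE_I2\<close>)
qed

lemma R_integrable:
  assumes "good t" shows "integrable L (R t)" "(\<integral>x. \<bar>R t x\<bar> \<partial>L) \<le> Rb t"
proof -
  have i: "integrable L (u t)" "integrable L g" "integrable L (\<lambda>x. f (u t x))"
    using sq_imp_integrable u_sq goodD(1)[OF assms] g_sq fu_integrable[OF assms] by auto
  then show R: "integrable L (R t)" unfolding R_def[abs_def] by simp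
  have "\<bar>R t x\<bar> \<le> (lam + \<sigma>) * \<bar>u t x\<bar> powr p + (lam + 2 * \<sigma>) + \<bar>g x\<bar>" for x
  proof -
    have "lam * \<bar>u t x\<bar> \<le> lam * (\<bar>u t x\<bar> powr p + 1)"
      using powr_le_powr_plus_1[of "\<bar>u t x\<bar>" 1 p] p lam by (intro mult_left_mono) auto
    moreover have "\<bar>R t x\<bar> \<le> lam * \<bar>u t x\<bar> + \<bar>f (u t x)\<bar> + \<bar>g x\<bar>"
      using lam abs_triangle_ineq4[of "lam * u t x + f (u t x)" "g x"] abs_triangle_ineq[of "lam * u t x" "f (u t x)"]
      by (simp add: R_def abs_mult)
    ultimately show ?thesis using f_growth[of "u t x"] by (simp add: algebra_simps)
  qed
  then have "(\<integral>x. \<bar>R t x\<bar> \<partial>L) \<le> (\<integral>x. (lam + \<sigma>) * \<bar>u t x\<bar> powr p + (lam + 2 * \<sigma>) + \<bar>g x\<bar> \<partial>L)"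
    using goodD(4)[OF assms] i R by (intro integral_mono) auto
  also have "\<dots> = Rb t" using goodD(4)[OF assms] i by (simp add: Rb_def Pint_def algebra_simps)
  finally show "(\<integral>x. \<bar>R t x\<bar> \<partial>L) \<le> Rb t" .
qed

lemma R_pairing_bound:
  assumes "good t" "z \<in> borel_measurable L" "\<And>x. \<bar>z x\<bar> \<le> B"
  shows "integrable L (\<lambda>x. R t x * z x)" "\<bar>\<integral>x. R t x * z x \<partial>L\<bar> \<le> B * Rb t"
proof -
  note [measurable] = borel_measurable_integrable[OF R_integrable(1)[OF assms(1)]] assms(2)
  have i: "integrable L (\<lambda>x. B * \<bar>R t x\<bar>)" using R_integrable(1)[OF assms(1)] by simp
  have b: "\<bar>R t x * z x\<bar> \<le> B * \<bar>R t x\<bar>" for x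
    using assms(3)[of x] by (simp add: abs_mult mult.commute mult_right_mono)
  show ii: "integrable L (\<lambda>x. R t x * z x)"
    by (rule Bochner_Integration.integrable_bound[OF i]) (use b in \<open>auto intro!: AE_I2 intro: order_trans[OF _ abs_ge_self]\<close>)
  have "\<bar>\<integral>x. R t x * z x \<partial>L\<bar> \<le> (\<integral>x. B * \<bar>R t x\<bar> \<partial>L)"
    using Bochner_Integration.integral_norm_bound_integral[OF ii i] b by simp
  \<comment> \<open>The bound on z at a single point shows B \<ge> 0.\<close>
  also have "\<dots> \<le> B * Rb t" using R_integrable(2)[OF assms(1)] assms(3)[of undefined] by (simp add: mult_left_mono)
  finally show "\<bar>\<integral>x. R t x * z x \<partial>L\<bar> \<le> B * Rb t" .
qed

text \<open>Measurability in time is the issue. Clamping u to [-n, n] before applying f gives a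
  pairing that is continuous in time. At good times it converges as n grows, dominated by the growth
  bound of f, which is monotone in |u|. The integrable bound is a multiple of
  \<open>Rb\<close>.\<close>

lemma R_pairing_integrable:
  assumes ab: "0 < a" "a < b" and z: "z \<in> borel_measurable L" "\<And>x. \<bar>z x\<bar> \<le> B"
  shows "integrable (lebesgue_on {a..b}) (\<lambda>t. \<integral>x. R t x * z x \<partial>L)"
proof -
  note [measurable] = z(1)
  have zi: "integrable L z" by (rule L.integrable_const_bound[where B=B]) (use z in auto)
  have zs: "square_integrable L z"
  proof -
    have "integrable L (\<lambda>x. (norm (z x))\<^sup>2)"
      by (rule L.integrable_const_bound[where B="B\<^sup>2"]) (use z in \<open>auto intro!: AE_I2 simp: abs_le_square_iff[symmetric] intro: order_trans[OF _ abs_ge_self]\<close>)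
    then show ?thesis by (simp add: square_integrable_def)
  qed
  define h where "h n t = (\<integral>x. z x * f (max (- real n) (min (real n) (u t x))) \<partial>L)" for n t
  have ch: "continuous_on {0..} (h n)" for n
  proof -
    have c: "continuous_on UNIV (\<lambda>s. f (max (- real n) (min (real n) s)))"
      by (intro continuous_on_compose2[OF f_cont[of UNIV]] continuous_intros) auto
    have "bounded (f ` {- real n..real n})" by (intro compact_imp_bounded compact_continuous_image f_cont compact_Icc)
    then obtain C where C: "\<forall>s\<in>{- real n..real n}. \<bar>f s\<bar> \<le> C" by (auto simp: bounded_iff)
    show ?thesis unfolding h_def
      by (rule continuous_compose[OF zi c, where B=C]) (use C in auto)
  qed
  have mh: "h n \<in> borel_measurable (lebesgue_on {a..b})" for n
    using ab by (intro continuous_imp_measurable_on_sets_lebesgue continuous_on_subset[OF ch]) auto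
  have lim: "(\<lambda>n. h n t) \<longlonglongrightarrow> (\<integral>x. z x * f (u t x) \<partial>L)" if t: "good t" for t
    unfolding h_def
  proof (rule integral_dominated_convergence[where w="\<lambda>x. B * (\<sigma> * \<bar>u t x\<bar> powr p + 2 * \<sigma>)"])
    note [measurable] = u_measurable[OF less_imp_le[OF goodD(1)[OF t]]]
    show "(\<lambda>x. z x * f (u t x)) \<in> borel_measurable L" "(\<lambda>x. z x * f (max (- real n) (min (real n) (u t x)))) \<in> borel_measurable L" for n
      by measurable
    show "integrable L (\<lambda>x. B * (\<sigma> * \<bar>u t x\<bar> powr p + 2 * \<sigma>))" using goodD(4)[OF t] by simp
    show "AE x in L. (\<lambda>n. z x * f (max (- real n) (min (real n) (u t x)))) \<longlonglongrightarrow> z x * f (u t x)"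
    proof (rule AE_I2, rule tendsto_eventually)
      fix x
      obtain N where "\<bar>u t x\<bar> \<le> real N" using real_arch_simple by blast
      then have "max (- real n) (min (real n) (u t x)) = u t x" if "n \<ge> N" for n
        using that by (auto simp: min_def max_def)
      then show "\<forall>\<^sub>F n in sequentially. z x * f (max (- real n) (min (real n) (u t x))) = z x * f (u t x)"
        by (intro eventually_mono[OF eventually_ge_at_top[of N]]) simp
    qed
    show "AE x in L. norm (z x * f (max (- real n) (min (real n) (u t x)))) \<le> B * (\<sigma> * \<bar>u t x\<bar> powr p + 2 * \<sigma>)" for n
    proof (rule AE_I2)
      fix x
      have "\<bar>f (max (- real n) (min (real n) (u t x)))\<bar> \<le> \<sigma> * \<bar>max (- real n) (min (real n) (u t x))\<bar> powr p + 2 * \<sigma>" by (rule f_growth)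
      also have "\<dots> \<le> \<sigma> * \<bar>u t x\<bar> powr p + 2 * \<sigma>"
        using \<sigma> p by (intro add_right_mono mult_left_mono powr_mono2) auto
      finally show "norm (z x * f (max (- real n) (min (real n) (u t x)))) \<le> B * (\<sigma> * \<bar>u t x\<bar> powr p + 2 * \<sigma>)"
        unfolding real_norm_def abs_mult using z(2)[of x] by (intro mult_mono) auto
    qed
  qed
  have "(\<lambda>t. \<integral>x. z x * f (u t x) \<partial>L) \<in> borel_measurable (lebesgue_on {a..b})"
    using AE_good[OF ab] by (intro borel_measurable_AE_LIMSEQ[OF _ mh]) (auto elim!: eventually_mono intro: lim)
  moreover have "(\<lambda>t. \<integral>x. u t x * z x \<partial>L) \<in> borel_measurable (lebesgue_on {a..b})"
    using ab by (intro continuous_imp_measurable_on_sets_lebesgue continuous_on_subset[OF continuous_inner_u[OF zs]]) auto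
  ultimately have "(\<lambda>t. lam * (\<integral>x. u t x * z x \<partial>L) + (\<integral>x. z x * f (u t x) \<partial>L) - (\<integral>x. g x * z x \<partial>L)) \<in> borel_measurable (lebesgue_on {a..b})"
    by measurable
  moreover have "lam * (\<integral>x. u t x * z x \<partial>L) + (\<integral>x. z x * f (u t x) \<partial>L) - (\<integral>x. g x * z x \<partial>L) = (\<integral>x. R t x * z x \<partial>L)" if t: "good t" for t
  proof -
    have "integrable L (\<lambda>x. u t x * z x)" "integrable L (\<lambda>x. g x * z x)"
      using goodD(1)[OF t] by (auto intro!: square_integrable_real_mult u_sq zs g_sq)
    moreover have "integrable L (\<lambda>x. z x * f (u t x))"
    proof -
      have "integrable L (\<lambda>x. B * \<bar>f (u t x)\<bar>)" using fu_integrable[OF t] by simp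
      then show ?thesis
        by (rule Bochner_Integration.integrable_bound)
          (use z borel_measurable_integrable[OF fu_integrable[OF t]] in \<open>auto intro!: AE_I2 simp: abs_mult intro!: mult_right_mono order_trans[OF z(2) abs_ge_self]\<close>)
    qed
    moreover have "R t x * z x = lam * (u t x * z x) + z x * f (u t x) - g x * z x" for x by (simp add: R_def algebra_simps)
    ultimately show ?thesis by simp
  qed
  then have "AE t in lebesgue_on {a..b}. lam * (\<integral>x. u t x * z x \<partial>L) + (\<integral>x. z x * f (u t x) \<partial>L) - (\<integral>x. g x * z x \<partial>L) = (\<integral>x. R t x * z x \<partial>L)"
    using AE_good[OF ab] by (auto elim!: eventually_mono)
  ultimately have m: "(\<lambda>t. \<integral>x. R t x * z x \<partial>L) \<in> borel_measurable (lebesgue_on {a..b})"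
    by (rule borel_measurable_AE_cong[rotated]) simp
  have "integrable (lebesgue_on {a..b}) (\<lambda>t. B * Rb t)" using Rb_integrable[OF ab] by simp
  then show ?thesis
    by (rule Bochner_Integration.integrable_bound[OF _ m])
      (use AE_good[OF ab] in \<open>auto elim!: eventually_mono intro: order_trans[OF R_pairing_bound(2)[OF _ z] abs_ge_self]\<close>)
qed

end

lemma simple_valued_iff:
  assumes "I \<in> sets lebesgue"
  shows "simple_valued I X s \<longleftrightarrow> simple_function (lebesgue_on I) s \<and> s ` I \<subseteq> X"
proof -
  have "s -` {w} \<inter> I = {t \<in> I. s t = w}" for w by auto
  then show ?thesis
    using assms by (auto simp: simple_valued_def simple_function_def space_restrict_space sets_restrict_space_iff)
qed

text \<open>On each level set of \<open>s\<close> the expression is one fixed measurable function of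
  t. This covers the distance of \<nabla>u(t) from a gradient that itself varies with t through a
  simple function.\<close>

lemma borel_measurable_simple_compose:
  assumes s: "simple_function M s" and c: "\<And>w. w \<in> s ` space M \<Longrightarrow> c w \<in> borel_measurable M"
  shows "(\<lambda>t. c (s t) t :: real) \<in> borel_measurable M"
proof -
  let ?S = "\<lambda>w. s -` {w} \<inter> space M"
  have fin: "finite (s ` space M)" using s by (rule simple_functionD)
  have S: "?S w \<in> sets M" for w using s by (rule simple_functionD)
  have "(\<lambda>t. \<Sum>w\<in>s ` space M. indicator (?S w) t * c w t) \<in> borel_measurable M"
    by (intro borel_measurable_sum borel_measurable_times borel_measurable_indicator S c)
  moreover have "(\<Sum>w\<in>s ` space M. indicator (?S w) t * c w t) = c (s t) t" if "t \<in> space M" for t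
  proof -
    have "(\<Sum>w\<in>s ` space M. indicator (?S w) t * c w t) = (\<Sum>w\<in>{s t}. indicator (?S w) t * c w t)"
      using that fin by (intro sum.mono_neutral_right) (auto simp: indicator_def)
    then show ?thesis using that by simp
  qed
  ultimately show ?thesis by (simp cong: measurable_cong)
qed

lemma integral_indicator_Ioc:
  fixes w :: "real \<Rightarrow> real"
  assumes "integrable (lebesgue_on B) w" "{s..t} \<subseteq> B" "B \<in> sets lebesgue"
  shows "(LINT x|lebesgue_on B. indicat_real {s<..t} x * w x) = (LINT x|lebesgue_on {s..t}. w x)"
proof -
  have "(LINT x|lebesgue_on B. indicat_real {s<..t} x * w x) = (LINT x|lebesgue_on {s..t}. indicat_real {s<..t} x * w x)"
    by (rule integral_lebesgue_on_subset) (use assms in auto)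
  also have "\<dots> = (LINT x|lebesgue_on {s..t}. w x)"
  proof (rule integral_cong_AE)
    have i: "integrable (lebesgue_on {s..t}) w" by (rule integrable_lebesgue_on_subset[OF assms(1,2)]) (use assms in auto)
    have "indicat_real {s<..t} \<in> borel_measurable (lebesgue_on {s..t})"
      by (intro measurable_restrict_space1 borel_measurable_indicator) auto
    with i show "(\<lambda>x. indicat_real {s<..t} x * w x) \<in> borel_measurable (lebesgue_on {s..t})" by auto
    show "w \<in> borel_measurable (lebesgue_on {s..t})" using i by auto
    have "{s} \<in> null_sets lebesgue" by (simp add: null_sets_completionI)
    then have "AE x in lebesgue. x \<notin> {s}" by (rule AE_not_in)
    then show "AE x in lebesgue_on {s..t}. indicat_real {s<..t} x * w x = w x"
      by (auto simp: AE_restrict_space_iff indicator_def elim!: eventually_mono)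
  qed
  finally show ?thesis .
qed

text \<open>The half-open cells are disjoint and cover the interval from T 0 (excluded) to T m
  (included), degenerate cells being empty, so the sum is a step function. It turns sums over a grid
  into integrals to which dominated convergence applies.\<close>

lemma sum_indicator_Ioc:
  fixes T :: "nat \<Rightarrow> real" and c :: "nat \<Rightarrow> real"
  assumes "\<And>i. i < m \<Longrightarrow> T i \<le> T (Suc i)"
  shows "(\<tau> \<le> T 0 \<or> T m < \<tau> \<longrightarrow> (\<Sum>i<m. indicator {T i<..T (Suc i)} \<tau> * c i) = 0) \<and>
     (T 0 < \<tau> \<and> \<tau> \<le> T m \<longrightarrow> (\<exists>i<m. T i < \<tau> \<and> \<tau> \<le> T (Suc i) \<and> (\<Sum>i<m. indicator {T i<..T (Suc i)} \<tau> * c i) = c i))"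
  using assms
proof (induction m)
  case (Suc m)
  have m: "T 0 \<le> T m" using Suc.prems by (induction m) (auto intro: order_trans)
  have ms: "T m \<le> T (Suc m)" using Suc.prems by simp
  have IH: "(\<tau> \<le> T 0 \<or> T m < \<tau> \<longrightarrow> (\<Sum>i<m. indicator {T i<..T (Suc i)} \<tau> * c i) = 0)"
     "(T 0 < \<tau> \<and> \<tau> \<le> T m \<longrightarrow> (\<exists>i<m. T i < \<tau> \<and> \<tau> \<le> T (Suc i) \<and> (\<Sum>i<m. indicator {T i<..T (Suc i)} \<tau> * c i) = c i))"
    using Suc by auto
  show ?case
  proof (intro conjI impI)
    assume "\<tau> \<le> T 0 \<or> T (Suc m) < \<tau>"
    then show "(\<Sum>i<Suc m. indicator {T i<..T (Suc i)} \<tau> * c i) = 0" using IH(1) m ms by auto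
  next
    assume *: "T 0 < \<tau> \<and> \<tau> \<le> T (Suc m)"
    show "\<exists>i<Suc m. T i < \<tau> \<and> \<tau> \<le> T (Suc i) \<and> (\<Sum>i<Suc m. indicator {T i<..T (Suc i)} \<tau> * c i) = c i"
    proof (cases "\<tau> \<le> T m")
      case True
      then obtain i where "i < m" "T i < \<tau>" "\<tau> \<le> T (Suc i)" "(\<Sum>i<m. indicator {T i<..T (Suc i)} \<tau> * c i) = c i"
        using IH(2) * by auto
      then show ?thesis using True by (intro exI[of _ i]) auto
    next
      case False then show ?thesis using IH(1) * by (intro exI[of _ m]) auto
    qed
  qed
qed simp

text \<open>Cauchy-Schwarz followed by Young's inequality with weight \<eta>. In the energy
  inequality the first integral is an approximation error of order \<eta>^2 after integration in
  time, so that both terms are of order \<eta>.\<close>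

lemma integral_inner_le:
  assumes "square_integrable M G" "square_integrable M H" "\<eta> > 0"
  shows "\<bar>\<integral>x. G x \<bullet> H x \<partial>M\<bar> \<le> (\<integral>x. (norm (G x))\<^sup>2 \<partial>M) / (2 * \<eta>) + \<eta> * (\<integral>x. (norm (H x))\<^sup>2 \<partial>M) / 2"
proof -
  define A where "A = (\<integral>x. (norm (G x))\<^sup>2 \<partial>M)"
  define C where "C = (\<integral>x. (norm (H x))\<^sup>2 \<partial>M)"
  have AC: "A \<ge> 0" "C \<ge> 0" by (simp_all add: A_def C_def)
  have "0 \<le> (sqrt A - \<eta> * sqrt C)\<^sup>2" by simp
  also have "\<dots> = A - 2 * \<eta> * (sqrt A * sqrt C) + \<eta>\<^sup>2 * C"
    using AC by (simp add: power2_diff power_mult_distrib)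
  finally have "sqrt A * sqrt C \<le> A / (2 * \<eta>) + \<eta> * C / 2" using assms(3) by (simp add: field_simps power2_eq_square)
  then show ?thesis using Cauchy_Schwarz_integral[OF assms(1,2)] by (simp add: A_def C_def)
qed

section \<open>Ingredients of the discretisation in time\<close>

context rd_solution
begin

text \<open>Polarization: the inner product is a combination of squared norms whose measurability in
  time is known.\<close>

lemma grad_pairing_integrable:
  assumes ab: "0 < a" "a < b" and W: "square_integrable L W"
  shows "integrable (lebesgue_on {a..b}) (\<lambda>t. \<integral>x. weak_gradient D (u t) x \<bullet> W x \<partial>L)"
proof -
  let ?c = "\<integral>x. (norm (W x))\<^sup>2 \<partial>L"
  let ?h = "\<lambda>t. (Ngrad t + ?c - (\<integral>x. (norm (weak_gradient D (u t) x - W x))\<^sup>2 \<partial>L)) / 2"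
  have m1: "?h \<in> borel_measurable (lebesgue_on {a..b})"
    using grad_dist_measurable[OF ab W] borel_measurable_integrable[OF Ngrad_integrable[OF ab]] by measurable
  have eq: "?h t = (\<integral>x. weak_gradient D (u t) x \<bullet> W x \<partial>L)" if "good t" for t
    using integral_norm_sq_add[OF goodD(3)[OF that] W, of "-1"] by (simp add: Ngrad_def)
  have m: "(\<lambda>t. \<integral>x. weak_gradient D (u t) x \<bullet> W x \<partial>L) \<in> borel_measurable (lebesgue_on {a..b})"
    by (rule borel_measurable_AE_cong[OF _ m1]) (use AE_good[OF ab] eq in \<open>auto elim!: eventually_mono\<close>)
  have i: "integrable (lebesgue_on {a..b}) (\<lambda>t. Ngrad t / 2 + ?c / 2)"
    using Ngrad_integrable[OF ab] by (auto intro: continuous_imp_integrable_real)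
  have b: "norm (\<integral>x. weak_gradient D (u t) x \<bullet> W x \<partial>L) \<le> norm (Ngrad t / 2 + ?c / 2)" if "good t" for t
    using integral_inner_le[OF goodD(3)[OF that] W, of 1] by (simp add: Ngrad_def)
  show ?thesis
    by (rule Bochner_Integration.integrable_bound[OF i m]) (use AE_good[OF ab] b in \<open>auto elim!: eventually_mono\<close>)
qed

lemma bounded_square_integrable:
  fixes z :: "'a \<Rightarrow> real"
  assumes "z \<in> borel_measurable L" "\<And>x. \<bar>z x\<bar> \<le> B"
  shows "square_integrable L z"
proof -
  have "square_integrable L (\<lambda>x. 1::real)" by (simp add: square_integrable_def)
  then show ?thesis by (rule square_integrable_bound[where c=B]) (use assms in auto)
qed

text \<open>For v independent of time the weak formulation gives the distributional derivative of
  the pairing of u(t) with v. As this pairing is continuous in t, \<open>du_Bois_Reymond\<close>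
  yields the integrated form for all 0 < s < t. Boundedness of v places it in L^p and gives a
  meaning to the pairing with R.\<close>

lemma time_identity:
  assumes v: "v \<in> H10 D" "\<And>x. \<bar>v x\<bar> \<le> B" and st: "0 < s" "s < t"
  shows "(\<integral>x. u t x * v x \<partial>L) - (\<integral>x. u s x * v x \<partial>L) =
    - (LINT \<tau>|lebesgue_on {s..t}. (\<integral>x. R \<tau> x * v x \<partial>L) + (\<integral>x. weak_gradient D (u \<tau>) x \<bullet> weak_gradient D v x \<partial>L))"
proof -
  have vs: "square_integrable L v" and wv: "square_integrable L (weak_gradient D v)"
    using v(1) by (auto simp: H10_def H1_iff has_weak_gradient_iff)
  note [measurable] = square_integrableD(1)[OF vs]
  let ?w = "\<lambda>\<tau>. (\<integral>x. R \<tau> x * v x \<partial>L) + (\<integral>x. weak_gradient D (u \<tau>) x \<bullet> weak_gradient D v x \<partial>L)"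
  have w: "integrable (lebesgue_on {a..b}) ?w" if "0 < a" "a < b" for a b
    using R_pairing_integrable[OF that, of v B] grad_pairing_integrable[OF that wv] v(2) by simp
  have vp: "v \<in> H10 D \<inter> Lspace D p"
  proof -
    have "integrable L (\<lambda>x. \<bar>v x\<bar> powr p)"
      by (rule L.integrable_const_bound[where B="B powr p"]) (use v p in \<open>auto intro!: AE_I2 powr_mono2\<close>)
    then show ?thesis using v(1) by (auto simp: Lspace_def Lnorm_pow_def integrable_iff_bounded)
  qed
  have eq: "(LINT t|lebesgue_on {0<..}. deriv \<psi> t * (\<integral>x. u t x * v x \<partial>L)) = (LINT t|lebesgue_on {0<..}. \<psi> t * ?w t)"
    if \<psi>: "\<psi> \<in> test_functions {0<..}" for \<psi>
  proof -
    obtain K where K: "compact K" "K \<subseteq> {0<..}" "\<And>x. x \<notin> K \<Longrightarrow> \<psi> x = 0"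
      using \<psi> by (auto simp: test_functions_def)
    \<comment> \<open>The support of \<psi> is compact in (0, \<infinity>), which keeps the interval
      away from 0, as integrability in time is local in (0, \<infinity>). The upper end is enlarged
      by 1 to have a < b even if the support is one point.\<close>
    obtain a b where ab: "0 < a" "a < b" "K \<subseteq> {a..b}"
    proof (cases "K = {}")
      case True then show ?thesis using that[of 1 2] by simp
    next
      case False
      obtain k1 where k1: "k1 \<in> K" "\<forall>y\<in>K. k1 \<le> y" using compact_attains_inf[OF K(1) False] by auto
      obtain k2 where k2: "k2 \<in> K" "\<forall>y\<in>K. y \<le> k2" using compact_attains_sup[OF K(1) False] by auto
      show ?thesis by (rule that[of k1 "k2 + 1"]) (use k1 k2 K(2) in force)+
    qed
    have sub: "{a..b} \<subseteq> {0<..}" using ab by auto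
    obtain C where C: "\<And>t. \<bar>\<psi> t\<bar> \<le> C" using test_functions_bounded[OF \<psi>] by metis
    have \<psi>m: "\<psi> \<in> borel_measurable (lebesgue_on S)" for S using \<psi> smooth_borel_measurable test_functions_smooth by blast
    let ?c = "\<integral>x. g x * v x \<partial>L"
    let ?X = "\<lambda>t. lam * pairing D (u t) v + (LINT x|L. weak_gradient D (u t) x \<bullet> weak_gradient D v x) + pairing D (\<lambda>x. f (u t x)) v"
    have X: "?X t = ?w t + ?c" if t: "good t" for t
    proof -
      have i: "integrable L (\<lambda>x. u t x * v x)" "integrable L (\<lambda>x. g x * v x)"
        using goodD(1)[OF t] by (auto intro!: square_integrable_real_mult u_sq vs g_sq)
      have R: "integrable L (\<lambda>x. R t x * v x)" by (rule R_pairing_bound(1)[OF t]) (use v in auto)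
      have fe: "f (u t x) * v x = R t x * v x - lam * (u t x * v x) + g x * v x" for x by (simp add: R_def algebra_simps)
      have "pairing D (\<lambda>x. f (u t x)) v = (\<integral>x. R t x * v x \<partial>L) - lam * (\<integral>x. u t x * v x \<partial>L) + ?c"
        unfolding pairing_def fe using i R by simp
      then show ?thesis by (simp add: pairing_def)
    qed
    have iwc: "integrable (lebesgue_on {a..b}) (\<lambda>t. ?w t + ?c)"
      using w[OF ab(1,2)] by (auto intro: continuous_imp_integrable_real)
    have prod_int: "integrable (lebesgue_on {a..b}) (\<lambda>t. \<psi> t * h t)" if "integrable (lebesgue_on {a..b}) h" for h
    proof -
      have "integrable (lebesgue_on {a..b}) (\<lambda>t. C * \<bar>h t\<bar>)" using that by simp
      then show ?thesis
        by (rule Bochner_Integration.integrable_bound)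
          (use that \<psi>m C in \<open>auto intro!: AE_I2 borel_measurable_times simp: abs_mult intro!: mult_right_mono order_trans[OF C abs_ge_self]\<close>)
    qed
    have z: "\<psi> x = 0" if "x \<in> {0<..} - {a..b}" for x by (rule K(3)) (use that ab(3) in blast)
    have restr: "(LINT t|lebesgue_on {0<..}. \<psi> t * h t) = (LINT t|lebesgue_on {a..b}. \<psi> t * h t)" for h
      by (rule integral_lebesgue_on_subset[OF sub]) (use z in auto)
    have "(LINT t|lebesgue_on {a..b}. \<psi> t * ?X t) = (LINT t|lebesgue_on {a..b}. \<psi> t * (?w t + ?c))"
    proof (rule integral_cong_AE)
      show m: "(\<lambda>t. \<psi> t * (?w t + ?c)) \<in> borel_measurable (lebesgue_on {a..b})"
        using prod_int[OF iwc] by auto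
      show ae: "AE t in lebesgue_on {a..b}. \<psi> t * ?X t = \<psi> t * (?w t + ?c)"
        using AE_good[OF ab(1,2)] X by (auto elim!: eventually_mono)
      show "(\<lambda>t. \<psi> t * ?X t) \<in> borel_measurable (lebesgue_on {a..b})"
        by (rule borel_measurable_AE_cong[OF _ m]) (use ae in \<open>auto elim!: eventually_mono\<close>)
    qed
    also have "\<dots> = (LINT t|lebesgue_on {a..b}. \<psi> t * ?w t) + (LINT t|lebesgue_on {a..b}. \<psi> t * ?c)"
      using prod_int[OF w[OF ab(1,2)]] prod_int[of "\<lambda>t. ?c"] by (simp add: distrib_left continuous_imp_integrable_real)
    finally have "(LINT t|lebesgue_on {0<..}. \<psi> t * ?X t) = (LINT t|lebesgue_on {0<..}. \<psi> t * ?w t) + (LINT t|lebesgue_on {0<..}. \<psi> t * ?c)"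
      by (simp only: restr)
    moreover have "- (LINT t|lebesgue_on {0<..}. deriv \<psi> t * pairing D (u t) v) + (LINT t|lebesgue_on {0<..}. \<psi> t * ?X t)
        = (LINT t|lebesgue_on {0<..}. \<psi> t * pairing D g v)"
      using sol vp \<psi> unfolding weak_solution_def by blast
    ultimately show ?thesis by (simp add: pairing_def)
  qed
  show ?thesis
    by (rule du_Bois_Reymond[OF continuous_on_subset[OF continuous_inner_u[OF vs]] w eq st]) auto
qed

text \<open>The simple approximations provided by strong measurability converge for almost every t,
  but without a dominating function. They are set to zero wherever 0 is closer to \<nabla>u(t); the
  squared error is then at most \<open>Ngrad t\<close>, and dominated convergence applies. Their
  finitely many values are finally replaced by test functions.\<close>

lemma grad_approx_test:
  assumes ab: "0 < a" "a < b" and e: "e > 0"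
  obtains S where "simple_valued {a..b} (test_functions D) S"
    "integrable (lebesgue_on {a..b}) (\<lambda>t. \<integral>x. (norm (weak_gradient D (u t) x - gradient (S t) x))\<^sup>2 \<partial>L)"
    "(LINT t|lebesgue_on {a..b}. \<integral>x. (norm (weak_gradient D (u t) x - gradient (S t) x))\<^sup>2 \<partial>L) \<le> e"
proof -
  let ?I = "{a..b}" and ?M = "lebesgue_on {a..b}"
  have I: "?I \<in> sets lebesgue" by simp
  obtain s where s: "\<And>n. simple_valued ?I (H10 D) (s n)"
    "AE t in ?M. (\<lambda>n::nat. \<integral>x. (norm (weak_gradient D (s n t) x - weak_gradient D (u t) x))\<^sup>2 \<partial>L) \<longlonglongrightarrow> 0"
    using grad_approx[OF ab] by blast
  have sf: "simple_function ?M (s n)" for n using s(1)[of n] simple_valued_iff[OF I] by blast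
  have sH: "s n t \<in> H10 D" if "t \<in> ?I" for n t using s(1)[of n] that by (auto simp: simple_valued_def)
  have wsq: "square_integrable L (weak_gradient D v)" if "v \<in> H10 D" for v
    using that by (auto simp: H10_def H1_iff has_weak_gradient_iff)
  define d where "d n t = (\<integral>x. (norm (weak_gradient D (u t) x - weak_gradient D (s n t) x))\<^sup>2 \<partial>L)" for n t
  have dm: "d n \<in> borel_measurable ?M" for n
    unfolding d_def
    by (rule borel_measurable_simple_compose[OF sf, where c="\<lambda>w t. \<integral>x. (norm (weak_gradient D (u t) x - weak_gradient D w x))\<^sup>2 \<partial>L"])
      (use sH wsq grad_dist_measurable[OF ab] in auto)
  note Nm = borel_measurable_integrable[OF Ngrad_integrable[OF ab]]
  have d0: "d n t \<ge> 0" for n t by (simp add: d_def)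
  have "(\<lambda>n. LINT t|?M. min (d n t) (Ngrad t)) \<longlonglongrightarrow> (LINT t|?M. 0)"
  proof (rule integral_dominated_convergence[where w=Ngrad])
    show "(\<lambda>t. min (d n t) (Ngrad t)) \<in> borel_measurable ?M" for n using dm Nm by measurable
    show "AE t in ?M. (\<lambda>n. min (d n t) (Ngrad t)) \<longlonglongrightarrow> 0"
      using s(2)
    proof eventually_elim
      case (elim t)
      then have "(\<lambda>n. d n t) \<longlonglongrightarrow> 0" by (simp add: d_def norm_minus_commute)
      then have "(\<lambda>n. min (d n t) (Ngrad t)) \<longlonglongrightarrow> min 0 (Ngrad t)" by (intro tendsto_min tendsto_const)
      then show ?case using Ngrad_nonneg[of t] by (simp add: min_absorb1)
    qed
    show "AE t in ?M. norm (min (d n t) (Ngrad t)) \<le> Ngrad t" for n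
      using d0 Ngrad_nonneg by (intro AE_I2) (simp add: min_def)
  qed (use Ngrad_integrable[OF ab] in auto)
  then have "\<forall>\<^sub>F n in sequentially. (LINT t|?M. min (d n t) (Ngrad t)) < e / 4"
    using e by (intro order_tendstoD(2)) auto
  then obtain n where n: "(LINT t|?M. min (d n t) (Ngrad t)) < e / 4" by (auto simp: eventually_sequentially)
  \<comment> \<open>In the final bound, 2 * e1 * (b - a) is e / 2, and twice the truncated error
    contributes at most 2 * (e / 4).\<close>
  define e1 where "e1 = e / (4 * (b - a))"
  have e1: "e1 > 0" using e ab by (simp add: e1_def)
  have "\<exists>\<phi>\<in>test_functions D. (\<integral>x. (norm (weak_gradient D v x - gradient \<phi> x))\<^sup>2 \<partial>L) < e1" if v: "v \<in> H10 D" for v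
  proof -
    obtain \<phi> where \<phi>: "\<And>n::nat. \<phi> n \<in> test_functions D" 
      "(\<lambda>n. \<integral>x. (norm (weak_gradient D v x - gradient (\<phi> n) x))\<^sup>2 \<partial>L) \<longlonglongrightarrow> 0"
      using H10_approx[OF v] by blast
    have "\<forall>\<^sub>F n in sequentially. (\<integral>x. (norm (weak_gradient D v x - gradient (\<phi> n) x))\<^sup>2 \<partial>L) < e1"
      using \<phi>(2) e1 by (rule order_tendstoD(2))
    then show ?thesis using \<phi>(1) by (auto simp: eventually_sequentially)
  qed
  then obtain q where q: "\<And>v. v \<in> H10 D \<Longrightarrow> q v \<in> test_functions D"
    "\<And>v. v \<in> H10 D \<Longrightarrow> (\<integral>x. (norm (weak_gradient D v x - gradient (q v) x))\<^sup>2 \<partial>L) < e1" by metis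
  define S where "S t = (if d n t \<le> Ngrad t then q (s n t) else (\<lambda>x. 0))" for t
  have St: "S t \<in> test_functions D" if "t \<in> ?I" for t
    using q(1) sH that test_functions_zero by (auto simp: S_def)
  have Ssf: "simple_function ?M S"
  proof -
    have "{t \<in> space ?M. d n t \<le> Ngrad t} \<in> sets ?M" using dm Nm by measurable
    moreover have "simple_function ?M (\<lambda>t. q (s n t))" using simple_function_compose[OF sf, of q] by (simp add: o_def)
    ultimately show ?thesis unfolding S_def[abs_def] by (intro simple_function_If) auto
  qed
  have Ssv: "simple_valued ?I (test_functions D) S" using Ssf St simple_valued_iff[OF I, of "test_functions D" S] by auto
  let ?d = "\<lambda>t. \<integral>x. (norm (weak_gradient D (u t) x - gradient (S t) x))\<^sup>2 \<partial>L"
  have m: "?d \<in> borel_measurable ?M"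
    by (rule borel_measurable_simple_compose[OF Ssf, where c="\<lambda>w t. \<integral>x. (norm (weak_gradient D (u t) x - gradient w x))\<^sup>2 \<partial>L"])
      (use St gradient_sq grad_dist_measurable[OF ab] in auto)
  have mi: "integrable ?M (\<lambda>t. min (d n t) (Ngrad t))"
    by (rule Bochner_Integration.integrable_bound[OF Ngrad_integrable[OF ab]])
      (use dm Nm d0 Ngrad_nonneg in \<open>auto intro!: AE_I2 simp: min_def\<close>)
  have bi: "integrable ?M (\<lambda>t. 2 * min (d n t) (Ngrad t) + 2 * e1)"
    using mi by (auto intro: continuous_imp_integrable_real)
  have bnd: "?d t \<le> 2 * min (d n t) (Ngrad t) + 2 * e1" if t: "good t" "t \<in> ?I" for t
  proof (cases "d n t \<le> Ngrad t")
    case True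
    note G = goodD(3)[OF t(1)] and W = wsq[OF sH[OF t(2), of n]] and Q = gradient_sq[OF q(1)[OF sH[OF t(2), of n]]]
    have "?d t = (\<integral>x. (norm ((weak_gradient D (u t) x - weak_gradient D (s n t) x) + 1 *\<^sub>R (weak_gradient D (s n t) x - gradient (q (s n t)) x)))\<^sup>2 \<partial>L)"
      using True by (simp add: S_def)
    also have "\<dots> \<le> (\<integral>x. 2 * (norm (weak_gradient D (u t) x - weak_gradient D (s n t) x))\<^sup>2
        + 2 * (norm (weak_gradient D (s n t) x - gradient (q (s n t)) x))\<^sup>2 \<partial>L)"
    proof (rule integral_mono)
      show "integrable L (\<lambda>x. (norm ((weak_gradient D (u t) x - weak_gradient D (s n t) x) + 1 *\<^sub>R (weak_gradient D (s n t) x - gradient (q (s n t)) x)))\<^sup>2)"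
        by (intro square_integrableD(2) square_integrable_add square_integrable_scaleR square_integrable_diff G W Q)
      show "integrable L (\<lambda>x. 2 * (norm (weak_gradient D (u t) x - weak_gradient D (s n t) x))\<^sup>2
        + 2 * (norm (weak_gradient D (s n t) x - gradient (q (s n t)) x))\<^sup>2)"
        by (intro Bochner_Integration.integrable_add integrable_mult_right square_integrableD(2) square_integrable_diff G W Q)
      have tri: "(norm (y + z))\<^sup>2 \<le> 2 * (norm y)\<^sup>2 + 2 * (norm z)\<^sup>2" for y z :: 'a
        using power_mono[OF norm_triangle_ineq[of y z], of 2] sum_squares_bound[of "norm y" "norm z"]
        by (simp add: power2_sum)
      show "(norm ((weak_gradient D (u t) x - weak_gradient D (s n t) x) + 1 *\<^sub>R (weak_gradient D (s n t) x - gradient (q (s n t)) x)))\<^sup>2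
         \<le> 2 * (norm (weak_gradient D (u t) x - weak_gradient D (s n t) x))\<^sup>2
        + 2 * (norm (weak_gradient D (s n t) x - gradient (q (s n t)) x))\<^sup>2" for x
        unfolding scaleR_one by (rule tri)
    qed
    also have "\<dots> = 2 * d n t + 2 * (\<integral>x. (norm (weak_gradient D (s n t) x - gradient (q (s n t)) x))\<^sup>2 \<partial>L)"
      using square_integrableD(2)[OF square_integrable_diff[OF G W]] square_integrableD(2)[OF square_integrable_diff[OF W Q]]
      by (simp add: d_def)
    also have "\<dots> \<le> 2 * d n t + 2 * e1" using q(2)[OF sH[OF t(2), of n]] by simp
    finally show ?thesis using True by (simp add: min_absorb1)
  next
    case False
    have "gradient (\<lambda>x::'a. 0::real) = (\<lambda>x. 0)" by (simp add: gradient_def fun_eq_iff)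
    then have "?d t = Ngrad t" using False by (simp add: S_def Ngrad_def)
    then show ?thesis using False e1 Ngrad_nonneg[of t] by (simp add: min_absorb2)
  qed
  have "AE t in ?M. t \<in> ?I" by (rule AE_I2) auto
  with AE_good[OF ab] have bae: "AE t in ?M. ?d t \<le> 2 * min (d n t) (Ngrad t) + 2 * e1"
    by eventually_elim (rule bnd)
  have di: "integrable ?M ?d"
    by (rule Bochner_Integration.integrable_bound[OF bi m]) (use bae in \<open>auto elim!: eventually_mono\<close>)
  have "(LINT t|?M. ?d t) \<le> (LINT t|?M. 2 * min (d n t) (Ngrad t) + 2 * e1)"
    by (rule integral_mono_AE[OF di bi bae])
  also have "\<dots> = 2 * (LINT t|?M. min (d n t) (Ngrad t)) + 2 * e1 * (b - a)"
    using mi ab by (simp add: continuous_imp_integrable_real measure_restrict_space)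
  also have "2 * e1 * (b - a) = e / 2" using ab by (simp add: e1_def divide_simps)
  also have "2 * (LINT t|?M. min (d n t) (Ngrad t)) + e / 2 \<le> e" using n by linarith
  finally show ?thesis using that Ssv di by blast
qed

text \<open>A function cannot exceed its mean almost everywhere. Such points are needed because a
  test function frozen at time t brings in \<open>Ngrad t\<close>, which is only integrable in t;
  with this choice the values at the grid points are controlled by the integral.\<close>

lemma good_point_in_cell:
  assumes ab: "0 < a" "a < b"
  obtains t where "a \<le> t" "t \<le> b" "good t" "(b - a) * Ngrad t \<le> (LINT t|lebesgue_on {a..b}. Ngrad t)"
proof -
  let ?M = "lebesgue_on {a..b}" and ?J = "LINT t|lebesgue_on {a..b}. Ngrad t"
  have "\<exists>t\<in>{a..b}. good t \<and> (b - a) * Ngrad t \<le> ?J"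
  proof (rule ccontr)
    assume neg: "\<not> (\<exists>t\<in>{a..b}. good t \<and> (b - a) * Ngrad t \<le> ?J)"
    have "AE t in ?M. t \<in> {a..b}" by (rule AE_I2) auto
    with AE_good[OF ab] have gt: "AE t in ?M. (b - a) * Ngrad t - ?J > 0"
      by eventually_elim (use neg in force)
    have i: "integrable ?M (\<lambda>t. (b - a) * Ngrad t - ?J)"
      using Ngrad_integrable[OF ab] by (auto intro: continuous_imp_integrable_real)
    have "(LINT t|?M. (b - a) * Ngrad t - ?J) = (b - a) * ?J - ?J * (b - a)"
      using Ngrad_integrable[OF ab] ab by (simp add: continuous_imp_integrable_real measure_restrict_space)
    also have "\<dots> = 0" by simp
    finally have "AE t in ?M. (b - a) * Ngrad t - ?J = 0"
      using gt by (subst (asm) integral_nonneg_eq_0_iff_AE[OF i]) (auto elim!: eventually_mono)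
    with gt have "AE t in ?M. False" by eventually_elim simp
    then have "emeasure ?M (space ?M) = 0" by (simp add: eventually_False ae_filter_eq_bot_iff)
    then show False using ab by (simp add: emeasure_restrict_space)
  qed
  then show ?thesis using that by auto
qed

text \<open>A Riemann sum in which only the factor with \<Phi> is frozen, at the right end of each
  cell, while Z stays under the time integral. For fixed \<tau> the pairing of Z \<tau> with \<Phi>
  (u t x) is continuous in t, and B * \<rho> dominates. On the diagonal t = \<tau> measurability is
  not clear beforehand; it results from the convergence of the step functions.\<close>

lemma grid_limit:
  fixes Z :: "real \<Rightarrow> 'a \<Rightarrow> real" and \<Phi> :: "real \<Rightarrow> real"
  assumes ab: "0 < a" "a < b"
    and \<Phi>: "continuous_on UNIV \<Phi>" "\<And>s. \<bar>\<Phi> s\<bar> \<le> B"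
    and Zi: "AE \<tau> in lebesgue_on {a..b}. integrable L (Z \<tau>)"
    and Zm: "\<And>z. z \<in> borel_measurable L \<Longrightarrow> (\<And>x. \<bar>z x\<bar> \<le> B) \<Longrightarrow> integrable (lebesgue_on {a..b}) (\<lambda>\<tau>. \<integral>x. Z \<tau> x * z x \<partial>L)"
    and \<rho>: "integrable (lebesgue_on {a..b}) \<rho>" "AE \<tau> in lebesgue_on {a..b}. (\<integral>x. \<bar>Z \<tau> x\<bar> \<partial>L) \<le> \<rho> \<tau>"
    and T: "\<And>n i. i < m n \<Longrightarrow> T n i \<le> T n (Suc i)" "\<And>n. a \<le> T n 0" "\<And>n. T n (m n) \<le> b"
      "\<And>n i. i < m n \<Longrightarrow> T n (Suc i) - T n i \<le> \<delta> n" "\<delta> \<longlonglongrightarrow> 0" "(\<lambda>n. T n 0) \<longlonglongrightarrow> a" "(\<lambda>n. T n (m n)) \<longlonglongrightarrow> b"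
  shows "integrable (lebesgue_on {a..b}) (\<lambda>\<tau>. \<integral>x. Z \<tau> x * \<Phi> (u \<tau> x) \<partial>L)"
    "(\<lambda>n. \<Sum>i<m n. LINT \<tau>|lebesgue_on {T n i..T n (Suc i)}. (\<integral>x. Z \<tau> x * \<Phi> (u (T n (Suc i)) x) \<partial>L))
       \<longlonglongrightarrow> (LINT \<tau>|lebesgue_on {a..b}. (\<integral>x. Z \<tau> x * \<Phi> (u \<tau> x) \<partial>L))"
proof -
  let ?M = "lebesgue_on {a..b}"
  have mono0: "T n 0 \<le> T n i" if "i \<le> m n" for n i
    using that by (induction i) (auto intro: order_trans[OF _ T(1)])
  have mono1: "T n i \<le> T n (m n)" if "i \<le> m n" for n i
    using that by (induction rule: inc_induct) (auto intro: order_trans[OF T(1)])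
  have Tab: "a \<le> T n i" "T n i \<le> b" if "i \<le> m n" for n i
    using mono0[OF that] mono1[OF that] T(2)[of n] T(3)[of n] by auto
  have \<Phi>m: "(\<lambda>x. \<Phi> (u t x)) \<in> borel_measurable L" if "t \<ge> 0" for t
    using u_measurable[OF that] borel_measurable_continuous_onI[OF \<Phi>(1)] by measurable
  define k where "k \<tau> t = (\<integral>x. Z \<tau> x * \<Phi> (u t x) \<partial>L)" for \<tau> t
  have ki: "integrable ?M (\<lambda>\<tau>. k \<tau> t)" if "t \<ge> 0" for t
    unfolding k_def by (rule Zm[OF \<Phi>m[OF that] \<Phi>(2)])
  define E where "E n \<tau> = (\<Sum>i<m n. indicator {T n i<..T n (Suc i)} \<tau> * k \<tau> (T n (Suc i)))" for n \<tau>
  have Em: "E n \<in> borel_measurable ?M" for n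
  proof -
    have "indicat_real {T n i<..T n (Suc i)} \<in> borel_measurable ?M" for i
      by (intro measurable_restrict_space1 borel_measurable_indicator) auto
    then show ?thesis unfolding E_def
      using ki Tab ab by (intro borel_measurable_sum borel_measurable_times) (auto intro!: borel_measurable_integrable ki order_trans[OF _ Tab(1)])
  qed
  have Eint: "(LINT \<tau>|?M. E n \<tau>) = (\<Sum>i<m n. LINT \<tau>|lebesgue_on {T n i..T n (Suc i)}. k \<tau> (T n (Suc i)))" for n
  proof -
    have t0: "T n (Suc i) \<ge> 0" if "i < m n" for i using Tab(1)[of "Suc i" n] that ab by simp
    have ii: "integrable ?M (\<lambda>\<tau>. indicator {T n i<..T n (Suc i)} \<tau> * k \<tau> (T n (Suc i)))" if "i < m n" for i
      using integrable_mult_indicator[OF _ ki[OF t0[OF that]], of "{T n i<..T n (Suc i)} \<inter> {a..b}"]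
      by (auto simp: sets_restrict_space_iff indicator_inter_arith elim!: Bochner_Integration.integrable_cong[THEN iffD1, rotated -1] split: split_indicator)
    have "(LINT \<tau>|?M. E n \<tau>) = (\<Sum>i<m n. LINT \<tau>|?M. indicator {T n i<..T n (Suc i)} \<tau> * k \<tau> (T n (Suc i)))"
      unfolding E_def by (rule Bochner_Integration.integral_sum) (use ii in auto)
    also have "\<dots> = (\<Sum>i<m n. LINT \<tau>|lebesgue_on {T n i..T n (Suc i)}. k \<tau> (T n (Suc i)))"
    proof (rule sum.cong[OF refl])
      fix i assume "i \<in> {..<m n}"
      then have i: "i < m n" by simp
      show "(LINT \<tau>|?M. indicator {T n i<..T n (Suc i)} \<tau> * k \<tau> (T n (Suc i))) = (LINT \<tau>|lebesgue_on {T n i..T n (Suc i)}. k \<tau> (T n (Suc i)))"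
        by (rule integral_indicator_Ioc[OF ki[OF t0[OF i]]]) (use Tab[of i n] Tab[of "Suc i" n] i in auto)
    qed
    finally show ?thesis .
  qed
  have kb: "AE \<tau> in ?M. \<forall>t\<ge>0. \<bar>k \<tau> t\<bar> \<le> B * \<rho> \<tau>"
    using Zi \<rho>(2)
  proof eventually_elim
    case (elim \<tau>)
    show ?case
    proof (intro allI impI)
      fix t :: real assume t: "t \<ge> 0"
      note [measurable] = \<Phi>m[OF t] borel_measurable_integrable[OF elim(1)]
      have i1: "integrable L (\<lambda>x. B * \<bar>Z \<tau> x\<bar>)" using elim by simp
      have b1: "norm (Z \<tau> x * \<Phi> (u t x)) \<le> B * \<bar>Z \<tau> x\<bar>" for x
        using \<Phi>(2)[of "u t x"] by (simp add: abs_mult mult.commute[of B] mult_left_mono)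
      have i2: "integrable L (\<lambda>x. Z \<tau> x * \<Phi> (u t x))"
        by (rule Bochner_Integration.integrable_bound[OF i1]) (use b1 in \<open>auto intro!: AE_I2 intro: order_trans[OF _ abs_ge_self]\<close>)
      have "\<bar>k \<tau> t\<bar> \<le> (\<integral>x. B * \<bar>Z \<tau> x\<bar> \<partial>L)"
        unfolding k_def using Bochner_Integration.integral_norm_bound_integral[OF i2 i1 b1] by simp
      also have "\<dots> \<le> B * \<rho> \<tau>" using elim(2) \<Phi>(2)[of 0] by (simp add: mult_left_mono)
      finally show "\<bar>k \<tau> t\<bar> \<le> B * \<rho> \<tau>" .
    qed
  qed
  \<comment> \<open>The grid may leave out pieces near a and b, but every interior point is
    eventually covered.\<close>
  have "AE \<tau> in ?M. \<tau> \<in> {a<..<b}"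
  proof -
    have "{a,b} \<in> null_sets lebesgue" by (intro null_sets_completionI) (simp add: countable_imp_null_set_lborel)
    then have "AE \<tau> in lebesgue. \<tau> \<notin> {a,b}" by (rule AE_not_in)
    then have "AE \<tau> in ?M. \<tau> \<notin> {a,b}" 
      by (subst AE_restrict_space_iff, simp, elim eventually_mono, blast)
    moreover have "AE \<tau> in ?M. \<tau> \<in> {a..b}" by (rule AE_I2) simp
    ultimately show ?thesis by eventually_elim auto
  qed
  with Zi have lim: "AE \<tau> in ?M. (\<lambda>n. E n \<tau>) \<longlonglongrightarrow> k \<tau> \<tau>"
  proof eventually_elim
    case (elim \<tau>)
    have kc: "continuous_on {0..} (k \<tau>)" unfolding k_def by (rule continuous_compose[OF elim(1) \<Phi>])
    show ?case
    proof (rule LIMSEQ_I)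
      fix e :: real assume "e > 0"
      then obtain d where d: "d > 0" "\<And>t. t \<ge> 0 \<Longrightarrow> \<bar>t - \<tau>\<bar> < d \<Longrightarrow> \<bar>k \<tau> t - k \<tau> \<tau>\<bar> < e"
        using kc[unfolded continuous_on_iff, rule_format, of \<tau> e] elim ab by (auto simp: dist_real_def)
      have "\<forall>\<^sub>F n in sequentially. \<delta> n < d \<and> T n 0 < \<tau> \<and> \<tau> < T n (m n)"
        using order_tendstoD(2)[OF T(5) d(1)] order_tendstoD(2)[OF T(6), of \<tau>] order_tendstoD(1)[OF T(7), of \<tau>] elim
        by (auto intro: eventually_conj)
      then have "\<forall>\<^sub>F n in sequentially. norm (E n \<tau> - k \<tau> \<tau>) < e"
      proof eventually_elim
        case n: (elim n)
        have "\<exists>i<m n. T n i < \<tau> \<and> \<tau> \<le> T n (Suc i) \<and> E n \<tau> = k \<tau> (T n (Suc i))"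
          using sum_indicator_Ioc[of "m n" "T n" \<tau> "\<lambda>i. k \<tau> (T n (Suc i))"] T(1) n unfolding E_def by auto
        then obtain i where i: "i < m n" "T n i < \<tau>" "\<tau> \<le> T n (Suc i)" "E n \<tau> = k \<tau> (T n (Suc i))" by blast
        then have "\<bar>T n (Suc i) - \<tau>\<bar> < d" using T(4)[OF i(1)] n by linarith
        moreover have "T n (Suc i) \<ge> 0" using i elim ab by auto
        ultimately show ?case using d(2) i(4) by simp
      qed
      then show "\<exists>no. \<forall>n\<ge>no. norm (E n \<tau> - k \<tau> \<tau>) < e" by (simp add: eventually_sequentially)
    qed
  qed
  have km: "(\<lambda>\<tau>. k \<tau> \<tau>) \<in> borel_measurable ?M" by (rule borel_measurable_AE_LIMSEQ[OF _ Em lim]) simp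
  have Bi: "integrable ?M (\<lambda>\<tau>. B * \<rho> \<tau>)" using \<rho> by simp
  have Eb: "AE \<tau> in ?M. norm (E n \<tau>) \<le> B * \<rho> \<tau>" for n
    using kb
  proof eventually_elim
    case (elim \<tau>)
    have nn: "0 \<le> B * \<rho> \<tau>" using elim[rule_format, of 0] by linarith
    consider "E n \<tau> = 0" | i where "i < m n" "E n \<tau> = k \<tau> (T n (Suc i))"
      using sum_indicator_Ioc[of "m n" "T n" \<tau> "\<lambda>i. k \<tau> (T n (Suc i))"] T(1) unfolding E_def by fastforce
    then show ?case
    proof cases
      case 1 then show ?thesis using nn by simp
    next
      case 2
      then show ?thesis using elim Tab(1)[of "Suc i" n] ab by auto
    qed
  qed
  show "integrable ?M (\<lambda>\<tau>. \<integral>x. Z \<tau> x * \<Phi> (u \<tau> x) \<partial>L)"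
    using integrable_dominated_convergence[OF km Em Bi lim Eb] by (simp add: k_def)
  show "(\<lambda>n. \<Sum>i<m n. LINT \<tau>|lebesgue_on {T n i..T n (Suc i)}. (\<integral>x. Z \<tau> x * \<Phi> (u (T n (Suc i)) x) \<partial>L))
       \<longlonglongrightarrow> (LINT \<tau>|?M. (\<integral>x. Z \<tau> x * \<Phi> (u \<tau> x) \<partial>L))"
    using integral_dominated_convergence[OF km Em Bi lim Eb] unfolding Eint by (simp add: k_def)
qed

end

section \<open>The energy inequality\<close>

lemma integral_lebesgue_on_combine:
  fixes w :: "real \<Rightarrow> real"
  assumes w: "integrable (lebesgue_on {r..t}) w" and "r \<le> s" "s \<le> t"
  shows "(LINT x|lebesgue_on {r..s}. w x) + (LINT x|lebesgue_on {s..t}. w x) = (LINT x|lebesgue_on {r..t}. w x)"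
proof -
  have i: "integrable (lebesgue_on {r..s}) w" "integrable (lebesgue_on {s..t}) w"
    using assms by (auto intro!: integrable_subinterval[OF w])
  have "w integrable_on {r..t}" using w by (intro integrable_on_lebesgue_on) auto
  then show ?thesis
    using Henstock_Kurzweil_Integration.integral_combine[OF assms(2,3)] 
      lebesgue_integral_eq_integral[OF w] lebesgue_integral_eq_integral[OF i(1)] lebesgue_integral_eq_integral[OF i(2)] by simp
qed

lemma integral_lebesgue_on_singleton: "(LINT x|lebesgue_on {t..t::real}. w x :: real) = 0"
proof (rule integral_eq_zero_AE)
  have "{t} \<in> null_sets lebesgue" by (simp add: null_sets_completionI)
  then have "AE x in lebesgue. x \<notin> {t}" by (rule AE_not_in)
  then have "AE x in lebesgue_on {t..t}. x \<notin> {t}" by (subst AE_restrict_space_iff, simp, elim eventually_mono, blast)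
  moreover have "AE x in lebesgue_on {t..t}. x \<in> {t}" by (rule AE_I2) simp
  ultimately show "AE x in lebesgue_on {t..t}. w x = 0" by eventually_elim simp
qed

lemma sum_integral_lebesgue_on:
  fixes T :: "nat \<Rightarrow> real" and w :: "real \<Rightarrow> real"
  assumes "\<And>i. i < m \<Longrightarrow> T i \<le> T (Suc i)" "integrable (lebesgue_on {T 0..T m}) w"
  shows "(\<Sum>i<m. LINT x|lebesgue_on {T i..T (Suc i)}. w x) = (LINT x|lebesgue_on {T 0..T m}. w x)"
  using assms
proof (induction m)
  case 0 then show ?case by (simp add: integral_lebesgue_on_singleton del: atLeastAtMost_singleton)
next
  case (Suc m)
  have m: "T 0 \<le> T m" using Suc.prems(1) by (induction m) (auto intro: order_trans)
  have ms: "T m \<le> T (Suc m)" using Suc.prems by simp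
  have "integrable (lebesgue_on {T 0..T m}) w" by (rule integrable_subinterval[OF Suc.prems(2)]) (use m ms in auto)
  then show ?case using Suc.IH Suc.prems integral_lebesgue_on_combine[OF Suc.prems(2) m ms] by simp
qed

lemma integral_lebesgue_on_mono_set:
  fixes w :: "real \<Rightarrow> real"
  assumes w: "integrable (lebesgue_on {a..b}) w" and "a \<le> s" "s \<le> t" "t \<le> b" and nn: "\<And>x. w x \<ge> 0"
  shows "(LINT x|lebesgue_on {s..t}. w x) \<le> (LINT x|lebesgue_on {a..b}. w x)"
proof -
  have ib: "integrable (lebesgue_on {s..b}) w" by (rule integrable_subinterval[OF w]) (use assms in auto)
  have "(LINT x|lebesgue_on {a..s}. w x) \<ge> 0" "(LINT x|lebesgue_on {t..b}. w x) \<ge> 0"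
    using nn by (auto intro!: Bochner_Integration.integral_nonneg)
  then show ?thesis
    using integral_lebesgue_on_combine[OF w, of s] integral_lebesgue_on_combine[OF ib, of t] assms by linarith
qed

lemma test_functions_sum:
  "finite I \<Longrightarrow> (\<And>i. i \<in> I \<Longrightarrow> \<phi> i \<in> test_functions U) \<Longrightarrow> (\<lambda>x. \<Sum>i\<in>I. \<phi> i x) \<in> test_functions U"
  by (induction I rule: finite_induct) (auto intro: test_functions_zero test_functions_add)

definition laplacian :: "('a::euclidean_space \<Rightarrow> real) \<Rightarrow> 'a \<Rightarrow> real" where
  "laplacian \<phi> x = (\<Sum>b\<in>Basis. frechet_derivative (\<lambda>y. frechet_derivative \<phi> (at y) b) (at x) b)"

lemma laplacian_test: "\<phi> \<in> test_functions U \<Longrightarrow> laplacian \<phi> \<in> test_functions U"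
  unfolding laplacian_def[abs_def] by (intro test_functions_sum frechet_derivative_test) auto

context bounded_open
begin

text \<open>Every partial derivative of \<phi> is a test function, so the definition of the weak
  gradient applies componentwise. Afterwards only v occurs, no longer its gradient.\<close>

lemma gradient_pairing_laplacian:
  assumes \<phi>: "\<phi> \<in> test_functions D" and v: "square_integrable L v" "has_weak_gradient D v G"
  shows "(\<integral>x. gradient \<phi> x \<bullet> G x \<partial>L) = - (\<integral>x. laplacian \<phi> x * v x \<partial>L)"
proof -
  let ?d = "\<lambda>b x. frechet_derivative \<phi> (at x) b"
  have G: "square_integrable L G" using v by (simp add: has_weak_gradient_iff)
  have d: "?d b \<in> test_functions D" for b using \<phi> by (rule frechet_derivative_test)
  have Gb: "square_integrable L (\<lambda>x. G x \<bullet> b)" if "b \<in> Basis" for b using G that square_integrable_components[of L G] by auto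
  have "(\<integral>x. gradient \<phi> x \<bullet> G x \<partial>L) = (\<integral>x. (\<Sum>b\<in>Basis. (G x \<bullet> b) * ?d b x) \<partial>L)"
    by (intro Bochner_Integration.integral_cong refl, subst euclidean_inner) (simp add: gradient_inner_Basis mult.commute)
  also have "\<dots> = (\<Sum>b\<in>Basis. \<integral>x. (G x \<bullet> b) * ?d b x \<partial>L)"
    by (intro Bochner_Integration.integral_sum square_integrable_real_mult Gb test_sq d)
  also have "\<dots> = (\<Sum>b\<in>Basis. - (\<integral>x. v x * frechet_derivative (?d b) (at x) b \<partial>L))"
    using v(2) d unfolding has_weak_gradient_iff by (intro sum.cong refl) auto
  also have "\<dots> = - (\<integral>x. (\<Sum>b\<in>Basis. v x * frechet_derivative (?d b) (at x) b) \<partial>L)"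
    unfolding sum_negf
    by (subst Bochner_Integration.integral_sum) (auto intro!: square_integrable_real_mult v test_sq frechet_derivative_test d)
  also have "\<dots> = - (\<integral>x. laplacian \<phi> x * v x \<partial>L)"
    by (simp add: laplacian_def sum_distrib_left mult.commute)
  finally show ?thesis .
qed

end

text \<open>What the energy inequality uses of a truncation. The bound B makes \<Phi>(u) admissible
  against R and F Lipschitz; the bounds on \<Phi>' serve the chain rule, the convexity of F and the
  sign of the diffusion term; \<open>smooth_\<Phi>\<close> together with \<Phi> 0 = 0 maps test
  functions to test functions.\<close>

locale rd_truncation = rd_solution D lam p l \<kappa> \<alpha> \<beta> \<sigma> f g u0 u
  for D :: "'a::euclidean_space set"
    and lam p l \<kappa> \<alpha> \<beta> \<sigma> :: real and f :: "real \<Rightarrow> real" and g u0 :: "'a \<Rightarrow> real"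
    and u :: "real \<Rightarrow> 'a \<Rightarrow> real" +
  fixes F \<Phi> \<Phi>' :: "real \<Rightarrow> real" and K B :: real
  assumes F: "\<And>s. (F has_real_derivative \<Phi> s) (at s)"
    and \<Phi>: "\<And>s. (\<Phi> has_real_derivative \<Phi>' s) (at s)" "\<And>s. \<bar>\<Phi> s\<bar> \<le> B" "\<Phi> 0 = 0"
    and \<Phi>': "continuous_on UNIV \<Phi>'" "\<And>s. 0 \<le> \<Phi>' s" "\<And>s. \<Phi>' s \<le> K"
    and smooth_\<Phi>: "\<And>\<phi>::'a \<Rightarrow> real. smooth \<phi> \<Longrightarrow> smooth (\<lambda>x. \<Phi> (\<phi> x))"
begin

lemma \<Phi>_mono: "x \<le> y \<Longrightarrow> \<Phi> x \<le> \<Phi> y"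
  using DERIV_nonneg_imp_nondecreasing[of x y \<Phi>] \<Phi>(1) \<Phi>'(2) by blast

lemma F_convex: "F y - F x \<le> \<Phi> y * (y - x)"
proof (cases "x = y")
  case False
  then consider "x < y" | "y < x" by linarith
  then show ?thesis
  proof cases
    case 1
    then obtain z where "x < z" "z < y" "F y - F x = (y - x) * \<Phi> z" using MVT2[of x y F \<Phi>] F by blast
    then show ?thesis using \<Phi>_mono[of z y] 1 by (simp add: mult.commute mult_left_mono)
  next
    case 2
    then obtain z where z: "y < z" "z < x" "F x - F y = (x - y) * \<Phi> z" using MVT2[of y x F \<Phi>] F by blast
    have "(x - y) * \<Phi> y \<le> (x - y) * \<Phi> z" using \<Phi>_mono[of y z] z by (intro mult_left_mono) auto
    then show ?thesis using z(3) by (simp add: algebra_simps)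
  qed
qed simp

lemma F_lipschitz: "\<bar>F x - F y\<bar> \<le> B * \<bar>x - y\<bar>"
  using field_differentiable_bound[of UNIV F \<Phi> B x y] F \<Phi>(2) by simp

lemma \<Phi>_cont: "continuous_on UNIV \<Phi>"
  using \<Phi>(1) by (meson DERIV_isCont continuous_at_imp_continuous_on)

definition Y :: "real \<Rightarrow> real" where "Y t = (\<integral>x. F (u t x) \<partial>L)"

lemma Y_cont: "continuous_on {0..} Y"
  unfolding Y_def[abs_def] by (rule continuous_lipschitz[OF F_lipschitz])

lemma \<Phi>u:
  assumes "good t"
  shows "(\<lambda>x. \<Phi> (u t x)) \<in> H10 D" "has_weak_gradient D (\<lambda>x. \<Phi> (u t x)) (\<lambda>x. \<Phi>' (u t x) *\<^sub>R weak_gradient D (u t) x)"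
    "square_integrable L (\<lambda>x. \<Phi> (u t x))"
    "square_integrable L (\<lambda>x. \<Phi>' (u t x) *\<^sub>R weak_gradient D (u t) x)"
    "(\<integral>x. (norm (\<Phi>' (u t x) *\<^sub>R weak_gradient D (u t) x))\<^sup>2 \<partial>L) \<le> K\<^sup>2 * Ngrad t"
    "(\<integral>x. (norm (weak_gradient D (\<lambda>x. \<Phi> (u t x)) x))\<^sup>2 \<partial>L) \<le> K\<^sup>2 * Ngrad t"
proof -
  have abs: "\<bar>\<Phi>' s\<bar> \<le> K" for s using \<Phi>'(2,3)[of s] by simp
  show h: "(\<lambda>x. \<Phi> (u t x)) \<in> H10 D" and w: "has_weak_gradient D (\<lambda>x. \<Phi> (u t x)) (\<lambda>x. \<Phi>' (u t x) *\<^sub>R weak_gradient D (u t) x)"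
    using H10_compose[OF goodD(2)[OF assms] \<Phi>(1) \<Phi>'(1) abs \<Phi>(3) smooth_\<Phi>] by auto
  show "square_integrable L (\<lambda>x. \<Phi> (u t x))" using h by (auto simp: H10_def H1_iff)
  show sq: "square_integrable L (\<lambda>x. \<Phi>' (u t x) *\<^sub>R weak_gradient D (u t) x)" using w by (simp add: has_weak_gradient_iff)
  have "(\<integral>x. (norm (\<Phi>' (u t x) *\<^sub>R weak_gradient D (u t) x))\<^sup>2 \<partial>L) \<le> (\<integral>x. K\<^sup>2 * (norm (weak_gradient D (u t) x))\<^sup>2 \<partial>L)"
  proof (rule integral_mono)
    show "integrable L (\<lambda>x. (norm (\<Phi>' (u t x) *\<^sub>R weak_gradient D (u t) x))\<^sup>2)" by (rule square_integrableD(2)[OF sq])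
    show "integrable L (\<lambda>x. K\<^sup>2 * (norm (weak_gradient D (u t) x))\<^sup>2)" using square_integrableD(2)[OF goodD(3)[OF assms]] by simp
    show "(norm (\<Phi>' (u t x) *\<^sub>R weak_gradient D (u t) x))\<^sup>2 \<le> K\<^sup>2 * (norm (weak_gradient D (u t) x))\<^sup>2" for x
      using \<Phi>'(2,3)[of "u t x"] by (simp add: power_mult_distrib mult_right_mono power_mono)
  qed
  also have "\<dots> = K\<^sup>2 * Ngrad t" by (simp add: Ngrad_def)
  finally show b: "(\<integral>x. (norm (\<Phi>' (u t x) *\<^sub>R weak_gradient D (u t) x))\<^sup>2 \<partial>L) \<le> K\<^sup>2 * Ngrad t" .
  have wg: "has_weak_gradient D (\<lambda>x. \<Phi> (u t x)) (weak_gradient D (\<lambda>x. \<Phi> (u t x)))" using h by (auto simp: H10_def H1_iff)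
  then have wsq: "square_integrable L (weak_gradient D (\<lambda>x. \<Phi> (u t x)))" by (simp add: has_weak_gradient_iff)
  have "(\<integral>x. (norm (weak_gradient D (\<lambda>x. \<Phi> (u t x)) x))\<^sup>2 \<partial>L) = (\<integral>x. (norm (\<Phi>' (u t x) *\<^sub>R weak_gradient D (u t) x))\<^sup>2 \<partial>L)"
    using weak_gradient_unique[OF wg w] square_integrableD(2)[OF wsq] square_integrableD(2)[OF sq]
    by (intro integral_cong_AE) (auto elim!: eventually_mono)
  with b show "(\<integral>x. (norm (weak_gradient D (\<lambda>x. \<Phi> (u t x)) x))\<^sup>2 \<partial>L) \<le> K\<^sup>2 * Ngrad t" by simp
qed

text \<open>R - \<Delta>S stands in for R - \<Delta>u, where \<nabla>S approximates \<nabla>u. For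
  almost every \<tau> it is an integrable function on D, so that its pairing with \<Phi>(u(t)) is
  continuous in t.\<close>

definition Z :: "(real \<Rightarrow> 'a \<Rightarrow> real) \<Rightarrow> real \<Rightarrow> 'a \<Rightarrow> real" where
  "Z S \<tau> x = R \<tau> x - laplacian (S \<tau>) x"

lemma Z_pairing_integrable:
  assumes ab: "0 < a" "a < b" and S: "simple_valued {a..b} (test_functions D) S"
    and z: "z \<in> borel_measurable L" "\<And>x. \<bar>z x\<bar> \<le> C"
  shows "integrable (lebesgue_on {a..b}) (\<lambda>\<tau>. \<integral>x. Z S \<tau> x * z x \<partial>L)"
proof -
  let ?c = "\<lambda>w. \<integral>x. laplacian w x * z x \<partial>L" and ?M = "lebesgue_on {a..b}"
  have zs: "square_integrable L z" by (rule bounded_square_integrable[OF z])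
  have St: "S t \<in> test_functions D" if "t \<in> {a..b}" for t using S that by (auto simp: simple_valued_def)
  have m: "(\<lambda>\<tau>. ?c (S \<tau>)) \<in> borel_measurable ?M" by (rule borel_measurable_simple_valued[OF S, where c="?c"]) simp
  have "finite (?c ` S ` {a..b})" using S by (simp add: simple_valued_def)
  then have "bounded (?c ` S ` {a..b})" by (rule finite_imp_bounded)
  then obtain C' where "\<forall>t\<in>{a..b}. \<bar>?c (S t)\<bar> \<le> C'" by (auto simp: bounded_iff)
  then have C': "\<bar>?c (S t)\<bar> \<le> C'" if "t \<in> {a..b}" for t using that by blast
  have "integrable ?M (\<lambda>\<tau>. C')" by (auto intro: continuous_imp_integrable_real)
  then have i: "integrable ?M (\<lambda>\<tau>. ?c (S \<tau>))"
    by (rule Bochner_Integration.integrable_bound[OF _ m])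
      (use C' in \<open>auto intro!: AE_I2 intro: order_trans[OF _ abs_ge_self]\<close>)
  have i2: "integrable ?M (\<lambda>\<tau>. (\<integral>x. R \<tau> x * z x \<partial>L) - ?c (S \<tau>))"
    by (rule Bochner_Integration.integrable_diff[OF R_pairing_integrable[OF ab z] i])
  have "AE \<tau> in ?M. \<tau> \<in> {a..b}" by (rule AE_I2) simp
  with AE_good[OF ab] have ae: "AE \<tau> in ?M. (\<integral>x. R \<tau> x * z x \<partial>L) - ?c (S \<tau>) = (\<integral>x. Z S \<tau> x * z x \<partial>L)"
  proof eventually_elim
    case (elim \<tau>)
    have "integrable L (\<lambda>x. laplacian (S \<tau>) x * z x)"
      by (intro square_integrable_real_mult test_sq laplacian_test St elim zs)
    then show ?case using R_pairing_bound(1)[OF elim(1) z] by (simp add: Z_def left_diff_distrib)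
  qed
  have "(\<lambda>\<tau>. \<integral>x. Z S \<tau> x * z x \<partial>L) \<in> borel_measurable ?M"
    by (rule borel_measurable_AE_cong[OF _ borel_measurable_integrable[OF i2] ae]) simp
  from Bochner_Integration.integrable_cong_AE_imp[OF i2 this ae] show ?thesis .
qed

text \<open>Convexity of F bounds the change of energy by the pairing of u(t) - u(s) with
  \<Phi>(u(t)), to which \<open>time_identity\<close> applies. There \<nabla>u is exchanged for
  \<nabla>S. The error is split by Young's inequality, and its part with the gradient of
  \<Phi>(u(t)) is at most K^2 times \<open>Ngrad t\<close>.\<close>

lemma step_inequality:
  assumes ab: "0 < a" "a < b" and S: "simple_valued {a..b} (test_functions D) S"
    and d: "integrable (lebesgue_on {a..b}) (\<lambda>t. \<integral>x. (norm (weak_gradient D (u t) x - gradient (S t) x))\<^sup>2 \<partial>L)"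
    and \<eta>: "\<eta> > 0" and st: "a \<le> s" "s \<le> t" "t \<le> b" "good t"
  shows "Y t - Y s \<le> - (LINT \<tau>|lebesgue_on {s..t}. \<integral>x. Z S \<tau> x * \<Phi> (u t x) \<partial>L)
     + (LINT \<tau>|lebesgue_on {s..t}. \<integral>x. (norm (weak_gradient D (u \<tau>) x - gradient (S \<tau>) x))\<^sup>2 \<partial>L) / (2 * \<eta>)
     + \<eta> / 2 * K\<^sup>2 * ((t - s) * Ngrad t)"
proof (cases "s = t")
  \<comment> \<open>Grid points of neighbouring cells may coincide.\<close>
  case True then show ?thesis by (simp add: integral_lebesgue_on_singleton del: atLeastAtMost_singleton)
next
  case False
  then have s: "0 < s" "s < t" using st ab by auto
  let ?v = "\<lambda>x. \<Phi> (u t x)" and ?M = "lebesgue_on {s..t}"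
  let ?d = "\<lambda>\<tau>. \<integral>x. (norm (weak_gradient D (u \<tau>) x - gradient (S \<tau>) x))\<^sup>2 \<partial>L"
  note v = \<Phi>u[OF st(4)]
  have St: "S t \<in> test_functions D" if "t \<in> {a..b}" for t using S that by (auto simp: simple_valued_def)
  have ut: "square_integrable L (u t)" "square_integrable L (u s)" using s by (auto intro!: u_sq)
  have wv: "has_weak_gradient D ?v (weak_gradient D ?v)" using v(1) by (auto simp: H10_def H1_iff)
  then have wvs: "square_integrable L (weak_gradient D ?v)" by (simp add: has_weak_gradient_iff)
  have vm: "?v \<in> borel_measurable L" using square_integrableD(1)[OF v(3)] .
  have "Y t - Y s = (\<integral>x. F (u t x) - F (u s x) \<partial>L)"
    unfolding Y_def using lipschitz_integrable[OF F_lipschitz ut(1)] lipschitz_integrable[OF F_lipschitz ut(2)] by simp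
  also have "\<dots> \<le> (\<integral>x. u t x * ?v x - u s x * ?v x \<partial>L)"
    using lipschitz_integrable[OF F_lipschitz ut(1)] lipschitz_integrable[OF F_lipschitz ut(2)] F_convex
    by (intro integral_mono Bochner_Integration.integrable_diff square_integrable_real_mult ut v) (auto simp: algebra_simps)
  also have "\<dots> = (\<integral>x. u t x * ?v x \<partial>L) - (\<integral>x. u s x * ?v x \<partial>L)"
    by (intro Bochner_Integration.integral_diff square_integrable_real_mult ut v)
  also have "\<dots> = - (LINT \<tau>|?M. (\<integral>x. R \<tau> x * ?v x \<partial>L) + (\<integral>x. weak_gradient D (u \<tau>) x \<bullet> weak_gradient D ?v x \<partial>L))"
    by (rule time_identity[OF v(1) \<Phi>(2) s])
  finally have 1: "Y t - Y s \<le> - (LINT \<tau>|?M. (\<integral>x. R \<tau> x * ?v x \<partial>L) + (\<integral>x. weak_gradient D (u \<tau>) x \<bullet> weak_gradient D ?v x \<partial>L))" .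
  have Zi: "integrable ?M (\<lambda>\<tau>. \<integral>x. Z S \<tau> x * ?v x \<partial>L)"
    by (rule integrable_subinterval[OF Z_pairing_integrable[OF ab S vm \<Phi>(2)]]) (use st in auto)
  have di: "integrable ?M ?d" by (rule integrable_subinterval[OF d]) (use st in auto)
  have ci: "integrable ?M (\<lambda>\<tau>. c)" for c :: real by (auto intro: continuous_imp_integrable_real)
  let ?c = "\<eta> * (K\<^sup>2 * Ngrad t) / 2"
  have "(LINT \<tau>|?M. (\<integral>x. Z S \<tau> x * ?v x \<partial>L) - ?d \<tau> / (2 * \<eta>) - ?c) \<le>
     (LINT \<tau>|?M. (\<integral>x. R \<tau> x * ?v x \<partial>L) + (\<integral>x. weak_gradient D (u \<tau>) x \<bullet> weak_gradient D ?v x \<partial>L))"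
  proof (rule integral_mono_AE)
    show "integrable ?M (\<lambda>\<tau>. (\<integral>x. Z S \<tau> x * ?v x \<partial>L) - ?d \<tau> / (2 * \<eta>) - ?c)" using Zi di ci by simp
    show "integrable ?M (\<lambda>\<tau>. (\<integral>x. R \<tau> x * ?v x \<partial>L) + (\<integral>x. weak_gradient D (u \<tau>) x \<bullet> weak_gradient D ?v x \<partial>L))"
      by (intro Bochner_Integration.integrable_add R_pairing_integrable[OF s vm \<Phi>(2)] grad_pairing_integrable[OF s wvs])
    have "AE \<tau> in ?M. \<tau> \<in> {s..t}" by (rule AE_I2) simp
    with AE_good[OF s] show "AE \<tau> in ?M. (\<integral>x. Z S \<tau> x * ?v x \<partial>L) - ?d \<tau> / (2 * \<eta>) - ?c \<le> 
      (\<integral>x. R \<tau> x * ?v x \<partial>L) + (\<integral>x. weak_gradient D (u \<tau>) x \<bullet> weak_gradient D ?v x \<partial>L)"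
    proof eventually_elim
      case (elim \<tau>)
      have Sr: "S \<tau> \<in> test_functions D" using St elim st by auto
      have sq: "square_integrable L (weak_gradient D (u \<tau>))" "square_integrable L (gradient (S \<tau>))"
        using goodD(3)[OF elim(1)] gradient_sq[OF Sr] by auto
      have il: "integrable L (\<lambda>x. laplacian (S \<tau>) x * ?v x)"
        by (intro square_integrable_real_mult test_sq laplacian_test Sr v)
      then have "(\<integral>x. Z S \<tau> x * ?v x \<partial>L) = (\<integral>x. R \<tau> x * ?v x \<partial>L) - (\<integral>x. laplacian (S \<tau>) x * ?v x \<partial>L)"
        using R_pairing_bound(1)[OF elim(1) vm \<Phi>(2)] by (simp add: Z_def left_diff_distrib)
      moreover have "- (\<integral>x. laplacian (S \<tau>) x * ?v x \<partial>L) = (\<integral>x. gradient (S \<tau>) x \<bullet> weak_gradient D ?v x \<partial>L)"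
        using gradient_pairing_laplacian[OF Sr v(3) wv] by simp
      ultimately have a: "(\<integral>x. Z S \<tau> x * ?v x \<partial>L) = (\<integral>x. R \<tau> x * ?v x \<partial>L) + (\<integral>x. gradient (S \<tau>) x \<bullet> weak_gradient D ?v x \<partial>L)"
        by simp
      have "(\<integral>x. (weak_gradient D (u \<tau>) x - gradient (S \<tau>) x) \<bullet> weak_gradient D ?v x \<partial>L) \<ge>
         - (?d \<tau> / (2 * \<eta>) + \<eta> * (\<integral>x. (norm (weak_gradient D ?v x))\<^sup>2 \<partial>L) / 2)"
        using integral_inner_le[OF square_integrable_diff[OF sq] wvs \<eta>] by linarith
      moreover have "(\<integral>x. (weak_gradient D (u \<tau>) x - gradient (S \<tau>) x) \<bullet> weak_gradient D ?v x \<partial>L)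
         = (\<integral>x. weak_gradient D (u \<tau>) x \<bullet> weak_gradient D ?v x \<partial>L) - (\<integral>x. gradient (S \<tau>) x \<bullet> weak_gradient D ?v x \<partial>L)"
        using integrable_inner[OF sq(1) wvs] integrable_inner[OF sq(2) wvs] by (simp add: inner_diff_left)
      moreover have "\<eta> * (\<integral>x. (norm (weak_gradient D ?v x))\<^sup>2 \<partial>L) / 2 \<le> ?c" using v(6) \<eta> by simp
      ultimately show ?case using a by linarith
    qed
  qed
  moreover have "(LINT \<tau>|?M. (\<integral>x. Z S \<tau> x * ?v x \<partial>L) - ?d \<tau> / (2 * \<eta>) - ?c) =
     (LINT \<tau>|?M. \<integral>x. Z S \<tau> x * ?v x \<partial>L) - (LINT \<tau>|?M. ?d \<tau>) / (2 * \<eta>) - ?c * (t - s)"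
    using Zi di ci s by (simp add: measure_restrict_space)
  moreover have "?c * (t - s) = \<eta> / 2 * K\<^sup>2 * ((t - s) * Ngrad t)" by simp
  ultimately show ?thesis using 1 by linarith
qed

text \<open>One point where \<open>Ngrad\<close> is at most its mean is taken from each of n + 1
  cells of equal length h. Neighbouring points are at most 2 h apart, hence the factor 2 in the
  bound of the sum.\<close>

lemma good_grid:
  assumes ab: "0 < a" "a < b"
  obtains T :: "nat \<Rightarrow> nat \<Rightarrow> real" and \<delta> where
    "\<And>n i. i < n \<Longrightarrow> T n i \<le> T n (Suc i)" "\<And>n. a \<le> T n 0" "\<And>n. T n n \<le> b"
    "\<And>n i. i < n \<Longrightarrow> T n (Suc i) - T n i \<le> \<delta> n" "\<delta> \<longlonglongrightarrow> 0" "(\<lambda>n. T n 0) \<longlonglongrightarrow> a" "(\<lambda>n. T n n) \<longlonglongrightarrow> b"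
    "\<And>n i. i \<le> n \<Longrightarrow> good (T n i)"
    "\<And>n. (\<Sum>i<n. (T n (Suc i) - T n i) * Ngrad (T n (Suc i))) \<le> 2 * (LINT t|lebesgue_on {a..b}. Ngrad t)"
proof -
  define h where "h n = (b - a) / real (Suc n)" for n
  define P where "P n i = a + real i * h n" for n i
  have h: "h n > 0" for n using ab by (simp add: h_def)
  have P0: "P n 0 = a" for n by (simp add: P_def)
  have PS: "P n (Suc n) = b" for n by (simp add: P_def h_def del: of_nat_Suc)
  have PSuc: "P n (Suc i) = P n i + h n" for n i by (simp add: P_def algebra_simps)
  have Pa: "a \<le> P n i" for n i using h[of n] by (simp add: P_def)
  have Pb: "P n i \<le> b" if "i \<le> Suc n" for n i
  proof -
    have "real i * h n \<le> real (Suc n) * h n" using that h[of n] by (intro mult_right_mono) auto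
    then show ?thesis using PS[of n] by (simp add: P_def)
  qed
  have "\<exists>t. P n i \<le> t \<and> t \<le> P n (Suc i) \<and> good t \<and> h n * Ngrad t \<le> (LINT t|lebesgue_on {P n i..P n (Suc i)}. Ngrad t)" for n i
    using good_point_in_cell[of "P n i" "P n (Suc i)"] Pa[of n i] ab h[of n] PSuc[of n i] by (metis add.commute add_diff_cancel_right' less_add_same_cancel1 less_le_trans)
  then obtain T where T: "\<And>n i. P n i \<le> T n i" "\<And>n i. T n i \<le> P n (Suc i)" "\<And>n i. good (T n i)"
    "\<And>n i. h n * Ngrad (T n i) \<le> (LINT t|lebesgue_on {P n i..P n (Suc i)}. Ngrad t)" by metis
  have h0: "h \<longlonglongrightarrow> 0"
    using tendsto_mult_right_zero[OF LIMSEQ_inverse_real_of_nat, of "b - a"] by (simp add: h_def[abs_def] divide_inverse)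
  have step: "T n i \<le> T n (Suc i)" "T n (Suc i) - T n i \<le> 2 * h n" for n i
    using T(1)[of n "Suc i"] T(2)[of n i] T(2)[of n "Suc i"] T(1)[of n i] PSuc[of n i] PSuc[of n "Suc i"] by linarith+
  show ?thesis
  proof
    show "T n i \<le> T n (Suc i)" for n i by (rule step)
    show "a \<le> T n 0" for n using T(1)[of n 0] P0[of n] by simp
    show "T n n \<le> b" for n using T(2)[of n n] PS[of n] by simp
    show "T n (Suc i) - T n i \<le> 2 * h n" for n i by (rule step)
    show "(\<lambda>n. 2 * h n) \<longlonglongrightarrow> 0" using tendsto_mult_right_zero[OF h0] by simp
    show "good (T n i)" for n i by (rule T)
    have "(\<lambda>n. a + h n) \<longlonglongrightarrow> a" using tendsto_add[OF tendsto_const h0] by simp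
    then show "(\<lambda>n. T n 0) \<longlonglongrightarrow> a"
      by (rule tendsto_sandwich[OF _ _ tendsto_const, rotated 2]) (use T(1,2)[of _ 0] P0 PSuc in auto)
    have l1: "(\<lambda>n. b - h n) \<longlonglongrightarrow> b" using tendsto_diff[OF tendsto_const h0] by simp
    have l2: "\<forall>\<^sub>F n in sequentially. b - h n \<le> T n n"
    proof (intro always_eventually allI)
      show "b - h n \<le> T n n" for n using T(1)[of n n] PSuc[of n n] PS[of n] by linarith
    qed
    have l3: "\<forall>\<^sub>F n in sequentially. T n n \<le> b"
      by (intro always_eventually allI) (metis T(2) PS)
    show "(\<lambda>n. T n n) \<longlonglongrightarrow> b" by (rule tendsto_sandwich[OF l2 l3 l1 tendsto_const])
    fix n
    have "(\<Sum>i<n. (T n (Suc i) - T n i) * Ngrad (T n (Suc i))) \<le> (\<Sum>i<n. 2 * (LINT t|lebesgue_on {P n (Suc i)..P n (Suc (Suc i))}. Ngrad t))"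
    proof (rule sum_mono)
      fix i
      have "(T n (Suc i) - T n i) * Ngrad (T n (Suc i)) \<le> (2 * h n) * Ngrad (T n (Suc i))"
        by (rule mult_right_mono[OF step(2) Ngrad_nonneg])
      also have "\<dots> \<le> 2 * (LINT t|lebesgue_on {P n (Suc i)..P n (Suc (Suc i))}. Ngrad t)" using T(4)[of n "Suc i"] by simp
      finally show "(T n (Suc i) - T n i) * Ngrad (T n (Suc i)) \<le> 2 * (LINT t|lebesgue_on {P n (Suc i)..P n (Suc (Suc i))}. Ngrad t)" .
    qed
    also have "\<dots> = 2 * (\<Sum>i<n. LINT t|lebesgue_on {P n (Suc i)..P n (Suc (Suc i))}. Ngrad t)" by (simp add: sum_distrib_left)
    also have "(\<Sum>i<n. LINT t|lebesgue_on {P n (Suc i)..P n (Suc (Suc i))}. Ngrad t) \<le> (\<Sum>i<Suc n. LINT t|lebesgue_on {P n i..P n (Suc i)}. Ngrad t)"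
      unfolding sum.lessThan_Suc_shift using Ngrad_nonneg by (simp add: Bochner_Integration.integral_nonneg)
    also have "\<dots> = (LINT t|lebesgue_on {P n 0..P n (Suc n)}. Ngrad t)"
      using h[of n] Ngrad_integrable[OF ab] by (intro sum_integral_lebesgue_on) (auto simp: PSuc P0 PS[unfolded PSuc] simp flip: )
    finally show "(\<Sum>i<n. (T n (Suc i) - T n i) * Ngrad (T n (Suc i))) \<le> 2 * (LINT t|lebesgue_on {a..b}. Ngrad t)"
      by (simp add: P0 PS)
  qed
qed

lemma energy_inequality:
  assumes ab: "0 < a" "a < b"
  shows "integrable (lebesgue_on {a..b}) (\<lambda>\<tau>. \<integral>x. R \<tau> x * \<Phi> (u \<tau> x) \<partial>L)"
    "Y b - Y a \<le> - (LINT \<tau>|lebesgue_on {a..b}. \<integral>x. R \<tau> x * \<Phi> (u \<tau> x) \<partial>L)"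
proof -
  let ?M = "lebesgue_on {a..b}"
  obtain T :: "nat \<Rightarrow> nat \<Rightarrow> real" and \<delta> where T:
    "\<And>n i. i < n \<Longrightarrow> T n i \<le> T n (Suc i)" "\<And>n. a \<le> T n 0" "\<And>n. T n n \<le> b"
    "\<And>n i. i < n \<Longrightarrow> T n (Suc i) - T n i \<le> \<delta> n" "\<delta> \<longlonglongrightarrow> 0" "(\<lambda>n. T n 0) \<longlonglongrightarrow> a" "(\<lambda>n. T n n) \<longlonglongrightarrow> b"
    and Tg: "\<And>n i. i \<le> n \<Longrightarrow> good (T n i)"
    and TN: "\<And>n. (\<Sum>i<n. (T n (Suc i) - T n i) * Ngrad (T n (Suc i))) \<le> 2 * (LINT t|lebesgue_on {a..b}. Ngrad t)"
    by (rule good_grid[OF ab]) (rule that; assumption)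
  have mono0: "T n 0 \<le> T n i" if "i \<le> n" for n i
    using that by (induction i) (auto intro: order_trans[OF _ T(1)])
  have mono1: "T n i \<le> T n n" if "i \<le> n" for n i
    using that by (induction rule: inc_induct) (auto intro: order_trans[OF T(1)])
  have Tab: "a \<le> T n i" "T n i \<le> b" if "i \<le> n" for n i
    using mono0[OF that] mono1[OF that] T(2)[of n] T(3)[of n] by auto
  have RiAE: "AE \<tau> in ?M. integrable L (R \<tau>)" "AE \<tau> in ?M. (\<integral>x. \<bar>R \<tau> x\<bar> \<partial>L) \<le> Rb \<tau>"
    using AE_good[OF ab] R_integrable by (auto elim!: eventually_mono)
  show Rd: "integrable ?M (\<lambda>\<tau>. \<integral>x. R \<tau> x * \<Phi> (u \<tau> x) \<partial>L)"
    by (rule grid_limit(1)[OF ab \<Phi>_cont \<Phi>(2) RiAE(1) R_pairing_integrable[OF ab] Rb_integrable[OF ab] RiAE(2) T])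
  let ?J = "LINT t|?M. Ngrad t"
  have J: "?J \<ge> 0" using Ngrad_nonneg by (intro Bochner_Integration.integral_nonneg) auto
  \<comment> \<open>The constant collects \<eta> / 2 from each of the two exchanges of gradients,
    \<eta> * K^2 * ?J from the grid sum with its factor 2, and half of this from the exchange at
    equal times.\<close>
  have main: "Y b - Y a \<le> - (LINT \<tau>|?M. \<integral>x. R \<tau> x * \<Phi> (u \<tau> x) \<partial>L) + \<eta> * (1 + 3 / 2 * K\<^sup>2 * ?J)" if \<eta>: "\<eta> > 0" for \<eta>
  proof -
    \<comment> \<open>The error is \<eta>^2 because Young's inequality divides it by 2 *
      \<eta>.\<close>
    obtain S where S: "simple_valued {a..b} (test_functions D) S"
      and d: "integrable ?M (\<lambda>t. \<integral>x. (norm (weak_gradient D (u t) x - gradient (S t) x))\<^sup>2 \<partial>L)"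
      and de: "(LINT t|?M. \<integral>x. (norm (weak_gradient D (u t) x - gradient (S t) x))\<^sup>2 \<partial>L) \<le> \<eta>\<^sup>2"
      using grad_approx_test[OF ab, of "\<eta>\<^sup>2"] \<eta> by auto
    let ?d = "\<lambda>t. \<integral>x. (norm (weak_gradient D (u t) x - gradient (S t) x))\<^sup>2 \<partial>L"
    have St: "S t \<in> test_functions D" if "t \<in> {a..b}" for t using S that by (auto simp: simple_valued_def)
    have inI: "AE \<tau> in ?M. \<tau> \<in> {a..b}" by (rule AE_I2) simp
    have "finite ((\<lambda>w. \<integral>x. \<bar>laplacian w x\<bar> \<partial>L) ` S ` {a..b})" using S by (simp add: simple_valued_def)
    then have "bounded ((\<lambda>w. \<integral>x. \<bar>laplacian w x\<bar> \<partial>L) ` S ` {a..b})" by (rule finite_imp_bounded)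
    then obtain C where "\<forall>t\<in>{a..b}. \<bar>\<integral>x. \<bar>laplacian (S t) x\<bar> \<partial>L\<bar> \<le> C" by (auto simp: bounded_iff)
    then have C: "(\<integral>x. \<bar>laplacian (S t) x\<bar> \<partial>L) \<le> C" if "t \<in> {a..b}" for t using that by fastforce
    have lapi: "integrable L (laplacian (S t))" if "t \<in> {a..b}" for t
      by (intro sq_imp_integrable test_sq laplacian_test St that)
    have Zi: "AE \<tau> in ?M. integrable L (Z S \<tau>)" using RiAE(1) inI
      by eventually_elim (auto simp: Z_def[abs_def] lapi)
    have Zb: "AE \<tau> in ?M. (\<integral>x. \<bar>Z S \<tau> x\<bar> \<partial>L) \<le> Rb \<tau> + C"
      using RiAE inI
    proof eventually_elim
      case (elim \<tau>)
      have "(\<integral>x. \<bar>Z S \<tau> x\<bar> \<partial>L) \<le> (\<integral>x. \<bar>R \<tau> x\<bar> + \<bar>laplacian (S \<tau>) x\<bar> \<partial>L)"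
        using elim lapi[OF elim(3)] by (intro integral_mono) (auto simp: Z_def[abs_def])
      also have "\<dots> = (\<integral>x. \<bar>R \<tau> x\<bar> \<partial>L) + (\<integral>x. \<bar>laplacian (S \<tau>) x\<bar> \<partial>L)" using elim lapi[OF elim(3)] by simp
      finally show ?case using elim(2) C[OF elim(3)] by linarith
    qed
    have \<rho>: "integrable ?M (\<lambda>\<tau>. Rb \<tau> + C)" using Rb_integrable[OF ab] by (auto intro: continuous_imp_integrable_real)
    note gl = grid_limit[OF ab \<Phi>_cont \<Phi>(2) Zi Z_pairing_integrable[OF ab S] \<rho> Zb T]
    let ?s = "\<lambda>n. \<Sum>i<n. LINT \<tau>|lebesgue_on {T n i..T n (Suc i)}. (\<integral>x. Z S \<tau> x * \<Phi> (u (T n (Suc i)) x) \<partial>L)"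
    have sn: "Y (T n n) - Y (T n 0) \<le> - ?s n + \<eta> / 2 + \<eta> * K\<^sup>2 * ?J" for n
    proof -
      have "Y (T n n) - Y (T n 0) = (\<Sum>i<n. Y (T n (Suc i)) - Y (T n i))" using sum_lessThan_telescope[of "\<lambda>i. Y (T n i)" n] by simp
      also have "\<dots> \<le> (\<Sum>i<n. - (LINT \<tau>|lebesgue_on {T n i..T n (Suc i)}. \<integral>x. Z S \<tau> x * \<Phi> (u (T n (Suc i)) x) \<partial>L)
         + (LINT \<tau>|lebesgue_on {T n i..T n (Suc i)}. ?d \<tau>) / (2 * \<eta>) + \<eta> / 2 * K\<^sup>2 * ((T n (Suc i) - T n i) * Ngrad (T n (Suc i))))"
        by (intro sum_mono step_inequality[OF ab S d \<eta>] Tab T Tg) auto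
      also have "\<dots> = - ?s n + (\<Sum>i<n. LINT \<tau>|lebesgue_on {T n i..T n (Suc i)}. ?d \<tau>) / (2 * \<eta>)
          + \<eta> / 2 * K\<^sup>2 * (\<Sum>i<n. (T n (Suc i) - T n i) * Ngrad (T n (Suc i)))"
        by (simp add: sum.distrib sum_negf sum_subtractf sum_distrib_left sum_divide_distrib)
      also have "(\<Sum>i<n. LINT \<tau>|lebesgue_on {T n i..T n (Suc i)}. ?d \<tau>) = (LINT \<tau>|lebesgue_on {T n 0..T n n}. ?d \<tau>)"
        using T(1) Tab[of 0 n] Tab[of n n] by (intro sum_integral_lebesgue_on integrable_subinterval[OF d]) auto
      also have "(LINT \<tau>|lebesgue_on {T n 0..T n n}. ?d \<tau>) / (2 * \<eta>) \<le> \<eta> / 2"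
      proof -
        have "(LINT \<tau>|lebesgue_on {T n 0..T n n}. ?d \<tau>) \<le> (LINT \<tau>|?M. ?d \<tau>)"
          using Tab[of 0 n] Tab[of n n] mono0[of n n] by (intro integral_lebesgue_on_mono_set[OF d]) auto
        then have "(LINT \<tau>|lebesgue_on {T n 0..T n n}. ?d \<tau>) \<le> \<eta>\<^sup>2" using de by linarith
        then show ?thesis using \<eta> by (simp add: field_simps power2_eq_square)
      qed
      also have "\<eta> / 2 * K\<^sup>2 * (\<Sum>i<n. (T n (Suc i) - T n i) * Ngrad (T n (Suc i))) \<le> \<eta> / 2 * K\<^sup>2 * (2 * ?J)"
        using \<eta> by (intro mult_left_mono TN) auto
      finally show ?thesis by simp
    qed
    have Yl: "(\<lambda>n. Y (T n n) - Y (T n 0)) \<longlonglongrightarrow> Y b - Y a"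
    proof (rule tendsto_diff)
      show "(\<lambda>n. Y (T n n)) \<longlonglongrightarrow> Y b"
        by (rule continuous_on_tendsto_compose[OF Y_cont T(7)]) (use ab Tab in \<open>auto intro!: always_eventually order_trans[OF _ Tab(1)]\<close>)
      show "(\<lambda>n. Y (T n 0)) \<longlonglongrightarrow> Y a"
        by (rule continuous_on_tendsto_compose[OF Y_cont T(6)]) (use ab Tab in \<open>auto intro!: always_eventually order_trans[OF _ Tab(1)]\<close>)
    qed
    have lim: "Y b - Y a \<le> - (LINT \<tau>|?M. \<integral>x. Z S \<tau> x * \<Phi> (u \<tau> x) \<partial>L) + \<eta> / 2 + \<eta> * K\<^sup>2 * ?J"
      by (rule LIMSEQ_le[OF Yl tendsto_add[OF tendsto_add[OF tendsto_minus[OF gl(2)] tendsto_const] tendsto_const]]) (use sn in auto)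
    have "(LINT \<tau>|?M. (\<integral>x. R \<tau> x * \<Phi> (u \<tau> x) \<partial>L) - (?d \<tau> / (2 * \<eta>) + \<eta> / 2 * K\<^sup>2 * Ngrad \<tau>)) \<le> (LINT \<tau>|?M. \<integral>x. Z S \<tau> x * \<Phi> (u \<tau> x) \<partial>L)"
    proof (rule integral_mono_AE)
      show "integrable ?M (\<lambda>\<tau>. (\<integral>x. R \<tau> x * \<Phi> (u \<tau> x) \<partial>L) - (?d \<tau> / (2 * \<eta>) + \<eta> / 2 * K\<^sup>2 * Ngrad \<tau>))"
        using Rd d Ngrad_integrable[OF ab] by simp
      show "integrable ?M (\<lambda>\<tau>. \<integral>x. Z S \<tau> x * \<Phi> (u \<tau> x) \<partial>L)" by (rule gl(1))
      show "AE \<tau> in ?M. (\<integral>x. R \<tau> x * \<Phi> (u \<tau> x) \<partial>L) - (?d \<tau> / (2 * \<eta>) + \<eta> / 2 * K\<^sup>2 * Ngrad \<tau>) \<le> (\<integral>x. Z S \<tau> x * \<Phi> (u \<tau> x) \<partial>L)"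
        using AE_good[OF ab] inI
      proof eventually_elim
        case (elim \<tau>)
        note v = \<Phi>u[OF elim(1)] and Sr = St[OF elim(2)] and G = goodD(3)[OF elim(1)]
        let ?G = "\<lambda>x. \<Phi>' (u \<tau> x) *\<^sub>R weak_gradient D (u \<tau>) x"
        have vm: "(\<lambda>x. \<Phi> (u \<tau> x)) \<in> borel_measurable L" using square_integrableD(1)[OF v(3)] .
        have "integrable L (\<lambda>x. laplacian (S \<tau>) x * \<Phi> (u \<tau> x))"
          by (intro square_integrable_real_mult test_sq laplacian_test Sr v)
        then have "(\<integral>x. Z S \<tau> x * \<Phi> (u \<tau> x) \<partial>L) = (\<integral>x. R \<tau> x * \<Phi> (u \<tau> x) \<partial>L) - (\<integral>x. laplacian (S \<tau>) x * \<Phi> (u \<tau> x) \<partial>L)"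
          using R_pairing_bound(1)[OF elim(1) vm \<Phi>(2)] by (simp add: Z_def left_diff_distrib)
        moreover have "- (\<integral>x. laplacian (S \<tau>) x * \<Phi> (u \<tau> x) \<partial>L) = (\<integral>x. gradient (S \<tau>) x \<bullet> ?G x \<partial>L)"
          using gradient_pairing_laplacian[OF Sr v(3,2)] by simp
        moreover have "(\<integral>x. (weak_gradient D (u \<tau>) x - gradient (S \<tau>) x) \<bullet> ?G x \<partial>L)
           = (\<integral>x. weak_gradient D (u \<tau>) x \<bullet> ?G x \<partial>L) - (\<integral>x. gradient (S \<tau>) x \<bullet> ?G x \<partial>L)"
          unfolding inner_diff_left
          by (intro Bochner_Integration.integral_diff integrable_inner G v(4) gradient_sq[OF Sr])
        moreover have "(\<integral>x. (weak_gradient D (u \<tau>) x - gradient (S \<tau>) x) \<bullet> ?G x \<partial>L) \<le> 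
           ?d \<tau> / (2 * \<eta>) + \<eta> * (\<integral>x. (norm (?G x))\<^sup>2 \<partial>L) / 2"
          using integral_inner_le[OF square_integrable_diff[OF G gradient_sq[OF Sr]] v(4) \<eta>] by linarith
        moreover have "\<eta> * (\<integral>x. (norm (?G x))\<^sup>2 \<partial>L) / 2 \<le> \<eta> / 2 * K\<^sup>2 * Ngrad \<tau>" using mult_left_mono[OF v(5), of "\<eta> / 2"] \<eta> by simp
        moreover have "(\<integral>x. weak_gradient D (u \<tau>) x \<bullet> ?G x \<partial>L) \<ge> 0"
          using \<Phi>'(2) by (intro Bochner_Integration.integral_nonneg) auto
        ultimately show ?case by linarith
      qed
    qed
    moreover have "(LINT \<tau>|?M. (\<integral>x. R \<tau> x * \<Phi> (u \<tau> x) \<partial>L) - (?d \<tau> / (2 * \<eta>) + \<eta> / 2 * K\<^sup>2 * Ngrad \<tau>))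
       = (LINT \<tau>|?M. \<integral>x. R \<tau> x * \<Phi> (u \<tau> x) \<partial>L) - ((LINT \<tau>|?M. ?d \<tau>) / (2 * \<eta>) + \<eta> / 2 * K\<^sup>2 * ?J)"
      using Rd d Ngrad_integrable[OF ab] by simp
    moreover have "(LINT \<tau>|?M. ?d \<tau>) / (2 * \<eta>) \<le> \<eta> / 2" using de \<eta> by (simp add: field_simps power2_eq_square)
    ultimately show ?thesis using lim by (simp add: algebra_simps)
  qed
  show "Y b - Y a \<le> - (LINT \<tau>|?M. \<integral>x. R \<tau> x * \<Phi> (u \<tau> x) \<partial>L)"
  proof (rule field_le_epsilon)
    fix e :: real assume e: "e > 0"
    have pos: "1 + 3 / 2 * K\<^sup>2 * ?J > 0" using J by (simp add: add_pos_nonneg)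
    show "Y b - Y a \<le> - (LINT \<tau>|?M. \<integral>x. R \<tau> x * \<Phi> (u \<tau> x) \<partial>L) + e"
      using main[of "e / (1 + 3 / 2 * K\<^sup>2 * ?J)"] e pos by simp
  qed
qed

end

section \<open>Truncations of powers\<close>

lemma continuous_has_antiderivative:
  fixes \<Phi> :: "real \<Rightarrow> real"
  assumes c: "continuous_on UNIV \<Phi>"
  obtains F where "F 0 = 0" "\<And>s. (F has_real_derivative \<Phi> s) (at s)"
proof -
  \<comment> \<open>Both integrals start to the left of 0 and of s, which avoids oriented integrals;
    the starting point cancels.\<close>
  define F where "F s = integral {- (\<bar>s\<bar> + 1)..s} \<Phi> - integral {- (\<bar>s\<bar> + 1)..0} \<Phi>" for s
  have ii: "\<Phi> integrable_on {x..y}" for x y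
    using continuous_on_subset[OF c] by (intro integrable_continuous_real) auto
  have eq: "F s = integral {- N..s} \<Phi> - integral {- N..0} \<Phi>" if "\<bar>s\<bar> + 1 \<le> N" for s N
  proof -
    have le: "- N \<le> - (\<bar>s\<bar> + 1)" "- (\<bar>s\<bar> + 1) \<le> s" "- (\<bar>s\<bar> + 1) \<le> 0" using that by linarith+
    show ?thesis
      using Henstock_Kurzweil_Integration.integral_combine[OF le(1,2) ii]
        Henstock_Kurzweil_Integration.integral_combine[OF le(1,3) ii] unfolding F_def by linarith
  qed
  have "(F has_real_derivative \<Phi> s) (at s)" for s
  proof -
    define N where "N = \<bar>s\<bar> + 2"
    have "((\<lambda>x. integral {- N..x} \<Phi>) has_real_derivative \<Phi> s) (at s within {- N..N})"
      by (intro integral_has_real_derivative continuous_on_subset[OF c]) (auto simp: N_def)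
    then have "((\<lambda>x. integral {- N..x} \<Phi>) has_real_derivative \<Phi> s) (at s)"
      by (subst (asm) at_within_Icc_at) (auto simp: N_def)
    then have "((\<lambda>x. integral {- N..x} \<Phi> - integral {- N..0} \<Phi>) has_real_derivative \<Phi> s) (at s)"
      by (auto intro!: derivative_eq_intros)
    moreover have "\<forall>\<^sub>F x in nhds s. F x = integral {- N..x} \<Phi> - integral {- N..0} \<Phi>"
    proof (rule eventually_mono[OF eventually_nhds_in_open[of "ball s 1" s]])
      show "F x = integral {- N..x} \<Phi> - integral {- N..0} \<Phi>" if "x \<in> ball s 1" for x
        by (rule eq) (use that in \<open>auto simp: N_def dist_real_def\<close>)
    qed auto
    ultimately show ?thesis by (rule iffD2[OF DERIV_cong_ev[OF refl _ refl], rotated])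
  qed
  then show ?thesis using that[of F] by (simp add: F_def)
qed

text \<open>Between -|s| and |s| such a G decreases up to 0 and increases afterwards. The sign of q
  is asked for only up to |s|, which allows q to contain s as a parameter.\<close>

lemma nonneg_of_derivative_sign:
  fixes G q :: "real \<Rightarrow> real"
  assumes "G 0 = 0" "\<And>r. (G has_real_derivative r * q r) (at r)" "\<And>r. \<bar>r\<bar> \<le> \<bar>s\<bar> \<Longrightarrow> 0 \<le> q r"
  shows "0 \<le> G s"
proof (cases "s \<ge> 0")
  case True
  have "G 0 \<le> G s"
    by (rule DERIV_nonneg_imp_nondecreasing[OF True]) (use assms True in \<open>auto intro!: exI mult_nonneg_nonneg\<close>)
  then show ?thesis using assms(1) by simp
next
  case False
  have "G s \<ge> G 0"
  proof (rule DERIV_nonpos_imp_nonincreasing[of s 0])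
    show "s \<le> 0" using False by simp
    fix x assume "s \<le> x" "x \<le> 0"
    then show "\<exists>y. (G has_real_derivative y) (at x) \<and> y \<le> 0"
      using assms(2)[of x] assms(3)[of x] by (intro exI[of _ "x * q x"]) (auto intro: mult_nonpos_nonneg)
  qed
  then show ?thesis using assms(1) by simp
qed

lemma DERIV_powr_compose:
  fixes h :: "real \<Rightarrow> real"
  assumes "(h has_real_derivative h') (at s)" "h s > 0"
  shows "((\<lambda>s. h s powr r) has_real_derivative r * h s powr (r - 1) * h') (at s)"
  using DERIV_chain2[where f="\<lambda>z. z powr r" and g=h, OF has_real_derivative_powr[OF assms(2)] assms(1)] .

text \<open>The truncation is s times this weight. As e \<rightarrow> 0 it tends to s (1 + s^2)^m, a
  substitute for |s|^(2m) s that is smooth at 0. For fixed e the second factor decays like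
  |s|^(-2m-1), exactly compensating the growth of s (1 + s^2)^m.\<close>

definition trunc_weight :: "real \<Rightarrow> real \<Rightarrow> real \<Rightarrow> real" where
  "trunc_weight m e s = (1 + s\<^sup>2) powr m * (1 + e * s\<^sup>2) powr (- m - 1/2)"

definition trunc_deriv :: "real \<Rightarrow> real \<Rightarrow> real \<Rightarrow> real" where
  "trunc_deriv m e s = trunc_weight m e s * (1 + 2 * m * s\<^sup>2 / (1 + s\<^sup>2) - (2 * m + 1) * (e * s\<^sup>2) / (1 + e * s\<^sup>2))"

locale truncation =
  fixes m e :: real assumes m: "m \<ge> 0" and e: "0 < e" "e \<le> 1"
begin

abbreviation "c \<equiv> trunc_weight m e"

lemma one_plus_pos: "0 < 1 + s\<^sup>2" "0 < 1 + e * s\<^sup>2" "1 \<le> 1 + e * s\<^sup>2" for s :: real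
proof -
  have "0 \<le> e * s\<^sup>2" using e by simp
  then show "0 < 1 + e * s\<^sup>2" "1 \<le> 1 + e * s\<^sup>2" by linarith+
  show "0 < 1 + s\<^sup>2" by (simp add: add_pos_nonneg)
qed

lemma c_pos: "c s > 0" using one_plus_pos[of s] by (simp add: trunc_weight_def)

lemma c_le: "c s \<le> (1 + s\<^sup>2) powr m"
proof -
  have "(1 + e * s\<^sup>2) powr (- m - 1/2) \<le> (1 + e * s\<^sup>2) powr 0" using one_plus_pos[of s] m by (intro powr_mono) auto
  also have "\<dots> = 1" using one_plus_pos(2)[of s] by simp
  finally show ?thesis by (simp add: trunc_weight_def mult_left_le)
qed

text \<open>Since e \<le> 1, e (1 + s^2) \<le> 1 + e s^2. The m-th power of this absorbs the growth
  of the first factor into the second.\<close>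

lemma c_le_e: "c s \<le> e powr (- m) * (1 + e * s\<^sup>2) powr (- 1/2)"
proof -
  have "e * (1 + s\<^sup>2) \<le> 1 + e * s\<^sup>2" using e by (simp add: algebra_simps)
  then have "(e * (1 + s\<^sup>2)) powr m \<le> (1 + e * s\<^sup>2) powr m" using m e by (intro powr_mono2) auto
  then have "e powr m * (1 + s\<^sup>2) powr m \<le> (1 + e * s\<^sup>2) powr m" using e by (simp add: powr_mult)
  then have "e powr (- m) * (e powr m * (1 + s\<^sup>2) powr m) \<le> e powr (- m) * (1 + e * s\<^sup>2) powr m" by (intro mult_left_mono) auto
  then have "(1 + s\<^sup>2) powr m \<le> e powr (- m) * (1 + e * s\<^sup>2) powr m"
    using e by (simp add: mult.assoc[symmetric] powr_add[symmetric])
  then have "c s \<le> (e powr (- m) * (1 + e * s\<^sup>2) powr m) * (1 + e * s\<^sup>2) powr (- m - 1/2)"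
    unfolding trunc_weight_def by (intro mult_right_mono) auto
  also have "\<dots> = e powr (- m) * (1 + e * s\<^sup>2) powr (- 1/2)"
    by (simp add: mult.assoc powr_add[symmetric])
  finally show ?thesis .
qed

lemma bound: "\<bar>s * c s\<bar> \<le> e powr (- m) * e powr (- 1/2)"
proof -
  have "(e * s\<^sup>2) powr (1/2) \<le> (1 + e * s\<^sup>2) powr (1/2)" using e by (intro powr_mono2) auto
  moreover have "(e * s\<^sup>2) powr (1/2) = e powr (1/2) * \<bar>s\<bar>"
    using e by (simp add: powr_mult powr_half_sqrt)
  ultimately have "e powr (1/2) * \<bar>s\<bar> * (1 + e * s\<^sup>2) powr (- 1/2) \<le> (1 + e * s\<^sup>2) powr (1/2) * (1 + e * s\<^sup>2) powr (- 1/2)"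
    by (intro mult_right_mono) auto
  also have "\<dots> = 1" using one_plus_pos[of s] by (simp add: powr_add[symmetric])
  finally have "e powr (- 1/2) * (e powr (1/2) * \<bar>s\<bar> * (1 + e * s\<^sup>2) powr (- 1/2)) \<le> e powr (- 1/2) * 1" by (intro mult_left_mono) auto
  moreover have "e powr (- 1/2) * e powr (1/2) = 1" using e by (simp add: powr_add[symmetric])
  ultimately have 1: "\<bar>s\<bar> * (1 + e * s\<^sup>2) powr (- 1/2) \<le> e powr (- 1/2)" by (simp add: mult.assoc[symmetric])
  have "\<bar>s * c s\<bar> = \<bar>s\<bar> * c s" using c_pos[of s] by (simp add: abs_mult)
  also have "\<dots> \<le> \<bar>s\<bar> * (e powr (- m) * (1 + e * s\<^sup>2) powr (- 1/2))" by (intro mult_left_mono c_le_e) auto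
  also have "\<dots> = e powr (- m) * (\<bar>s\<bar> * (1 + e * s\<^sup>2) powr (- 1/2))" by simp
  also have "\<dots> \<le> e powr (- m) * e powr (- 1/2)" by (intro mult_left_mono 1) auto
  finally show ?thesis .
qed

lemma deriv: "((\<lambda>s. s * c s) has_real_derivative trunc_deriv m e s) (at s)"
proof -
  let ?a = "1 + s\<^sup>2" and ?b = "1 + e * s\<^sup>2" and ?n = "- m - 1/2"
  have pa: "((\<lambda>s. (1 + s\<^sup>2) powr m) has_real_derivative (m * ?a powr (m - 1) * (2 * s))) (at s)"
    by (intro DERIV_powr_compose one_plus_pos) (auto intro!: derivative_eq_intros)
  have pb: "((\<lambda>s. (1 + e * s\<^sup>2) powr ?n) has_real_derivative (?n * ?b powr (?n - 1) * (2 * e * s))) (at s)"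
    by (intro DERIV_powr_compose one_plus_pos) (auto intro!: derivative_eq_intros)
  have ra: "?a powr (m - 1) = ?a powr m / ?a" and rb: "?b powr (?n - 1) = ?b powr ?n / ?b"
    using powr_diff[of ?a m 1] powr_diff[of ?b ?n 1] one_plus_pos[of s] by simp_all
  have "((\<lambda>s. s * ((1 + s\<^sup>2) powr m * (1 + e * s\<^sup>2) powr ?n)) has_real_derivative
     1 * (?a powr m * ?b powr ?n) + ((m * ?a powr (m - 1) * (2 * s)) * ?b powr ?n + (?n * ?b powr (?n - 1) * (2 * e * s)) * ?a powr m) * s) (at s)"
    by (intro DERIV_mult' DERIV_mult DERIV_ident pa pb)
  also have "1 * (?a powr m * ?b powr ?n) + ((m * ?a powr (m - 1) * (2 * s)) * ?b powr ?n + (?n * ?b powr (?n - 1) * (2 * e * s)) * ?a powr m) * s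
     = trunc_deriv m e s"
  proof -
    \<comment> \<open>A polynomial identity in the powers and the inverse bases; the exponent enters
      only through 2 * n = - (2 * m + 1).\<close>
    have "1 * (A * B) + ((m * (A * ia) * (2 * s)) * B + (n * (B * ib) * (2 * e * s)) * A) * s
      = A * B * (1 + 2 * m * s\<^sup>2 * ia - (2 * m + 1) * (e * s\<^sup>2) * ib)" if "2 * n = - (2 * m + 1)" for A B ia ib n :: real
      using that by algebra
    then have "1 * (A * B) + ((m * (A / a) * (2 * s)) * B + (?n * (B / b) * (2 * e * s)) * A) * s
      = A * B * (1 + 2 * m * s\<^sup>2 / a - (2 * m + 1) * (e * s\<^sup>2) / b)" for A B a b :: real
      unfolding divide_inverse[of _ a] divide_inverse[of _ b] by simp
    then show ?thesis unfolding trunc_deriv_def trunc_weight_def ra rb .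
  qed
  finally show ?thesis by (simp add: trunc_weight_def)
qed

text \<open>With A = s^2 / (1 + s^2) and B = e s^2 / (1 + e s^2) the bracket in
  \<open>trunc_deriv\<close> equals (1 - B) + 2 m (A - B). Since e \<le> 1 implies B \<le> A, it
  lies between 0 and 1 + 2 m.\<close>

lemma deriv_bounds: "0 \<le> trunc_deriv m e s" "trunc_deriv m e s \<le> e powr (- m) * (1 + 2 * m)"
proof -
  define A where "A = s\<^sup>2 / (1 + s\<^sup>2)"
  define B where "B = (e * s\<^sup>2) / (1 + e * s\<^sup>2)"
  note pos = one_plus_pos[of s]
  have A: "0 \<le> A" "A \<le> 1" using pos by (auto simp: A_def)
  have B: "0 \<le> B" "B \<le> 1" using pos e by (auto simp: B_def pos_divide_le_eq[OF pos(2)])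
  have "e * s\<^sup>2 \<le> s\<^sup>2" using e by (simp add: mult_left_le_one_le)
  then have BA: "B \<le> A" unfolding A_def B_def using pos by (simp add: divide_simps algebra_simps)
  have br: "1 + 2 * m * s\<^sup>2 / (1 + s\<^sup>2) - (2 * m + 1) * (e * s\<^sup>2) / (1 + e * s\<^sup>2) = (1 - B) + 2 * m * (A - B)"
    by (simp add: A_def B_def algebra_simps add_divide_distrib)
  have b1: "0 \<le> (1 - B) + 2 * m * (A - B)" using B BA m by (intro add_nonneg_nonneg mult_nonneg_nonneg) auto
  have "2 * m * (A - B) \<le> 2 * m * 1" using m A B by (intro mult_left_mono) auto
  then have b2: "(1 - B) + 2 * m * (A - B) \<le> 1 + 2 * m" using B by linarith
  show "0 \<le> trunc_deriv m e s" unfolding trunc_deriv_def br using b1 c_pos[of s] by (intro mult_nonneg_nonneg) auto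
  have "(1 + e * s\<^sup>2) powr (- 1/2) \<le> (1 + e * s\<^sup>2) powr 0" using pos by (intro powr_mono) auto
  then have "(1 + e * s\<^sup>2) powr (- 1/2) \<le> 1" using pos by simp
  then have "e powr (- m) * (1 + e * s\<^sup>2) powr (- 1/2) \<le> e powr (- m)" by (intro mult_left_le) auto
  then have "c s \<le> e powr (- m)" using c_le_e[of s] by linarith
  then show "trunc_deriv m e s \<le> e powr (- m) * (1 + 2 * m)"
    unfolding trunc_deriv_def br using b1 b2 c_pos[of s] by (intro mult_mono) auto
qed

lemma c_cont: "continuous_on S c"
  unfolding trunc_weight_def[abs_def] using one_plus_pos
  by (intro continuous_intros) (auto simp: less_imp_neq[THEN not_sym])

lemma deriv_cont: "continuous_on S (trunc_deriv m e)"
  unfolding trunc_deriv_def[abs_def] using one_plus_pos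
  by (intro continuous_intros c_cont) (auto simp: less_imp_neq[THEN not_sym])

lemma smooth_trunc: assumes "smooth \<phi>" shows "smooth (\<lambda>x. \<phi> x * c (\<phi> x))"
  unfolding trunc_weight_def power2_eq_square using one_plus_pos
  by (intro smooth_mult smooth_powr smooth_add smooth_const assms) (auto simp: power2_eq_square)

end

text \<open>The antiderivative of s (1 + s^2)^m vanishing at 0, that is, what the energy density F
  becomes when the truncation is removed. Up to factors and additive constants it is
  |s|^(2m+2).\<close>

definition growth :: "real \<Rightarrow> real \<Rightarrow> real" where
  "growth m s = ((1 + s\<^sup>2) powr (m + 1) - 1) / (2 * (m + 1))"

lemma growth_deriv:
  assumes "m \<ge> 0" shows "(growth m has_real_derivative s * (1 + s\<^sup>2) powr m) (at s)"
proof -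
  have pos: "0 < 1 + s\<^sup>2" by (simp add: add_pos_nonneg)
  have "((\<lambda>s. (1 + s\<^sup>2) powr (m + 1)) has_real_derivative ((m + 1) * (1 + s\<^sup>2) powr (m + 1 - 1) * (2 * s))) (at s)"
    by (intro DERIV_powr_compose pos) (auto intro!: derivative_eq_intros)
  from DERIV_cdivide[OF DERIV_diff[OF this DERIV_const[of 1]], of "2 * (m + 1)"]
  moreover have "((m + 1) * (1 + s\<^sup>2) powr (m + 1 - 1) * (2 * s) - 0) / (2 * (m + 1)) = s * (1 + s\<^sup>2) powr m"
    using assms by (simp add: field_simps)
  ultimately show ?thesis unfolding growth_def[abs_def] by (simp only:)
qed

context truncation
begin

text \<open>F and \<open>growth m\<close> have derivatives of the form s times a weight, so
  inequalities between the weights carry over. For |r| \<le> |s| the truncating factor at r is at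
  least its value at s; this gives the lower bound, whose factor tends to 1 as e \<rightarrow>
  0.\<close>

lemma antiderivative_bounds:
  assumes F: "F 0 = 0" "\<And>s. (F has_real_derivative s * c s) (at s)"
  shows "0 \<le> F s" "F s \<le> growth m s" "(1 + e * s\<^sup>2) powr (- m - 1/2) * growth m s \<le> F s" "0 \<le> growth m s"
proof -
  have g0: "growth m 0 = 0" by (simp add: growth_def)
  show "0 \<le> F s" by (rule nonneg_of_derivative_sign[OF F]) (simp add: c_pos less_imp_le)
  have "0 \<le> growth m s - F s"
  proof (rule nonneg_of_derivative_sign[where G="\<lambda>s. growth m s - F s"])
    show "((\<lambda>s. growth m s - F s) has_real_derivative r * ((1 + r\<^sup>2) powr m - c r)) (at r)" for r
      using DERIV_diff[OF growth_deriv[OF m] F(2)] by (simp add: algebra_simps)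
  qed (use F g0 c_le in auto)
  then show "F s \<le> growth m s" by simp
  show "0 \<le> growth m s" by (rule nonneg_of_derivative_sign[OF g0 growth_deriv[OF m]]) simp
  let ?k = "(1 + e * s\<^sup>2) powr (- m - 1/2)"
  have "0 \<le> F s - ?k * growth m s"
  proof (rule nonneg_of_derivative_sign[where G="\<lambda>r. F r - ?k * growth m r"])
    show "((\<lambda>r. F r - ?k * growth m r) has_real_derivative r * (c r - ?k * (1 + r\<^sup>2) powr m)) (at r)" for r
    proof -
      have eq: "r * c r - ?k * (r * (1 + r\<^sup>2) powr m) = r * (c r - ?k * (1 + r\<^sup>2) powr m)" by (simp add: right_diff_distrib)
      show ?thesis
        using DERIV_diff[OF F(2) DERIV_cmult[OF growth_deriv[OF m], of ?k], of r] unfolding eq .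
    qed
    fix r assume "\<bar>r\<bar> \<le> \<bar>s\<bar>"
    then have "r\<^sup>2 \<le> s\<^sup>2" by (simp add: abs_le_square_iff)
    then have "1 + e * r\<^sup>2 \<le> 1 + e * s\<^sup>2" using e by simp
    then have "?k \<le> (1 + e * r\<^sup>2) powr (- m - 1/2)" using m one_plus_pos[of r] by (intro powr_mono2') auto
    then show "0 \<le> c r - ?k * (1 + r\<^sup>2) powr m" by (simp add: trunc_weight_def mult.commute mult_left_mono)
  qed (use F g0 in auto)
  then show "?k * growth m s \<le> F s" by simp
qed

end

text \<open>The first summand bounds \<beta> times the weight for |s| up to (4 \<beta> /
  \<alpha>)^(1/p). The second bounds, up to a power of |\<gamma>|, the contribution of a source
  \<gamma> for |s| up to (4 |\<gamma>| / \<alpha>)^(1/(p-1)). Beyond these thresholds the coercive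
  term absorbs them.\<close>

definition source_const :: "real \<Rightarrow> real \<Rightarrow> real \<Rightarrow> real \<Rightarrow> real" where
  "source_const p \<alpha> \<beta> m = \<beta> * (1 + ((4 * \<beta> / \<alpha>) powr (1 / p))\<^sup>2) powr m
     + (4 / \<alpha>) powr (1 / (p - 1)) * (1 + ((4 / \<alpha>) powr (1 / (p - 1)))\<^sup>2) powr m"

lemma source_const_pos: "\<beta> > 0 \<Longrightarrow> source_const p \<alpha> \<beta> m > 0"
proof -
  assume b: "\<beta> > 0"
  have "0 < (1 + x\<^sup>2) powr m" for x :: real
    by (subst powr_gt_zero, rule less_imp_neq[THEN not_sym]) (simp add: add_pos_nonneg)
  then have "0 < \<beta> * (1 + ((4 * \<beta> / \<alpha>) powr (1 / p))\<^sup>2) powr m" by (intro mult_pos_pos b)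
  then show ?thesis unfolding source_const_def by (intro add_pos_nonneg) auto
qed

text \<open>Cases take the place of Young's inequality: either \<beta>, respectively |\<gamma>| |s|,
  is at most \<alpha>/4 |s|^p, or |s| is bounded by a constant, respectively by a multiple of
  |\<gamma>|^(1/(p-1)). Absorbing both terms leaves \<alpha>/2. Of the weight only positivity and
  the bound (1 + s^2)^m enter, so the constant is free of e. The source scales like |\<gamma>|
  |s|^(2m+1), hence the exponent 1 + (2m+1)/(p-1) = (2m+p)/(p-1).\<close>

lemma (in truncation) pointwise_estimate:
  fixes p \<alpha> \<beta> fs \<gamma> s :: real
  assumes p: "p > 2" and \<alpha>: "\<alpha> > 0" and \<beta>: "\<beta> > 0" and fs: "fs * s \<ge> \<alpha> * \<bar>s\<bar> powr p - \<beta>"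
  shows "(fs - \<gamma>) * (s * c s) \<ge> \<alpha> / 2 * (\<bar>s\<bar> powr p * c s) - source_const p \<alpha> \<beta> m * (1 + \<bar>\<gamma>\<bar> powr ((2 * m + p) / (p - 1)))"
proof -
  define X where "X = \<bar>s\<bar> powr p * c s"
  have X: "X \<ge> 0" using c_pos[of s] by (simp add: X_def)
  define M where "M = (4 * \<beta> / \<alpha>) powr (1 / p)"
  define \<mu> where "\<mu> = (4 / \<alpha>) powr (1 / (p - 1))"
  define r where "r = (2 * m + p) / (p - 1)"
  define C1 where "C1 = \<beta> * (1 + M\<^sup>2) powr m"
  define C2 where "C2 = \<mu> * (1 + \<mu>\<^sup>2) powr m"
  have C: "source_const p \<alpha> \<beta> m = C1 + C2" by (simp add: source_const_def C1_def C2_def M_def \<mu>_def)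
  have C1: "C1 \<ge> 0" and C2: "C2 \<ge> 0" using \<beta> by (auto simp: C1_def C2_def \<mu>_def)
  have b: "\<beta> * c s \<le> \<alpha> / 4 * X + C1"
  proof (cases "\<beta> \<le> \<alpha> / 4 * \<bar>s\<bar> powr p")
    case True
    then have "\<beta> * c s \<le> \<alpha> / 4 * \<bar>s\<bar> powr p * c s" using c_pos[of s] by (intro mult_right_mono) auto
    then show ?thesis using C1 by (simp add: X_def)
  next
    case False
    then have "\<bar>s\<bar> powr p \<le> 4 * \<beta> / \<alpha>" using \<alpha> by (simp add: field_simps)
    then have "(\<bar>s\<bar> powr p) powr (1 / p) \<le> M" unfolding M_def using p by (intro powr_mono2) auto
    then have "\<bar>s\<bar> \<le> M" using p by (simp add: powr_powr)
    then have "s\<^sup>2 \<le> M\<^sup>2" by (simp add: abs_le_square_iff[symmetric])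
    then have "(1 + s\<^sup>2) powr m \<le> (1 + M\<^sup>2) powr m" using m by (intro powr_mono2) auto
    then have "c s \<le> (1 + M\<^sup>2) powr m" using c_le[of s] by linarith
    then have "\<beta> * c s \<le> C1" unfolding C1_def using \<beta> by (intro mult_left_mono) auto
    then show ?thesis using X \<alpha> by (smt (verit) divide_nonneg_nonneg mult_nonneg_nonneg)
  qed
  have g: "\<gamma> * (s * c s) \<le> \<alpha> / 4 * X + C2 * (1 + \<bar>\<gamma>\<bar> powr r)"
  proof (cases "\<bar>\<gamma>\<bar> \<le> \<alpha> / 4 * \<bar>s\<bar> powr (p - 1)")
    case True
    have "\<gamma> * (s * c s) \<le> \<bar>\<gamma> * (s * c s)\<bar>" by simp
    also have "\<dots> = \<bar>\<gamma>\<bar> * (\<bar>s\<bar> * c s)" using c_pos[of s] by (simp add: abs_mult)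
    also have "\<dots> \<le> \<alpha> / 4 * \<bar>s\<bar> powr (p - 1) * (\<bar>s\<bar> * c s)" using True c_pos[of s] by (intro mult_right_mono) auto
    also have "\<dots> = \<alpha> / 4 * X"
    proof (cases "s = 0")
      case False
      then have "\<bar>s\<bar> powr (p - 1) * \<bar>s\<bar> = \<bar>s\<bar> powr p" using powr_add[of "\<bar>s\<bar>" "p - 1" 1] by simp
      then show ?thesis by (simp add: X_def mult.assoc[symmetric])
    qed (simp add: X_def)
    finally show ?thesis using C2 mult_nonneg_nonneg[of C2 "1 + \<bar>\<gamma>\<bar> powr r"] by (smt (verit) powr_ge_zero)
  next
    case False
    define \<nu> where "\<nu> = \<bar>\<gamma>\<bar> powr (1 / (p - 1))"
    have "\<bar>s\<bar> powr (p - 1) \<le> 4 / \<alpha> * \<bar>\<gamma>\<bar>" using False \<alpha> by (simp add: field_simps)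
    then have "(\<bar>s\<bar> powr (p - 1)) powr (1 / (p - 1)) \<le> (4 / \<alpha> * \<bar>\<gamma>\<bar>) powr (1 / (p - 1))" using p by (intro powr_mono2) auto
    then have s: "\<bar>s\<bar> \<le> \<mu> * \<nu>" 
    proof -
      have "(4 / \<alpha> * \<bar>\<gamma>\<bar>) powr (1 / (p - 1)) = \<mu> * \<nu>" unfolding \<mu>_def \<nu>_def by (subst powr_mult) (use \<alpha> in auto)
      with \<open>_ \<le> (4 / \<alpha> * \<bar>\<gamma>\<bar>) powr (1 / (p - 1))\<close> show ?thesis using p by (simp add: powr_powr)
    qed
    have \<mu>0: "\<mu> \<ge> 0" and \<nu>0: "\<nu> \<ge> 0" by (auto simp: \<mu>_def \<nu>_def)
    have "\<gamma> * (s * c s) \<le> \<bar>\<gamma> * (s * c s)\<bar>" by simp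
    also have "\<dots> = \<bar>\<gamma>\<bar> * (\<bar>s\<bar> * c s)" using c_pos[of s] by (simp add: abs_mult)
    also have "\<dots> \<le> C2 * (1 + \<bar>\<gamma>\<bar> powr r)"
    proof (cases "\<bar>\<gamma>\<bar> \<le> 1")
      case True
      then have "\<nu> \<le> 1" unfolding \<nu>_def using p powr_mono2[of "1 / (p - 1)" "\<bar>\<gamma>\<bar>" 1] by simp
      then have sm: "\<bar>s\<bar> \<le> \<mu>" using s \<mu>0 mult_left_le[of \<nu> \<mu>] by linarith
      then have "s\<^sup>2 \<le> \<mu>\<^sup>2" by (simp add: abs_le_square_iff[symmetric])
      then have "(1 + s\<^sup>2) powr m \<le> (1 + \<mu>\<^sup>2) powr m" using m by (intro powr_mono2) auto
      then have "c s \<le> (1 + \<mu>\<^sup>2) powr m" using c_le[of s] by linarith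
      then have "\<bar>s\<bar> * c s \<le> C2" unfolding C2_def using sm c_pos[of s] \<mu>0 by (intro mult_mono) auto
      then have "\<bar>\<gamma>\<bar> * (\<bar>s\<bar> * c s) \<le> 1 * C2" using True c_pos[of s] by (intro mult_mono) auto
      also have "\<dots> \<le> C2 * (1 + \<bar>\<gamma>\<bar> powr r)" using C2 by (simp add: algebra_simps)
      finally show ?thesis .
    next
      case False
      \<comment> \<open>Now \<nu> \<ge> 1, so 1 + s^2 \<le> (1 + \<mu>^2) \<nu>^2, and the weight
        turns into a power of |\<gamma>|.\<close>
      then have \<nu>1: "\<nu> \<ge> 1" unfolding \<nu>_def using p by (intro ge_one_powr_ge_zero) auto
      have "s\<^sup>2 \<le> (\<mu> * \<nu>)\<^sup>2" using s by (simp add: abs_le_square_iff[symmetric])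
      moreover have "1 \<le> \<nu>\<^sup>2" using \<nu>1 by simp
      ultimately have "1 + s\<^sup>2 \<le> (1 + \<mu>\<^sup>2) * \<nu>\<^sup>2" by (simp add: algebra_simps power_mult_distrib)
      then have "(1 + s\<^sup>2) powr m \<le> ((1 + \<mu>\<^sup>2) * \<nu>\<^sup>2) powr m" using m by (intro powr_mono2) auto
      also have "\<dots> = (1 + \<mu>\<^sup>2) powr m * \<nu> powr (2 * m)"
        using \<nu>1 by (simp add: powr_mult powr_powr flip: powr_numeral)
      finally have cb: "c s \<le> (1 + \<mu>\<^sup>2) powr m * \<nu> powr (2 * m)" using c_le[of s] by linarith
      have "\<bar>\<gamma>\<bar> * (\<bar>s\<bar> * c s) \<le> \<bar>\<gamma>\<bar> * ((\<mu> * \<nu>) * ((1 + \<mu>\<^sup>2) powr m * \<nu> powr (2 * m)))"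
        using s cb c_pos[of s] \<mu>0 \<nu>0 by (intro mult_left_mono mult_mono) auto
      also have "\<dots> = C2 * (\<bar>\<gamma>\<bar> * \<nu> * \<nu> powr (2 * m))" by (simp add: C2_def)
      also have "\<bar>\<gamma>\<bar> * \<nu> * \<nu> powr (2 * m) = \<bar>\<gamma>\<bar> powr r"
      proof -
        have "\<bar>\<gamma>\<bar> * \<nu> * \<nu> powr (2 * m) = \<bar>\<gamma>\<bar> powr 1 * \<bar>\<gamma>\<bar> powr (1 / (p - 1)) * \<bar>\<gamma>\<bar> powr (1 / (p - 1) * (2 * m))"
          using False by (simp add: \<nu>_def powr_powr)
        also have "\<dots> = \<bar>\<gamma>\<bar> powr (1 + 1 / (p - 1) + 1 / (p - 1) * (2 * m))" by (simp only: powr_add)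
        also have "1 + 1 / (p - 1) + 1 / (p - 1) * (2 * m) = r"
        proof -
          have "1 + 1 / (p - 1) = p / (p - 1)" using p by (simp add: field_simps)
          then show ?thesis by (simp add: r_def add_divide_distrib)
        qed
        finally show ?thesis .
      qed
      also have "C2 * \<bar>\<gamma>\<bar> powr r \<le> C2 * (1 + \<bar>\<gamma>\<bar> powr r)" using C2 by (intro mult_left_mono) auto
      finally show ?thesis .
    qed
    finally show ?thesis using X \<alpha> by (smt (verit) divide_nonneg_nonneg mult_nonneg_nonneg)
  qed
  have "fs * (s * c s) \<ge> \<alpha> * X - \<beta> * c s"
    using mult_right_mono[OF fs, of "c s"] c_pos[of s] by (simp add: X_def algebra_simps)
  moreover have "C1 \<le> C1 * (1 + \<bar>\<gamma>\<bar> powr r)" using C1 by (simp add: algebra_simps)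
  ultimately have "(fs - \<gamma>) * (s * c s) \<ge> \<alpha> / 2 * X - (C1 * (1 + \<bar>\<gamma>\<bar> powr r) + C2 * (1 + \<bar>\<gamma>\<bar> powr r))"
    using b g by (simp add: left_diff_distrib)
  then show ?thesis unfolding C X_def r_def by (simp add: algebra_simps)
qed

section \<open>Bounds for all norms\<close>

text \<open>V is only continuous, so it is compared with the exponential E, which satisfies the
  relation with equality. After the last time s with V \<le> E the difference is positive, and the
  inequality on the interval from s to t keeps it from growing.\<close>

lemma gronwall:
  fixes V :: "real \<Rightarrow> real"
  assumes c: "continuous_on {a..t} V" and at: "a \<le> t" and lam: "lam > 0"
    and ineq: "\<And>x y. a \<le> x \<Longrightarrow> x < y \<Longrightarrow> y \<le> t \<Longrightarrow> V y - V x \<le> - lam * (LINT \<tau>|lebesgue_on {x..y}. V \<tau>)"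
  shows "V t \<le> exp (- lam * (t - a)) * V a"
proof (rule ccontr)
  assume neg: "\<not> V t \<le> exp (- lam * (t - a)) * V a"
  define E where "E x = exp (- lam * (x - a)) * V a" for x
  define G where "G x = V x - E x" for x
  have cE: "continuous_on S E" for S unfolding E_def by (intro continuous_intros)
  have cG: "continuous_on {a..t} G" unfolding G_def by (intro continuous_intros c cE)
  have Ei: "E y - E x = - lam * (LINT \<tau>|lebesgue_on {x..y}. E \<tau>)" if "x \<le> y" for x y
  proof -
    have d: "(E has_real_derivative (- lam * E \<tau>)) (at \<tau>)" for \<tau>
      unfolding E_def by (auto intro!: derivative_eq_intros)
    have "((\<lambda>\<tau>. - lam * E \<tau>) has_integral (E y - E x)) {x..y}"
    proof (rule fundamental_theorem_of_calculus[OF that])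
      show "(E has_vector_derivative - lam * E \<tau>) (at \<tau> within {x..y})" for \<tau>
        unfolding has_real_derivative_iff_has_vector_derivative[symmetric]
        by (rule has_field_derivative_at_within[OF d])
    qed
    then have "integral {x..y} (\<lambda>\<tau>. - lam * E \<tau>) = E y - E x" by (rule integral_unique)
    moreover have "integral {x..y} (\<lambda>\<tau>. - lam * E \<tau>) = - lam * integral {x..y} E"
      by (rule Henstock_Kurzweil_Integration.integral_mult_right)
    moreover have "(LINT \<tau>|lebesgue_on {x..y}. E \<tau>) = integral {x..y} E"
      by (rule lebesgue_integral_eq_integral[OF continuous_imp_integrable_real[OF cE]]) simp
    ultimately show ?thesis by (simp only:)
  qed
  define A where "A = {x \<in> {a..t}. G x \<le> 0}"
  have "A = {a..t} \<inter> G -` {..0}" by (auto simp: A_def)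
  then have "closed A" using continuous_closed_preimage[OF cG closed_atLeastAtMost closed_atMost] by simp
  moreover have "bounded A" by (rule bounded_subset[of "{a..t}"]) (auto simp: A_def)
  ultimately have "compact A" by (simp add: compact_eq_bounded_closed)
  moreover have "a \<in> A" using at by (simp add: A_def G_def E_def)
  ultimately obtain s where s: "s \<in> A" "\<forall>x\<in>A. x \<le> s" using compact_attains_sup[of A] by auto
  have st: "a \<le> s" "s < t"
  proof -
    show "a \<le> s" using s by (simp add: A_def)
    have "s \<noteq> t" using s(1) neg by (auto simp: A_def G_def E_def)
    then show "s < t" using s(1) by (auto simp: A_def)
  qed
  have pos: "G x > 0" if "s < x" "x \<le> t" for x
  proof (rule ccontr)
    assume "\<not> G x > 0"
    then have "x \<in> A" using that st by (simp add: A_def)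
    then show False using s(2) that by fastforce
  qed
  have i: "integrable (lebesgue_on {s..t}) V" "integrable (lebesgue_on {s..t}) E"
    using st by (auto intro!: continuous_imp_integrable_real cE continuous_on_subset[OF c])
  have "(LINT \<tau>|lebesgue_on {s..t}. G \<tau>) \<ge> 0"
  proof (rule integral_nonneg_AE)
    have "{s} \<in> null_sets lebesgue" by (simp add: null_sets_completionI)
    then have "AE x in lebesgue. x \<notin> {s}" by (rule AE_not_in)
    then have "AE x in lebesgue_on {s..t}. x \<notin> {s}" by (subst AE_restrict_space_iff, simp, elim eventually_mono, blast)
    moreover have "AE x in lebesgue_on {s..t}. x \<in> {s..t}" by (rule AE_I2) simp
    ultimately show "AE x in lebesgue_on {s..t}. 0 \<le> G x"
      by eventually_elim (use pos in force)
  qed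
  moreover have "G t - G s \<le> - lam * (LINT \<tau>|lebesgue_on {s..t}. G \<tau>)"
    using ineq[OF st(1,2)] Ei[of s t] st i by (simp add: G_def algebra_simps)
  ultimately have "G t \<le> G s" using lam by (smt (verit) mult_minus_left mult_nonneg_nonneg)
  then show False using pos[of t] s(1) st by (auto simp: A_def)
qed

lemma nn_integral_liminf_le:
  assumes "\<And>n. f n \<in> borel_measurable M" "\<And>x. x \<in> space M \<Longrightarrow> (\<lambda>n. f n x) \<longlonglongrightarrow> w x"
  shows "(\<integral>\<^sup>+x. w x \<partial>M) \<le> liminf (\<lambda>n. \<integral>\<^sup>+x. f n x \<partial>M)"
proof -
  have "(\<integral>\<^sup>+x. w x \<partial>M) = (\<integral>\<^sup>+x. liminf (\<lambda>n. f n x) \<partial>M)"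
    by (rule nn_integral_cong) (use assms(2) lim_imp_Liminf in force)
  also have "\<dots> \<le> liminf (\<lambda>n. \<integral>\<^sup>+x. f n x \<partial>M)" by (rule nn_integral_liminf) (rule assms)
  finally show ?thesis .
qed

lemma liminf_le_const: "(\<And>n. f n \<le> (B::ennreal)) \<Longrightarrow> liminf f \<le> B"
  using Liminf_mono[of f "\<lambda>_. B" sequentially] by (simp add: Liminf_const)

context rd_solution
begin

text \<open>The integral over D of the error term in \<open>pointwise_estimate\<close> with \<gamma>
  = g x.\<close>

definition source :: "real \<Rightarrow> real" where
  "source m = source_const p \<alpha> \<beta> m * (measure L D + (\<integral>x. \<bar>g x\<bar> powr ((2 * m + p) / (p - 1)) \<partial>L))"

lemma source_nonneg: "source m \<ge> 0"
  unfolding source_def using source_const_pos[OF \<beta>, of p \<alpha> m] by (intro mult_nonneg_nonneg add_nonneg_nonneg) auto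

text \<open>Exports the energy inequality for the concrete truncation. The cut at N makes the
  dissipation integral over D continuous in time, hence integrable; N = 0 discards the dissipation,
  and N \<rightarrow> \<infinity> recovers it.\<close>

lemma truncated_energy:
  assumes m: "m \<ge> 0" and e: "0 < e" "e \<le> 1"
    and gi: "integrable L (\<lambda>x. \<bar>g x\<bar> powr ((2 * m + p) / (p - 1)))" and N: "N \<ge> 0"
  obtains F where "F 0 = 0" "\<And>s. (F has_real_derivative s * trunc_weight m e s) (at s)"
    "\<And>t. t \<ge> 0 \<Longrightarrow> integrable L (\<lambda>x. F (u t x))"
    "continuous_on {0..} (\<lambda>t. \<integral>x. F (u t x) \<partial>L)"
    "continuous_on {0..} (\<lambda>t. \<integral>x. min (\<bar>u t x\<bar> powr p * trunc_weight m e (u t x)) N \<partial>L)"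
    "\<And>a b. 0 < a \<Longrightarrow> a < b \<Longrightarrow> (\<integral>x. F (u b x) \<partial>L) - (\<integral>x. F (u a x) \<partial>L) \<le>
      (LINT \<tau>|lebesgue_on {a..b}. source m - lam * (\<integral>x. F (u \<tau> x) \<partial>L)
         - \<alpha> / 2 * (\<integral>x. min (\<bar>u \<tau> x\<bar> powr p * trunc_weight m e (u \<tau> x)) N \<partial>L))"
proof -
  interpret T: truncation m e by unfold_locales (use m e in auto)
  let ?c = "trunc_weight m e"
  have cont: "continuous_on UNIV (\<lambda>s. s * ?c s)" by (intro continuous_intros T.c_cont)
  obtain F where F0: "F 0 = 0" "\<And>s. (F has_real_derivative s * ?c s) (at s)"
    using continuous_has_antiderivative[OF cont] by blast
  interpret rd_truncation D lam p l \<kappa> \<alpha> \<beta> \<sigma> f g u0 u F "\<lambda>s. s * ?c s" "trunc_deriv m e"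
    "e powr (- m) * (1 + 2 * m)" "e powr (- m) * e powr (- 1/2)"
    by unfold_locales (use F0 T.deriv T.bound T.deriv_cont T.deriv_bounds T.smooth_trunc in auto)
  have Fi: "integrable L (\<lambda>x. F (u t x))" if "t \<ge> 0" for t
    by (rule lipschitz_integrable[OF F_lipschitz u_sq[OF that]])
  let ?h = "\<lambda>s. min (\<bar>s\<bar> powr p * ?c s) N"
  have hc: "continuous_on UNIV ?h"
    using p by (intro continuous_intros T.c_cont continuous_on_powr') auto
  have hb: "\<bar>?h s\<bar> \<le> N" for s using N T.c_pos[of s] by (auto simp: min_def)
  have one: "integrable L (\<lambda>x. 1::real)" by simp
  have Ac: "continuous_on {0..} (\<lambda>t. \<integral>x. ?h (u t x) \<partial>L)"
    using continuous_compose[OF one hc hb] by simp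
  have hi: "integrable L (\<lambda>x. ?h (u t x))" if "t \<ge> 0" for t
  proof (rule L.integrable_const_bound[where B=N])
    show "(\<lambda>x. ?h (u t x)) \<in> borel_measurable L"
      using borel_measurable_continuous_onI[OF hc] u_measurable[OF that] by (rule measurable_compose[rotated])
  qed (use hb in \<open>auto intro: AE_I2\<close>)
  have en: "(\<integral>x. F (u b x) \<partial>L) - (\<integral>x. F (u a x) \<partial>L) \<le>
      (LINT \<tau>|lebesgue_on {a..b}. source m - lam * (\<integral>x. F (u \<tau> x) \<partial>L) - \<alpha> / 2 * (\<integral>x. ?h (u \<tau> x) \<partial>L))"
    if ab: "0 < a" "a < b" for a b
  proof -
    have "(\<integral>x. F (u b x) \<partial>L) - (\<integral>x. F (u a x) \<partial>L) \<le> - (LINT \<tau>|lebesgue_on {a..b}. \<integral>x. R \<tau> x * (u \<tau> x * ?c (u \<tau> x)) \<partial>L)"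
      using energy_inequality(2)[OF ab] by (simp add: Y_def)
    also have "\<dots> = (LINT \<tau>|lebesgue_on {a..b}. - (\<integral>x. R \<tau> x * (u \<tau> x * ?c (u \<tau> x)) \<partial>L))" by simp
    also have "\<dots> \<le> (LINT \<tau>|lebesgue_on {a..b}. source m - lam * (\<integral>x. F (u \<tau> x) \<partial>L) - \<alpha> / 2 * (\<integral>x. ?h (u \<tau> x) \<partial>L))"
    proof (rule integral_mono_AE)
      show "integrable (lebesgue_on {a..b}) (\<lambda>\<tau>. - (\<integral>x. R \<tau> x * (u \<tau> x * ?c (u \<tau> x)) \<partial>L))"
        using energy_inequality(1)[OF ab] by simp
      show "integrable (lebesgue_on {a..b}) (\<lambda>\<tau>. source m - lam * (\<integral>x. F (u \<tau> x) \<partial>L) - \<alpha> / 2 * (\<integral>x. ?h (u \<tau> x) \<partial>L))"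
        using ab by (intro continuous_imp_integrable_real continuous_intros continuous_on_subset[OF Ac] continuous_on_subset[OF Y_cont[unfolded Y_def[abs_def]]]) auto
      show "AE \<tau> in lebesgue_on {a..b}. - (\<integral>x. R \<tau> x * (u \<tau> x * ?c (u \<tau> x)) \<partial>L) \<le> 
         source m - lam * (\<integral>x. F (u \<tau> x) \<partial>L) - \<alpha> / 2 * (\<integral>x. ?h (u \<tau> x) \<partial>L)"
        using AE_good[OF ab]
      proof eventually_elim
        case (elim \<tau>)
        have t0: "\<tau> \<ge> 0" using goodD(1)[OF elim] by simp
        let ?S = "source_const p \<alpha> \<beta> m" and ?r = "(2 * m + p) / (p - 1)"
        have um: "(\<lambda>x. u \<tau> x * ?c (u \<tau> x)) \<in> borel_measurable L"
          using \<Phi>u(3)[OF elim] by (rule square_integrableD(1))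
        have Ri: "integrable L (\<lambda>x. R \<tau> x * (u \<tau> x * ?c (u \<tau> x)))"
          by (rule R_pairing_bound(1)[OF elim um T.bound])
        have pt: "lam * F s + \<alpha> / 2 * ?h s - ?S * (1 + \<bar>\<gamma>\<bar> powr ?r) \<le> (lam * s + f s - \<gamma>) * (s * ?c s)" for s \<gamma>
        proof -
          have "f s * s \<ge> \<alpha> * \<bar>s\<bar> powr p - \<beta>" using f by (simp add: nonlinearity_def)
          from T.pointwise_estimate[OF p \<alpha> \<beta> this, of \<gamma>]
          have "\<alpha> / 2 * (\<bar>s\<bar> powr p * ?c s) - ?S * (1 + \<bar>\<gamma>\<bar> powr ?r) \<le> (f s - \<gamma>) * (s * ?c s)" .
          moreover have "\<alpha> / 2 * ?h s \<le> \<alpha> / 2 * (\<bar>s\<bar> powr p * ?c s)" using \<alpha> by (intro mult_left_mono) auto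
          \<comment> \<open>Convexity and F 0 = 0 give F s \<le> \<Phi> s * s, so that the term with
            lam reproduces the energy itself.\<close>
          moreover have "lam * F s \<le> lam * ((s * ?c s) * s)"
            using F_convex[of s 0] F0(1) lam by (intro mult_left_mono) auto
          ultimately show ?thesis by (simp add: algebra_simps)
        qed
        have "(\<integral>x. lam * F (u \<tau> x) + \<alpha> / 2 * ?h (u \<tau> x) - ?S * (1 + \<bar>g x\<bar> powr ?r) \<partial>L) \<le> (\<integral>x. R \<tau> x * (u \<tau> x * ?c (u \<tau> x)) \<partial>L)"
          using Fi[OF t0] hi[OF t0] gi Ri pt by (intro integral_mono) (auto simp: R_def)
        moreover have "(\<integral>x. lam * F (u \<tau> x) + \<alpha> / 2 * ?h (u \<tau> x) - ?S * (1 + \<bar>g x\<bar> powr ?r) \<partial>L)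
          = lam * (\<integral>x. F (u \<tau> x) \<partial>L) + \<alpha> / 2 * (\<integral>x. ?h (u \<tau> x) \<partial>L) - source m"
          using Fi[OF t0] hi[OF t0] gi by (simp add: source_def)
        ultimately show ?case by linarith
      qed
    qed
    finally show ?thesis .
  qed
  show ?thesis by (rule that[OF F0 Fi Y_cont[unfolded Y_def[abs_def]] Ac en])
qed

text \<open>Extended-valued, because higher powers of u t are not known to be integrable in
  advance.\<close>

definition Egrowth :: "real \<Rightarrow> real \<Rightarrow> ennreal" where
  "Egrowth m t = (\<integral>\<^sup>+x. ennreal (growth m (u t x)) \<partial>L)"

lemma trunc_factor_tendsto:
  "(\<lambda>n. (1 + inverse (real (Suc n)) * s\<^sup>2) powr c) \<longlonglongrightarrow> 1"
proof -
  have "(\<lambda>n. (1 + inverse (real (Suc n)) * s\<^sup>2) powr c) \<longlonglongrightarrow> (1 + 0 * s\<^sup>2) powr c"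
    by (intro tendsto_intros LIMSEQ_inverse_real_of_nat) auto
  then show ?thesis by simp
qed

lemma growth_measurable[measurable]: "m \<ge> 0 \<Longrightarrow> growth m \<in> borel_measurable borel"
  using growth_deriv by (intro borel_measurable_continuous_onI) (meson DERIV_isCont continuous_at_imp_continuous_on)

text \<open>Fatou's lemma is applied to the lower bound of F n from
  \<open>antiderivative_bounds\<close> rather than to F n itself: its convergence to
  \<open>growth m\<close> as e = 1/(n+1) tends to 0 is explicit.\<close>

lemma Egrowth_le_liminf:
  assumes m: "m \<ge> 0" and t: "t \<ge> 0"
    and F: "\<And>n. F n 0 = 0" "\<And>n s. (F n has_real_derivative s * trunc_weight m (inverse (real (Suc n))) s) (at s)"
    and Fi: "\<And>n. integrable L (\<lambda>x. F n (u t x))" and B: "\<And>n. (\<integral>x. F n (u t x) \<partial>L) \<le> B"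
  shows "Egrowth m t \<le> ennreal B"
proof -
  note [measurable] = u_measurable[OF t] growth_measurable[OF m]
  have T: "truncation m (inverse (real (Suc n)))" for n
    by unfold_locales (use m in \<open>auto simp: field_simps\<close>)
  let ?k = "\<lambda>n s. (1 + inverse (real (Suc n)) * s\<^sup>2) powr (- m - 1/2)"
  have "Egrowth m t \<le> liminf (\<lambda>n. \<integral>\<^sup>+x. ennreal (?k n (u t x) * growth m (u t x)) \<partial>L)"
    unfolding Egrowth_def
  proof (rule nn_integral_liminf_le)
    show "(\<lambda>x. ennreal (?k n (u t x) * growth m (u t x))) \<in> borel_measurable L" for n by measurable
    show "(\<lambda>n. ennreal (?k n (u t x) * growth m (u t x))) \<longlonglongrightarrow> ennreal (growth m (u t x))" for x
      using tendsto_mult[OF trunc_factor_tendsto tendsto_const, of "u t x" "- m - 1/2" "growth m (u t x)"]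
      by (intro tendsto_ennrealI) simp
  qed
  also have "\<dots> \<le> ennreal B"
  proof (rule liminf_le_const)
    fix n
    have "(\<integral>\<^sup>+x. ennreal (?k n (u t x) * growth m (u t x)) \<partial>L) \<le> (\<integral>\<^sup>+x. ennreal (F n (u t x)) \<partial>L)"
      using truncation.antiderivative_bounds(3)[OF T F] by (intro nn_integral_mono ennreal_leI) 
    also have "\<dots> = ennreal (\<integral>x. F n (u t x) \<partial>L)"
      using truncation.antiderivative_bounds(1)[OF T F] Fi by (intro nn_integral_eq_integral) auto
    also have "\<dots> \<le> ennreal B" using B by (rule ennreal_leI)
    finally show "(\<integral>\<^sup>+x. ennreal (?k n (u t x) * growth m (u t x)) \<partial>L) \<le> ennreal B" .
  qed
  finally show ?thesis .
qed

lemma F_le_Egrowth: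
  assumes m: "m \<ge> 0" and T: "truncation m e"
    and F: "F 0 = 0" "\<And>s. (F has_real_derivative s * trunc_weight m e s) (at s)"
    and Fi: "integrable L (\<lambda>x. F (u t x))"
  shows "ennreal (\<integral>x. F (u t x) \<partial>L) \<le> Egrowth m t"
proof -
  have "ennreal (\<integral>x. F (u t x) \<partial>L) = (\<integral>\<^sup>+x. ennreal (F (u t x)) \<partial>L)"
    using truncation.antiderivative_bounds(1)[OF T F] Fi by (intro nn_integral_eq_integral[symmetric]) auto
  also have "\<dots> \<le> Egrowth m t"
    unfolding Egrowth_def using truncation.antiderivative_bounds(2)[OF T F] by (intro nn_integral_mono ennreal_leI)
  finally show ?thesis .
qed

end

section \<open>Comparison with pure powers, and the constant of one smoothing step\<close>

lemma square_powr: "(s\<^sup>2) powr c = \<bar>s\<bar> powr (2 * c)" for s c :: real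
proof -
  have "s\<^sup>2 = \<bar>s\<bar> powr 2" by (cases "s = 0") (simp_all add: powr_numeral)
  then show ?thesis by (simp only: powr_powr)
qed

lemma powr_le_growth: 
  assumes "m \<ge> 0" shows "\<bar>s\<bar> powr (2 * m + 2) \<le> 1 + 2 * (m + 1) * growth m s"
proof -
  have "\<bar>s\<bar> powr (2 * m + 2) = (s\<^sup>2) powr (m + 1)"
    by (simp add: square_powr algebra_simps)
  also have "\<dots> \<le> (1 + s\<^sup>2) powr (m + 1)" using assms by (intro powr_mono2) auto
  also have "\<dots> = 1 + 2 * (m + 1) * growth m s" using assms by (simp add: growth_def)
  finally show ?thesis .
qed

lemma growth_le_powr: 
  assumes "m \<ge> 0" shows "growth m s \<le> 2 powr (m + 1) * (1 + \<bar>s\<bar> powr (2 * m + 2))"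
proof -
  have "(1 + s\<^sup>2) powr (m + 1) \<le> (2 * max 1 (s\<^sup>2)) powr (m + 1)" using assms by (intro powr_mono2) auto
  also have "\<dots> = 2 powr (m + 1) * max 1 (s\<^sup>2) powr (m + 1)" by (rule powr_mult)
  also have "max 1 (s\<^sup>2) powr (m + 1) \<le> 1 + (s\<^sup>2) powr (m + 1)"
    by (cases "s\<^sup>2 \<le> 1") (simp_all add: max_def)
  also have "(s\<^sup>2) powr (m + 1) = \<bar>s\<bar> powr (2 * m + 2)"
    by (simp add: square_powr algebra_simps)
  finally have *: "(1 + s\<^sup>2) powr (m + 1) \<le> 2 powr (m + 1) * (1 + \<bar>s\<bar> powr (2 * m + 2))" by simp
  have "growth m s \<le> (1 + s\<^sup>2) powr (m + 1) / (2 * (m + 1))" using assms by (simp add: growth_def divide_right_mono)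
  also have "\<dots> \<le> (1 + s\<^sup>2) powr (m + 1)" using assms by (simp add: divide_le_eq mult_le_cancel_left1)
  finally show ?thesis using * by linarith
qed

lemma powr_le_weight:
  fixes m p s :: real
  assumes "m \<ge> 0" shows "\<bar>s\<bar> powr (2 * m + p) \<le> \<bar>s\<bar> powr p * (1 + s\<^sup>2) powr m"
proof -
  have "\<bar>s\<bar> powr (2 * m + p) = \<bar>s\<bar> powr p * (s\<^sup>2) powr m"
    by (simp add: square_powr powr_add)
  also have "\<dots> \<le> \<bar>s\<bar> powr p * (1 + s\<^sup>2) powr m" using assms by (intro mult_left_mono powr_mono2) auto
  finally show ?thesis .
qed

text \<open>
  Given explicitly, because the constant has to be uniform in \<open>g\<close>, \<open>u0\<close> and \<open>u\<close>, whereas the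
  estimate is proved for a fixed solution.
\<close>

definition smoothing_const :: "real \<Rightarrow> real \<Rightarrow> real \<Rightarrow> real \<Rightarrow> real \<Rightarrow> real \<Rightarrow> real" where
  "smoothing_const d p \<alpha> \<beta> m \<delta> =
    (let m' = m + (p - 2) / 2; c = 2 powr (m + 1); c' = 2 powr (m' + 1);
         K = source_const p \<alpha> \<beta> m; K' = source_const p \<alpha> \<beta> m';
         M1 = 2 / \<alpha> * (c * d + 2 * K * d * \<delta> + c + K * \<delta>);
         M2 = c' * d + c' * M1 / \<delta> + K' * d * \<delta> + K' * \<delta>
     in d + 2 * (m' + 1) * M2 + 1)"

text \<open>The arithmetic behind \<open>smoothing\<close>: x is the norm power at time t -
  \<delta>, I the source integral, w the time integral of the higher norm power, y the energy of the
  next level and z bounds the norm power sought. Every term is at most a multiple of x + I + 1,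
  which is at least 1, x and I.\<close>

lemma smoothing_const_bound:
  fixes d p \<alpha> \<beta> m \<delta> x I w y z :: real
  assumes "p > 2" "\<alpha> > 0" "\<beta> > 0" "m \<ge> 0" "\<delta> > 0" "d \<ge> 0" "x \<ge> 0" "I \<ge> 0"
    and w: "\<alpha> / 2 * w \<le> 2 powr (m + 1) * (d + x) + source_const p \<alpha> \<beta> m * (2 * d + I) * \<delta>"
    and y: "\<delta> * y \<le> 2 powr (m + (p - 2) / 2 + 1) * (d * \<delta> + w) + source_const p \<alpha> \<beta> (m + (p - 2) / 2) * (d + I) * \<delta> * \<delta>"
    and z: "z \<le> d + 2 * (m + (p - 2) / 2 + 1) * y"
  shows "z \<le> smoothing_const d p \<alpha> \<beta> m \<delta> * (x + I + 1)"
proof -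
  define m' where "m' = m + (p - 2) / 2"
  define c where "c = 2 powr (m + 1)"
  define c' where "c' = 2 powr (m' + 1)"
  define K where "K = source_const p \<alpha> \<beta> m"
  define K' where "K' = source_const p \<alpha> \<beta> m'"
  define M1 where "M1 = 2 / \<alpha> * (c * d + 2 * K * d * \<delta> + c + K * \<delta>)"
  define M2 where "M2 = c' * d + c' * M1 / \<delta> + K' * d * \<delta> + K' * \<delta>"
  have K: "K > 0" "K' > 0" "c > 0" "c' > 0" "m' \<ge> 0"
    using source_const_pos assms by (auto simp: K_def K'_def c_def c'_def m'_def)
  define X where "X = x + I + 1"
  have X: "1 \<le> X" "x \<le> X" "I \<le> X" using assms by (auto simp: X_def)
  have M1: "M1 \<ge> 0" using assms K by (auto simp: M1_def)
  have "\<alpha> / 2 * w \<le> c * (d + x) + K * (2 * d + I) * \<delta>" using w by (simp add: c_def K_def)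
  also have "\<dots> = (c * d + 2 * K * d * \<delta>) * 1 + c * x + (K * \<delta>) * I" by (simp add: algebra_simps)
  also have "\<dots> \<le> (c * d + 2 * K * d * \<delta>) * X + c * X + (K * \<delta>) * X"
    using assms K X by (intro add_mono mult_left_mono) auto
  also have "\<dots> = \<alpha> / 2 * (M1 * X)" using assms by (simp add: M1_def algebra_simps)
  finally have w': "w \<le> M1 * X" using assms by simp
  have "\<delta> * y \<le> c' * (d * \<delta> + w) + K' * (d + I) * \<delta> * \<delta>" using y by (simp add: c'_def K'_def m'_def)
  also have "\<dots> \<le> c' * (d * \<delta> + M1 * X) + K' * (d + I) * \<delta> * \<delta>" using w' K by simp
  also have "\<dots> = (c' * d * \<delta>) * 1 + (c' * M1) * X + (K' * d * \<delta> * \<delta>) * 1 + (K' * \<delta> * \<delta>) * I" by (simp add: algebra_simps)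
  also have "\<dots> \<le> (c' * d * \<delta>) * X + (c' * M1) * X + (K' * d * \<delta> * \<delta>) * X + (K' * \<delta> * \<delta>) * X"
    using assms K X M1 by (intro add_mono mult_left_mono) auto
  also have "\<dots> = \<delta> * (M2 * X)" using assms by (simp add: M2_def algebra_simps)
  finally have y': "y \<le> M2 * X" using assms by simp
  have M2: "M2 \<ge> 0" using assms K M1 unfolding M2_def
    by (intro add_nonneg_nonneg mult_nonneg_nonneg divide_nonneg_nonneg) auto
  have "z \<le> d + 2 * (m' + 1) * y" using z by (simp add: m'_def)
  also have "\<dots> \<le> d * X + 2 * (m' + 1) * (M2 * X)" using y' K X assms by (intro add_mono mult_left_mono) (auto simp: mult_le_cancel_left1)
  also have "\<dots> \<le> (d + 2 * (m' + 1) * M2 + 1) * X" using X by (simp add: algebra_simps)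
  finally show ?thesis unfolding smoothing_const_def Let_def X_def
    by (simp only: m'_def c_def c'_def K_def K'_def M1_def M2_def)
qed

lemma smoothing_const_pos:
  assumes "p > 2" "\<alpha> > 0" "\<beta> > 0" "m \<ge> 0" "\<delta> > 0" "d \<ge> 0"
  shows "smoothing_const d p \<alpha> \<beta> m \<delta> > 0"
  unfolding smoothing_const_def Let_def using assms source_const_pos[OF assms(3), of p \<alpha>, THEN less_imp_le]
  by (intro add_nonneg_pos add_nonneg_nonneg mult_nonneg_nonneg divide_nonneg_nonneg) auto

section \<open>Decay in L^2 and gain of integrability\<close>

context rd_solution
begin

text \<open>For m = 0 the density \<open>growth\<close> is s^2 / 2, and the energy minus
  \<open>source 0 / lam\<close> satisfies the hypothesis of \<open>gronwall\<close>. The energy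
  inequality starts at positive times; the initial time is reached by continuity of the energy on
  [0, \<infinity>).\<close>

lemma L2_decay:
  assumes gi: "integrable L (\<lambda>x. \<bar>g x\<bar> powr (p / (p - 1)))" and t: "t > 0"
  shows "Lnorm_pow D 2 (u t) \<le> ennreal (exp (- lam * t)) * Lnorm_pow D 2 u0 + ennreal (2 * source 0 / lam)"
proof -
  define H where "H = (\<integral>x. (norm (u 0 x))\<^sup>2 \<partial>L)"
  have g0: "growth 0 s = s\<^sup>2 / 2" for s by (simp add: growth_def)
  define B where "B = exp (- lam * t) * (H / 2) + source 0 / lam"
  have ex: "\<exists>F. F 0 = 0 \<and> (\<forall>s. (F has_real_derivative s * trunc_weight 0 (inverse (real (Suc n))) s) (at s))
     \<and> integrable L (\<lambda>x. F (u t x)) \<and> (\<integral>x. F (u t x) \<partial>L) \<le> B" for n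
  proof -
    let ?e = "inverse (real (Suc n))"
    have e: "0 < ?e" "?e \<le> 1" by (auto simp: field_simps)
    interpret T: truncation 0 ?e by unfold_locales (use e in auto)
    obtain F where F: "F 0 = 0" "\<And>s. (F has_real_derivative s * trunc_weight 0 ?e s) (at s)"
      and Fi: "\<And>t. t \<ge> 0 \<Longrightarrow> integrable L (\<lambda>x. F (u t x))"
      and Fc: "continuous_on {0..} (\<lambda>t. \<integral>x. F (u t x) \<partial>L)"
      and Ac: "continuous_on {0..} (\<lambda>t. \<integral>x. min (\<bar>u t x\<bar> powr p * trunc_weight 0 ?e (u t x)) 0 \<partial>L)"
      and en: "\<And>a b. 0 < a \<Longrightarrow> a < b \<Longrightarrow> (\<integral>x. F (u b x) \<partial>L) - (\<integral>x. F (u a x) \<partial>L) \<le>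
      (LINT \<tau>|lebesgue_on {a..b}. source 0 - lam * (\<integral>x. F (u \<tau> x) \<partial>L)
         - \<alpha> / 2 * (\<integral>x. min (\<bar>u \<tau> x\<bar> powr p * trunc_weight 0 ?e (u \<tau> x)) 0 \<partial>L))"
      by (rule truncated_energy[of 0 ?e 0]) (use e gi in auto)
    define V where "V \<tau> = (\<integral>x. F (u \<tau> x) \<partial>L) - source 0 / lam" for \<tau>
    have Vc: "continuous_on {0..} V" unfolding V_def by (intro continuous_intros Fc)
    \<comment> \<open>With N = 0 the dissipation term disappears.\<close>
    have A0: "min (\<bar>s\<bar> powr p * trunc_weight 0 ?e s) 0 = 0" for s
      by (intro min_absorb2 mult_nonneg_nonneg less_imp_le[OF T.c_pos]) auto
    have Vt: "V t \<le> exp (- lam * (t - a)) * V a" if a: "0 < a" "a < t" for a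
    proof (rule gronwall)
      show "continuous_on {a..t} V" by (rule continuous_on_subset[OF Vc]) (use a in auto)
      fix x y assume xy: "a \<le> x" "x < y" "y \<le> t"
      have Vi: "integrable (lebesgue_on {x..y}) V" 
        by (intro continuous_imp_integrable_real continuous_on_subset[OF Vc]) (use xy a in auto)
      have "V y - V x \<le> (LINT \<tau>|lebesgue_on {x..y}. source 0 - lam * (\<integral>x. F (u \<tau> x) \<partial>L))"
        using en[of x y, unfolded A0] xy a by (simp add: V_def)
      also have "\<dots> = (LINT \<tau>|lebesgue_on {x..y}. - lam * V \<tau>)"
        using lam by (simp add: V_def right_diff_distrib)
      also have "\<dots> = - lam * (LINT \<tau>|lebesgue_on {x..y}. V \<tau>)" using Vi by simp
      finally show "V y - V x \<le> - lam * (LINT \<tau>|lebesgue_on {x..y}. V \<tau>)" .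
    qed (use a lam in auto)
    have V0: "V t \<le> exp (- lam * (t - 0)) * V 0"
    proof (rule LIMSEQ_le_const)
      \<comment> \<open>The shift to k + 2 gives a k < t also for k = 0.\<close>
      define a where "a k = t * inverse (real (Suc (Suc k)))" for k
      have "inverse (real (Suc (Suc k))) < 1" for k by (simp add: inverse_less_1_iff)
      then have a: "0 < a k" "a k < t" for k
        using t mult_strict_left_mono[of "inverse (real (Suc (Suc k)))" 1 t] by (auto simp: a_def simp del: of_nat_Suc)
      have a0: "a \<longlonglongrightarrow> 0"
        using tendsto_mult_right_zero[OF LIMSEQ_Suc[OF LIMSEQ_inverse_real_of_nat], of t] by (simp add: a_def[abs_def])
      have "(\<lambda>k. V (a k)) \<longlonglongrightarrow> V 0"
        by (rule continuous_on_tendsto_compose[OF Vc a0]) (use a in \<open>auto intro: always_eventually less_imp_le\<close>)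
      then show "(\<lambda>k. exp (- lam * (t - a k)) * V (a k)) \<longlonglongrightarrow> exp (- lam * (t - 0)) * V 0"
        by (intro tendsto_intros a0)
      show "\<exists>N. \<forall>k\<ge>N. V t \<le> exp (- lam * (t - a k)) * V (a k)" using Vt a by blast
    qed
    have F0: "(\<integral>x. F (u 0 x) \<partial>L) \<le> H / 2"
    proof -
      have "(\<integral>x. F (u 0 x) \<partial>L) \<le> (\<integral>x. (norm (u 0 x))\<^sup>2 / 2 \<partial>L)"
        using T.antiderivative_bounds(2)[OF F] Fi[of 0] square_integrableD(2)[OF u_sq[of 0]]
        by (intro integral_mono) (auto simp: g0)
      then show ?thesis by (simp add: H_def)
    qed
    have "(\<integral>x. F (u t x) \<partial>L) = V t + source 0 / lam" by (simp add: V_def)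
    also have "\<dots> \<le> exp (- lam * t) * ((\<integral>x. F (u 0 x) \<partial>L) - source 0 / lam) + source 0 / lam"
      using V0 by (simp add: V_def)
    also have "\<dots> \<le> exp (- lam * t) * (H / 2) + source 0 / lam"
    proof -
      have "source 0 / lam \<ge> 0" using source_nonneg lam by simp
      then show ?thesis using F0 by (intro add_right_mono mult_left_mono) auto
    qed
    finally have "(\<integral>x. F (u t x) \<partial>L) \<le> B" by (simp add: B_def)
    then show ?thesis using F Fi[of t] t by auto
  qed
  then obtain F where F: "\<And>n. F n 0 = 0" "\<And>n s. (F n has_real_derivative s * trunc_weight 0 (inverse (real (Suc n))) s) (at s)"
    "\<And>n. integrable L (\<lambda>x. F n (u t x))" "\<And>n. (\<integral>x. F n (u t x) \<partial>L) \<le> B" by metis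
  have "Egrowth 0 t \<le> ennreal B" by (rule Egrowth_le_liminf[OF _ _ F]) (use t in auto)
  moreover have "Egrowth 0 t = ennreal ((\<integral>x. (norm (u t x))\<^sup>2 \<partial>L) / 2)"
    unfolding Egrowth_def g0 using square_integrableD(2)[OF u_sq[of t]] t
    by (subst nn_integral_eq_integral) auto
  moreover have B0: "B \<ge> 0" unfolding B_def H_def using source_nonneg lam by (intro add_nonneg_nonneg mult_nonneg_nonneg) auto
  ultimately have "(\<integral>x. (norm (u t x))\<^sup>2 \<partial>L) \<le> 2 * B" by (simp add: ennreal_le_iff)
  then have "Lnorm_pow D 2 (u t) \<le> ennreal (2 * B)" using Lnorm_pow_2[OF u_sq[of t]] t by (simp add: ennreal_leI)
  also have "2 * B = exp (- lam * t) * H + 2 * source 0 / lam" by (simp add: B_def)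
  also have "ennreal \<dots> = ennreal (exp (- lam * t)) * ennreal H + ennreal (2 * source 0 / lam)"
    using source_nonneg lam by (simp add: H_def ennreal_mult)
  also have "ennreal H = Lnorm_pow D 2 (u 0)" using Lnorm_pow_2[OF u_sq[of 0]] by (simp add: H_def)
  also have "\<dots> = Lnorm_pow D 2 u0"
    unfolding Lnorm_pow_def using sol by (intro nn_integral_cong_AE) (auto simp: weak_solution_def elim!: eventually_mono)
  finally show ?thesis .
qed

text \<open>The term with lam is dropped, F being nonnegative; what remains bounds both the energy
  at t and the dissipation up to t. Both truncations are removed together, with e = 1/(n+1) and N =
  n, by Fatou's lemma. If the energy at s is infinite both bounds are trivial.\<close>

lemma one_step:
  assumes m: "m \<ge> 0" and st: "0 < s" "s < t"
    and gi: "integrable L (\<lambda>x. \<bar>g x\<bar> powr ((2 * m + p) / (p - 1)))"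
  shows "Egrowth m t \<le> Egrowth m s + ennreal (source m * (t - s))"
    "(\<integral>\<^sup>+\<tau>. ennreal (\<alpha> / 2) * Lnorm_pow D (2 * m + p) (u \<tau>) \<partial>lebesgue_on {s..t}) \<le> Egrowth m s + ennreal (source m * (t - s))"
proof -
  have "Egrowth m t \<le> Egrowth m s + ennreal (source m * (t - s)) \<and>
    (\<integral>\<^sup>+\<tau>. ennreal (\<alpha> / 2) * Lnorm_pow D (2 * m + p) (u \<tau>) \<partial>lebesgue_on {s..t}) \<le> Egrowth m s + ennreal (source m * (t - s))"
  proof (cases "Egrowth m s")
    case top then show ?thesis by simp
  next
    case (real Es)
    let ?e = "\<lambda>n. inverse (real (Suc n))" and ?M = "lebesgue_on {s..t}"
    let ?h = "\<lambda>n s. min (\<bar>s\<bar> powr p * trunc_weight m (?e n) s) (real n)"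
    define B where "B = Es + source m * (t - s)"
    have e: "0 < ?e n" "?e n \<le> 1" for n by (auto simp: field_simps)
    have T: "truncation m (?e n)" for n by unfold_locales (use m e in auto)
    have h0: "?h n s \<ge> 0" for n s using truncation.c_pos[OF T, of n s] by simp
    have ex: "\<exists>F. F 0 = 0 \<and> (\<forall>s. (F has_real_derivative s * trunc_weight m (?e n) s) (at s))
     \<and> integrable L (\<lambda>x. F (u t x)) \<and> (\<integral>x. F (u t x) \<partial>L) \<le> B
     \<and> continuous_on {0..} (\<lambda>t. \<integral>x. ?h n (u t x) \<partial>L)
     \<and> (LINT \<tau>|?M. \<alpha> / 2 * (\<integral>x. ?h n (u \<tau> x) \<partial>L)) \<le> B" for n
    proof -
      obtain F where F: "F 0 = 0" "\<And>s. (F has_real_derivative s * trunc_weight m (?e n) s) (at s)"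
        and Fi: "\<And>t. t \<ge> 0 \<Longrightarrow> integrable L (\<lambda>x. F (u t x))"
        and Fc: "continuous_on {0..} (\<lambda>t. \<integral>x. F (u t x) \<partial>L)"
        and Ac: "continuous_on {0..} (\<lambda>t. \<integral>x. ?h n (u t x) \<partial>L)"
        and en: "\<And>a b. 0 < a \<Longrightarrow> a < b \<Longrightarrow> (\<integral>x. F (u b x) \<partial>L) - (\<integral>x. F (u a x) \<partial>L) \<le>
        (LINT \<tau>|lebesgue_on {a..b}. source m - lam * (\<integral>x. F (u \<tau> x) \<partial>L) - \<alpha> / 2 * (\<integral>x. ?h n (u \<tau> x) \<partial>L))"
        by (rule truncated_energy[OF m e gi, of "real n" n]) auto
      have F0: "F s \<ge> 0" for s by (rule truncation.antiderivative_bounds(1)[OF T F])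
      have Fn: "(\<integral>x. F (u t x) \<partial>L) \<ge> 0" for t using F0 by simp
      have hn: "(\<integral>x. ?h n (u \<tau> x) \<partial>L) \<ge> 0" for \<tau> using h0 by (intro Bochner_Integration.integral_nonneg) auto
      have Fs: "(\<integral>x. F (u s x) \<partial>L) \<le> Es"
        using F_le_Egrowth[OF m T F Fi[of s]] st real by (simp add: ennreal_le_iff)
      have i: "integrable ?M (\<lambda>\<tau>. source m)" "integrable ?M (\<lambda>\<tau>. \<alpha> / 2 * (\<integral>x. ?h n (u \<tau> x) \<partial>L))"
         "integrable ?M (\<lambda>\<tau>. source m - lam * (\<integral>x. F (u \<tau> x) \<partial>L) - \<alpha> / 2 * (\<integral>x. ?h n (u \<tau> x) \<partial>L))"
        by (intro continuous_imp_integrable_real continuous_intros continuous_on_subset[OF Ac] continuous_on_subset[OF Fc]; use st in auto)+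
      have "(\<integral>x. F (u t x) \<partial>L) - (\<integral>x. F (u s x) \<partial>L) \<le> (LINT \<tau>|?M. source m - \<alpha> / 2 * (\<integral>x. ?h n (u \<tau> x) \<partial>L))"
      proof (rule order_trans[OF en[OF st] integral_mono[OF i(3) Bochner_Integration.integrable_diff[OF i(1,2)]]])
        fix \<tau>
        have "0 \<le> lam * (\<integral>x. F (u \<tau> x) \<partial>L)" using lam Fn[of \<tau>] by (intro mult_nonneg_nonneg) auto
        then show "source m - lam * (\<integral>x. F (u \<tau> x) \<partial>L) - \<alpha> / 2 * (\<integral>x. ?h n (u \<tau> x) \<partial>L) \<le> source m - \<alpha> / 2 * (\<integral>x. ?h n (u \<tau> x) \<partial>L)"
          by linarith
      qed
      also have "\<dots> = source m * (t - s) - (LINT \<tau>|?M. \<alpha> / 2 * (\<integral>x. ?h n (u \<tau> x) \<partial>L))"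
        using Bochner_Integration.integral_diff[OF i(1,2)] st by (simp add: measure_restrict_space)
      finally have *: "(\<integral>x. F (u t x) \<partial>L) + (LINT \<tau>|?M. \<alpha> / 2 * (\<integral>x. ?h n (u \<tau> x) \<partial>L)) \<le> B"
        using Fs by (simp add: B_def)
      moreover have "(LINT \<tau>|?M. \<alpha> / 2 * (\<integral>x. ?h n (u \<tau> x) \<partial>L)) \<ge> 0"
        using hn \<alpha> by (intro Bochner_Integration.integral_nonneg) auto
      ultimately have "(\<integral>x. F (u t x) \<partial>L) \<le> B" "(LINT \<tau>|?M. \<alpha> / 2 * (\<integral>x. ?h n (u \<tau> x) \<partial>L)) \<le> B"
        using Fn[of t] by linarith+
      then show ?thesis using F Fi[of t] Ac st by (intro exI[of _ F]) auto
    qed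
    then obtain F where F: "\<And>n. F n 0 = 0" "\<And>n s. (F n has_real_derivative s * trunc_weight m (?e n) s) (at s)"
      "\<And>n. integrable L (\<lambda>x. F n (u t x))" "\<And>n. (\<integral>x. F n (u t x) \<partial>L) \<le> B" by metis
    have Ac: "continuous_on {0..} (\<lambda>t. \<integral>x. ?h n (u t x) \<partial>L)" for n using ex by blast
    have Ab: "(LINT \<tau>|?M. \<alpha> / 2 * (\<integral>x. ?h n (u \<tau> x) \<partial>L)) \<le> B" for n using ex by blast
    have Beq: "ennreal B = Egrowth m s + ennreal (source m * (t - s))"
      unfolding B_def real(2) using real(1) source_nonneg st by (intro ennreal_plus) auto
    have 1: "Egrowth m t \<le> ennreal B" by (rule Egrowth_le_liminf[OF m _ F]) (use st in auto)
    let ?a = "\<lambda>n \<tau>. ennreal (\<alpha> / 2 * (\<integral>x. ?h n (u \<tau> x) \<partial>L))"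
    have am: "integrable ?M (\<lambda>\<tau>. \<alpha> / 2 * (\<integral>x. ?h n (u \<tau> x) \<partial>L))" for n
      using st by (intro continuous_imp_integrable_real continuous_intros continuous_on_subset[OF Ac]) auto
    have "(\<integral>\<^sup>+\<tau>. ennreal (\<alpha> / 2) * Lnorm_pow D (2 * m + p) (u \<tau>) \<partial>?M) \<le> (\<integral>\<^sup>+\<tau>. liminf (\<lambda>n. ?a n \<tau>) \<partial>?M)"
    proof (rule nn_integral_mono)
      fix \<tau> assume "\<tau> \<in> space ?M"
      then have \<tau>: "\<tau> \<ge> 0" using st by simp
      note [measurable] = u_measurable[OF \<tau>]
      have hc: "continuous_on UNIV (?h n)" for n
        using p by (intro continuous_intros truncation.c_cont[OF T] continuous_on_powr') auto
      have hm: "(\<lambda>x. ?h n (u \<tau> x)) \<in> borel_measurable L" for n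
        using borel_measurable_continuous_onI[OF hc] u_measurable[OF \<tau>] by (rule measurable_compose[rotated])
      have "ennreal (\<alpha> / 2) * Lnorm_pow D (2 * m + p) (u \<tau>) = (\<integral>\<^sup>+x. ennreal (\<alpha> / 2) * ennreal (\<bar>u \<tau> x\<bar> powr (2 * m + p)) \<partial>L)"
        unfolding Lnorm_pow_def by (rule nn_integral_cmult[symmetric]) measurable
      also have "\<dots> \<le> (\<integral>\<^sup>+x. ennreal (\<alpha> / 2 * (\<bar>u \<tau> x\<bar> powr p * (1 + (u \<tau> x)\<^sup>2) powr m)) \<partial>L)"
        using \<alpha> powr_le_weight[OF m]
        by (intro nn_integral_mono) (auto simp: ennreal_mult[symmetric] intro!: ennreal_leI mult_left_mono)
      also have "\<dots> \<le> liminf (\<lambda>n. \<integral>\<^sup>+x. ennreal (\<alpha> / 2 * ?h n (u \<tau> x)) \<partial>L)"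
      proof (rule nn_integral_liminf_le)
        show "(\<lambda>x. ennreal (\<alpha> / 2 * ?h n (u \<tau> x))) \<in> borel_measurable L" for n using hm by measurable
        fix x
        let ?s = "u \<tau> x"
        have "(\<lambda>n. \<bar>?s\<bar> powr p * ((1 + ?s\<^sup>2) powr m * (1 + ?e n * ?s\<^sup>2) powr (- m - 1/2))) \<longlonglongrightarrow> \<bar>?s\<bar> powr p * ((1 + ?s\<^sup>2) powr m * 1)"
          by (intro tendsto_mult tendsto_const trunc_factor_tendsto)
        then have l: "(\<lambda>n. \<bar>?s\<bar> powr p * trunc_weight m (?e n) ?s) \<longlonglongrightarrow> \<bar>?s\<bar> powr p * (1 + ?s\<^sup>2) powr m"
          by (simp add: trunc_weight_def)
        \<comment> \<open>The truncated weight stays below its limit, so the cut at n is inactive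
          once n exceeds the limit of the whole expression.\<close>
        obtain k where k: "\<bar>?s\<bar> powr p * (1 + ?s\<^sup>2) powr m \<le> real k" using real_arch_simple by blast
        have "\<forall>\<^sub>F n in sequentially. \<bar>?s\<bar> powr p * trunc_weight m (?e n) ?s = ?h n ?s"
        proof (rule eventually_mono[OF eventually_ge_at_top[of k]])
          fix n assume n: "k \<le> n"
          have "\<bar>?s\<bar> powr p * trunc_weight m (?e n) ?s \<le> \<bar>?s\<bar> powr p * (1 + ?s\<^sup>2) powr m"
            by (intro mult_left_mono truncation.c_le[OF T]) auto
          then have "\<bar>?s\<bar> powr p * trunc_weight m (?e n) ?s \<le> real n" using k n by linarith
          then show "\<bar>?s\<bar> powr p * trunc_weight m (?e n) ?s = ?h n ?s" by simp
        qed
        then have "(\<lambda>n. ?h n ?s) \<longlonglongrightarrow> \<bar>?s\<bar> powr p * (1 + ?s\<^sup>2) powr m" by (rule Lim_transform_eventually[OF l])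
        then show "(\<lambda>n. ennreal (\<alpha> / 2 * ?h n ?s)) \<longlonglongrightarrow> ennreal (\<alpha> / 2 * (\<bar>?s\<bar> powr p * (1 + ?s\<^sup>2) powr m))"
          by (intro tendsto_ennrealI tendsto_mult tendsto_const)
      qed
      also have "(\<lambda>n. \<integral>\<^sup>+x. ennreal (\<alpha> / 2 * ?h n (u \<tau> x)) \<partial>L) = (\<lambda>n. ?a n \<tau>)"
      proof
        fix n
        have "integrable L (\<lambda>x. ?h n (u \<tau> x))"
          by (rule L.integrable_const_bound[where B="real n"]) (use hm h0 in \<open>auto intro!: AE_I2\<close>)
        then have "(\<integral>\<^sup>+x. ennreal (\<alpha> / 2 * ?h n (u \<tau> x)) \<partial>L) = ennreal (\<integral>x. \<alpha> / 2 * ?h n (u \<tau> x) \<partial>L)"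
          using h0 \<alpha> by (intro nn_integral_eq_integral) (auto intro!: AE_I2 mult_nonneg_nonneg)
        then show "(\<integral>\<^sup>+x. ennreal (\<alpha> / 2 * ?h n (u \<tau> x)) \<partial>L) = ?a n \<tau>"
          by (simp only: integral_mult_right_zero)
      qed
      finally show "ennreal (\<alpha> / 2) * Lnorm_pow D (2 * m + p) (u \<tau>) \<le> liminf (\<lambda>n. ?a n \<tau>)" .
    qed
    also have "\<dots> \<le> liminf (\<lambda>n. \<integral>\<^sup>+\<tau>. ?a n \<tau> \<partial>?M)"
      using am by (intro nn_integral_liminf) auto
    also have "\<dots> \<le> ennreal B"
    proof (rule liminf_le_const)
      fix n
      have "(\<integral>\<^sup>+\<tau>. ?a n \<tau> \<partial>?M) = ennreal (LINT \<tau>|?M. \<alpha> / 2 * (\<integral>x. ?h n (u \<tau> x) \<partial>L))"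
        using h0 \<alpha> by (intro nn_integral_eq_integral am AE_I2 mult_nonneg_nonneg Bochner_Integration.integral_nonneg) auto
      also have "\<dots> \<le> ennreal B" using Ab by (rule ennreal_leI)
      finally show "(\<integral>\<^sup>+\<tau>. ?a n \<tau> \<partial>?M) \<le> ennreal B" .
    qed
    finally show ?thesis using 1 Beq by simp
  qed
  then show "Egrowth m t \<le> Egrowth m s + ennreal (source m * (t - s))"
    "(\<integral>\<^sup>+\<tau>. ennreal (\<alpha> / 2) * Lnorm_pow D (2 * m + p) (u \<tau>) \<partial>lebesgue_on {s..t}) \<le> Egrowth m s + ennreal (source m * (t - s))"
    by auto
qed

lemma Egrowth_le_Lnorm:
  assumes m: "m \<ge> 0" and t: "t \<ge> 0"
  shows "Egrowth m t \<le> ennreal (2 powr (m + 1)) * (ennreal (measure L D) + Lnorm_pow D (2 * m + 2) (u t))"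
proof -
  note [measurable] = u_measurable[OF t]
  have "Egrowth m t \<le> (\<integral>\<^sup>+x. ennreal (2 powr (m + 1)) * (1 + ennreal (\<bar>u t x\<bar> powr (2 * m + 2))) \<partial>L)"
    unfolding Egrowth_def
  proof (rule nn_integral_mono)
    fix x
    have "ennreal (growth m (u t x)) \<le> ennreal (2 powr (m + 1) * (1 + \<bar>u t x\<bar> powr (2 * m + 2)))"
      by (rule ennreal_leI[OF growth_le_powr[OF m]])
    also have "\<dots> = ennreal (2 powr (m + 1)) * (1 + ennreal (\<bar>u t x\<bar> powr (2 * m + 2)))"
      by (simp add: ennreal_mult)
    finally show "ennreal (growth m (u t x)) \<le> ennreal (2 powr (m + 1)) * (1 + ennreal (\<bar>u t x\<bar> powr (2 * m + 2)))" .
  qed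
  also have "\<dots> = ennreal (2 powr (m + 1)) * (emeasure L D + Lnorm_pow D (2 * m + 2) (u t))"
    by (simp add: nn_integral_cmult nn_integral_add Lnorm_pow_def)
  finally show ?thesis using L.emeasure_eq_measure[of D] by simp
qed

lemma Lnorm_le_Egrowth:
  assumes m: "m \<ge> 0" and t: "t \<ge> 0"
  shows "Lnorm_pow D (2 * m + 2) (u t) \<le> ennreal (measure L D) + ennreal (2 * (m + 1)) * Egrowth m t"
proof -
  note [measurable] = u_measurable[OF t] growth_measurable[OF m]
  have g0: "growth m s \<ge> 0" for s
    using nonneg_of_derivative_sign[of "growth m", OF _ growth_deriv[OF m]] by (simp add: growth_def[of m 0])
  have "Lnorm_pow D (2 * m + 2) (u t) \<le> (\<integral>\<^sup>+x. 1 + ennreal (2 * (m + 1)) * ennreal (growth m (u t x)) \<partial>L)"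
    unfolding Lnorm_pow_def
  proof (rule nn_integral_mono)
    fix x
    have "ennreal (\<bar>u t x\<bar> powr (2 * m + 2)) \<le> ennreal (1 + 2 * (m + 1) * growth m (u t x))"
      by (rule ennreal_leI[OF powr_le_growth[OF m]])
    also have "\<dots> = ennreal 1 + ennreal (2 * (m + 1) * growth m (u t x))"
      using m g0 by (intro ennreal_plus) auto
    also have "\<dots> = 1 + ennreal (2 * (m + 1)) * ennreal (growth m (u t x))"
      using m g0 by (subst ennreal_mult) auto
    finally show "ennreal (\<bar>u t x\<bar> powr (2 * m + 2)) \<le> 1 + ennreal (2 * (m + 1)) * ennreal (growth m (u t x))" .
  qed
  also have "\<dots> = emeasure L D + ennreal (2 * (m + 1)) * Egrowth m t"
    by (simp add: nn_integral_cmult nn_integral_add Egrowth_def del: ennreal_plus)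
  finally show ?thesis using L.emeasure_eq_measure[of D] by simp
qed

text \<open>The next level is m + (p - 2) / 2, because its norm has the exponent 2 m + p of the
  dissipation at level m. Its source has the exponent (2 m + 2 p - 2) / (p - 1), and integrability
  of g to this power serves both levels.\<close>

lemma smoothing:
  assumes m: "m \<ge> 0" and \<delta>: "\<delta> > 0" "\<delta> < t"
    and gi': "integrable L (\<lambda>x. \<bar>g x\<bar> powr ((2 * m + 2 * p - 2) / (p - 1)))"
  shows "Lnorm_pow D (2 * m + p) (u t) \<le> ennreal (smoothing_const (measure L D) p \<alpha> \<beta> m \<delta>) *
    (Lnorm_pow D (2 * m + 2) (u (t - \<delta>)) + ennreal (\<integral>x. \<bar>g x\<bar> powr ((2 * m + 2 * p - 2) / (p - 1)) \<partial>L) + 1)"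
proof (cases "Lnorm_pow D (2 * m + 2) (u (t - \<delta>))")
  case top
  have "smoothing_const (measure L D) p \<alpha> \<beta> m \<delta> > 0" using p \<alpha> \<beta> m \<delta> by (intro smoothing_const_pos) auto
  then show ?thesis by (simp add: top ennreal_mult_top)
next
  case (real x)
  define s where "s = t - \<delta>"
  have s: "0 < s" "s < t" "t - s = \<delta>" using \<delta> by (auto simp: s_def)
  define m' where "m' = m + (p - 2) / 2"
  have m': "m' \<ge> 0" "2 * m' + 2 = 2 * m + p" "2 * m' + p = 2 * m + 2 * p - 2" using m p by (auto simp: m'_def field_simps)
  let ?d = "measure L D" and ?r = "(2 * m + p) / (p - 1)" and ?r' = "(2 * m + 2 * p - 2) / (p - 1)"
  define I where "I = (\<integral>x. \<bar>g x\<bar> powr ?r' \<partial>L)"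
  have I: "I \<ge> 0" by (simp add: I_def)
  have rr: "0 \<le> ?r" "?r \<le> ?r'" using p m by (auto intro!: divide_right_mono)
  \<comment> \<open>The lower power of |g| belonging to level m is traded for the higher one plus 1,
    which adds the measure of D and explains the factor 2 before it below.\<close>
  have gle: "\<bar>g x\<bar> powr ?r \<le> \<bar>g x\<bar> powr ?r' + 1" for x by (rule powr_le_powr_plus_1[OF _ rr]) simp
  have gm[measurable]: "g \<in> borel_measurable L" using g_sq by (rule square_integrableD)
  have gb: "integrable L (\<lambda>x. \<bar>g x\<bar> powr ?r' + 1)" using gi' by simp
  have gi: "integrable L (\<lambda>x. \<bar>g x\<bar> powr ?r)"
    by (rule Bochner_Integration.integrable_bound[OF gb]) (use gle in \<open>auto intro!: AE_I2\<close>)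
  have "(\<integral>x. \<bar>g x\<bar> powr ?r \<partial>L) \<le> (\<integral>x. \<bar>g x\<bar> powr ?r' + 1 \<partial>L)" by (rule integral_mono[OF gi gb gle])
  also have "\<dots> = I + ?d" using gi' by (simp add: I_def)
  finally have GI: "(\<integral>x. \<bar>g x\<bar> powr ?r \<partial>L) \<le> I + ?d" .
  define K where "K = source_const p \<alpha> \<beta> m"
  define K' where "K' = source_const p \<alpha> \<beta> m'"
  have K: "K > 0" "K' > 0" using source_const_pos[OF \<beta>] by (auto simp: K_def K'_def)
  have S: "source m \<le> K * (2 * ?d + I)"
    unfolding source_def K_def[symmetric] using K GI by (intro mult_left_mono) auto
  have S': "source m' = K' * (?d + I)" unfolding source_def K'_def I_def m'(3) ..
  define c where "c = 2 powr (m + 1)"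
  define c' where "c' = 2 powr (m' + 1)"
  have c: "c > 0" "c' > 0" by (simp_all add: c_def c'_def)
  have xs: "Lnorm_pow D (2 * m + 2) (u s) = ennreal x" "x \<ge> 0" using real by (auto simp: s_def)
  let ?M = "lebesgue_on {s..t}"
  have meas[measurable]: "(\<lambda>\<tau>. Lnorm_pow D (2 * m + p) (u \<tau>)) \<in> borel_measurable ?M"
    by (rule Lnorm_pow_measurable) (use s m p in auto)
  define W where "W = (\<integral>\<^sup>+\<tau>. Lnorm_pow D (2 * m + p) (u \<tau>) \<partial>?M)"
  have "ennreal (\<alpha> / 2) * W = (\<integral>\<^sup>+\<tau>. ennreal (\<alpha> / 2) * Lnorm_pow D (2 * m + p) (u \<tau>) \<partial>?M)"
    unfolding W_def by (rule nn_integral_cmult[symmetric]) (rule meas)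
  also have "\<dots> \<le> Egrowth m s + ennreal (source m * \<delta>)"
    using one_step(2)[OF m s(1,2) gi] s by simp
  also have "\<dots> \<le> ennreal c * (ennreal ?d + ennreal x) + ennreal (K * (2 * ?d + I) * \<delta>)"
    using Egrowth_le_Lnorm[OF m, of s] s S \<delta> xs by (intro add_mono ennreal_leI mult_right_mono) (auto simp: c_def)
  also have "\<dots> = ennreal (c * (?d + x) + K * (2 * ?d + I) * \<delta>)"
  proof -
    have "0 \<le> K * (2 * ?d + I) * \<delta>" using K I \<delta> by (intro mult_nonneg_nonneg) auto
    then show ?thesis using c xs(2) by (simp add: ennreal_mult ennreal_plus)
  qed
  finally have W1: "ennreal (\<alpha> / 2) * W \<le> ennreal (c * (?d + x) + K * (2 * ?d + I) * \<delta>)" .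
  have RHS0: "0 \<le> c * (?d + x) + K * (2 * ?d + I) * \<delta>" using c K I \<delta> xs by (intro add_nonneg_nonneg mult_nonneg_nonneg) auto
  \<comment> \<open>Only here does the time integral turn out to be finite, so that real arithmetic
    can be used.\<close>
  have "W \<noteq> top" using W1 \<alpha> by (auto simp: ennreal_mult_top top_unique)
  then obtain w where w: "W = ennreal w" "w \<ge> 0" by (cases W) auto
  have w1: "\<alpha> / 2 * w \<le> c * (?d + x) + K * (2 * ?d + I) * \<delta>"
    using W1 \<alpha> w RHS0 by (simp add: ennreal_mult[symmetric] ennreal_le_iff)
  let ?E = "Egrowth m' t"
  have gi2: "integrable L (\<lambda>x. \<bar>g x\<bar> powr ((2 * m' + p) / (p - 1)))" using gi' by (simp add: m'(3))
  have Sn: "source m' \<ge> 0" by (rule source_nonneg)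
  have step: "?E \<le> ennreal c' * (ennreal ?d + Lnorm_pow D (2 * m + p) (u \<tau>)) + ennreal (K' * (?d + I) * \<delta>)" if \<tau>: "\<tau> \<in> {s..t}" for \<tau>
  proof -
    have E1: "Egrowth m' \<tau> \<le> ennreal c' * (ennreal ?d + Lnorm_pow D (2 * m + p) (u \<tau>))"
      using Egrowth_le_Lnorm[OF m'(1), of \<tau>] \<tau> s by (simp add: c'_def m'(2))
    have "?E \<le> Egrowth m' \<tau> + ennreal (source m' * \<delta>)"
    proof (cases "\<tau> = t")
      case False
      then have "?E \<le> Egrowth m' \<tau> + ennreal (source m' * (t - \<tau>))" using \<tau> s by (intro one_step(1)[OF m'(1) _ _ gi2]) auto
      also have "\<dots> \<le> Egrowth m' \<tau> + ennreal (source m' * \<delta>)"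
        using \<tau> s Sn by (intro add_mono order_refl ennreal_leI mult_left_mono) auto
      finally show ?thesis .
    qed simp
    also have "\<dots> \<le> ennreal c' * (ennreal ?d + Lnorm_pow D (2 * m + p) (u \<tau>)) + ennreal (K' * (?d + I) * \<delta>)"
      using E1 by (intro add_mono) (auto simp: S')
    finally show ?thesis .
  qed
  have em: "emeasure ?M {s..t} = ennreal \<delta>" using s by (simp add: emeasure_restrict_space)
  \<comment> \<open>The left-hand side of \<open>step\<close> does not depend on \<tau>, so
    integrating over the interval of length \<delta> averages the right-hand side.\<close>
  have "ennreal \<delta> * ?E = (\<integral>\<^sup>+\<tau>. ?E \<partial>?M)" using em by (simp add: space_restrict_space mult.commute)
  also have "\<dots> \<le> (\<integral>\<^sup>+\<tau>. ennreal c' * (ennreal ?d + Lnorm_pow D (2 * m + p) (u \<tau>)) + ennreal (K' * (?d + I) * \<delta>) \<partial>?M)"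
    using step by (intro nn_integral_mono) (simp add: space_restrict_space)
  also have "\<dots> = ennreal c' * (ennreal ?d * ennreal \<delta> + W) + ennreal (K' * (?d + I) * \<delta>) * ennreal \<delta>"
    using em by (simp add: nn_integral_add nn_integral_cmult W_def space_restrict_space)
  also have "\<dots> = ennreal (c' * (?d * \<delta> + w) + K' * (?d + I) * \<delta> * \<delta>)"
  proof -
    have "0 \<le> K' * (?d + I) * \<delta>" using K I \<delta> by (intro mult_nonneg_nonneg) auto
    then have "ennreal (K' * (?d + I) * \<delta> * \<delta>) = ennreal (K' * (?d + I) * \<delta>) * ennreal \<delta>" "0 \<le> K' * (?d + I) * \<delta> * \<delta>"
      using \<delta> by (auto intro: ennreal_mult)
    moreover have "ennreal (c' * (?d * \<delta> + w)) = ennreal c' * (ennreal ?d * ennreal \<delta> + W)"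
      using c \<delta> w by (simp add: ennreal_mult)
    moreover have "0 \<le> c' * (?d * \<delta> + w)" using c \<delta> w by (intro mult_nonneg_nonneg add_nonneg_nonneg) auto
    ultimately show ?thesis by (simp only: ennreal_plus)
  qed
  finally have E1: "ennreal \<delta> * ?E \<le> ennreal (c' * (?d * \<delta> + w) + K' * (?d + I) * \<delta> * \<delta>)" .
  have R0: "0 \<le> c' * (?d * \<delta> + w) + K' * (?d + I) * \<delta> * \<delta>"
    using c K I \<delta> w by (intro add_nonneg_nonneg mult_nonneg_nonneg) auto
  have "?E \<noteq> top" using E1 \<delta> by (auto simp: ennreal_mult_top top_unique)
  then obtain y where y: "?E = ennreal y" "y \<ge> 0" by (cases ?E) auto
  have y1: "\<delta> * y \<le> c' * (?d * \<delta> + w) + K' * (?d + I) * \<delta> * \<delta>"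
    using E1 \<delta> y R0 by (simp add: ennreal_mult[symmetric] ennreal_le_iff)
  have Z: "Lnorm_pow D (2 * m + p) (u t) \<le> ennreal (?d + 2 * (m' + 1) * y)"
  proof -
    have "Lnorm_pow D (2 * m + p) (u t) \<le> ennreal ?d + ennreal (2 * (m' + 1)) * ennreal y"
      using Lnorm_le_Egrowth[OF m'(1), of t] s y by (simp add: m'(2))
    also have "\<dots> = ennreal (?d + 2 * (m' + 1) * y)"
      using m' y by (subst ennreal_plus) (auto simp: ennreal_mult intro!: mult_nonneg_nonneg)
    finally show ?thesis .
  qed
  have "?d + 2 * (m' + 1) * y \<le> smoothing_const ?d p \<alpha> \<beta> m \<delta> * (x + I + 1)"
    by (rule smoothing_const_bound[where w=w and y=y])
      (use p \<alpha> \<beta> m \<delta> xs I w1 y1 in \<open>simp_all add: c_def c'_def K_def K'_def m'_def\<close>)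
  then have "ennreal (?d + 2 * (m' + 1) * y) \<le> ennreal (smoothing_const ?d p \<alpha> \<beta> m \<delta> * (x + I + 1))" by (rule ennreal_leI)
  also have "\<dots> = ennreal (smoothing_const ?d p \<alpha> \<beta> m \<delta>) * (ennreal x + ennreal I + 1)"
  proof -
    have "smoothing_const ?d p \<alpha> \<beta> m \<delta> > 0" using p \<alpha> \<beta> m \<delta> by (intro smoothing_const_pos) auto
    then show ?thesis using xs I by (simp add: ennreal_mult)
  qed
  finally show ?thesis using Z xs(1) unfolding s_def[symmetric] I_def[symmetric] by simp
qed

end

text \<open>Placed outside the locale because C is chosen before g, u0 and u. The index starts at k
  = 0, the L^2 level, one below the first level of the theorem. Each step spends half of \<epsilon>
  on the previous level and half on smoothing, so \<epsilon> is general in the induction.\<close>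

lemma iterated_bound:
  fixes D :: "'a::euclidean_space set" and lam p l \<kappa> \<alpha> \<beta> \<sigma> :: real and f :: "real \<Rightarrow> real"
  assumes D: "open D" "bounded D" and lam: "lam > 0" and p: "p > 2" and \<alpha>: "\<alpha> > 0" and \<beta>: "\<beta> > 0" and \<epsilon>: "\<epsilon> > 0"
  shows "\<exists>C>0. \<forall>g u0 u. rd_solution D lam p l \<kappa> \<alpha> \<beta> \<sigma> f g u0 u \<longrightarrow>
    integrable (lebesgue_on D) (\<lambda>x. \<bar>g x\<bar> powr ((real k * (p - 2) + p) / (p - 1))) \<longrightarrow>
    (\<forall>t>\<epsilon>. Lnorm_pow D (real k * (p - 2) + 2) (u t) \<le> ennreal C * (ennreal (exp (- lam * t)) * Lnorm_pow D 2 u0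
      + ennreal (\<integral>x. \<bar>g x\<bar> powr ((real k * (p - 2) + p) / (p - 1)) \<partial>lebesgue_on D) + 1))"
  using \<epsilon>
proof (induction k arbitrary: \<epsilon>)
  case 0
  let ?L = "lebesgue_on D"
  let ?d = "measure ?L D" and ?K = "source_const p \<alpha> \<beta> 0"
  \<comment> \<open>The summand 1 covers the coefficient of the decaying term, the other one the
    source.\<close>
  define C where "C = 1 + 2 * ?K * (?d + 1) / lam"
  have K: "?K > 0" by (rule source_const_pos[OF \<beta>])
  then have C: "C \<ge> 1" using lam by (simp add: C_def)
  show ?case
  proof (intro exI[of _ C] conjI allI impI)
    show "C > 0" using C by simp
    fix g u0 u t assume rs: "rd_solution D lam p l \<kappa> \<alpha> \<beta> \<sigma> f g u0 u"
      and gi: "integrable ?L (\<lambda>x. \<bar>g x\<bar> powr ((real 0 * (p - 2) + p) / (p - 1)))" and t: "\<epsilon> < t"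
    interpret rd_solution D lam p l \<kappa> \<alpha> \<beta> \<sigma> f g u0 u by (rule rs)
    let ?I = "\<integral>x. \<bar>g x\<bar> powr (p / (p - 1)) \<partial>?L"
    have I: "?I \<ge> 0" by simp
    have "2 * source 0 / lam = 2 * ?K * (?d + ?I) / lam" by (simp add: source_def)
    also have "\<dots> \<le> 2 * ?K * ((?d + 1) * (?I + 1)) / lam"
      using K lam I mult_nonneg_nonneg[of ?d ?I] by (intro divide_right_mono mult_left_mono) (auto simp: algebra_simps)
    also have "\<dots> = (2 * ?K * (?d + 1) / lam) * (?I + 1)" by simp
    also have "\<dots> \<le> C * (?I + 1)" using I by (intro mult_right_mono) (auto simp: C_def)
    finally have S: "2 * source 0 / lam \<le> C * (?I + 1)" .
    let ?X = "ennreal (exp (- lam * t)) * Lnorm_pow D 2 u0"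
    have "Lnorm_pow D 2 (u t) \<le> ?X + ennreal (2 * source 0 / lam)"
      by (rule L2_decay) (use gi t 0 in auto)
    also have "\<dots> \<le> ennreal C * ?X + ennreal (C * (?I + 1))"
    proof (intro add_mono ennreal_leI S)
      have "1 * ?X \<le> ennreal C * ?X" using C by (intro mult_right_mono) (auto simp: ennreal_leI[of 1 C, simplified])
      then show "?X \<le> ennreal C * ?X" by simp
    qed
    also have "ennreal (C * (?I + 1)) = ennreal C * (ennreal ?I + 1)" using C I by (simp add: ennreal_mult)
    finally show "Lnorm_pow D (real 0 * (p - 2) + 2) (u t) \<le> ennreal C * (?X
      + ennreal (\<integral>x. \<bar>g x\<bar> powr ((real 0 * (p - 2) + p) / (p - 1)) \<partial>?L) + 1)"
      by (simp add: distrib_left add.assoc)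
  qed
next
  case (Suc k)
  let ?L = "lebesgue_on D"
  define \<delta> where "\<delta> = \<epsilon> / 2"
  have \<delta>: "\<delta> > 0" using Suc.prems by (simp add: \<delta>_def)
  define m where "m = real k * (p - 2) / 2"
  have m: "m \<ge> 0" "2 * m = real k * (p - 2)" using p by (auto simp: m_def)
  define d where "d = measure ?L D"
  obtain C0 where C0: "C0 > 0" and IH: "\<And>g u0 u t. rd_solution D lam p l \<kappa> \<alpha> \<beta> \<sigma> f g u0 u \<Longrightarrow>
    integrable ?L (\<lambda>x. \<bar>g x\<bar> powr ((2 * m + p) / (p - 1))) \<Longrightarrow> t > \<delta> \<Longrightarrow>
    Lnorm_pow D (2 * m + 2) (u t) \<le> ennreal C0 * (ennreal (exp (- lam * t)) * Lnorm_pow D 2 u0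
      + ennreal (\<integral>x. \<bar>g x\<bar> powr ((2 * m + p) / (p - 1)) \<partial>?L) + 1)"
    using Suc.IH[OF \<delta>] unfolding m(2) by blast
  define C1 where "C1 = smoothing_const d p \<alpha> \<beta> m \<delta>"
  have C1: "C1 > 0" unfolding C1_def using p \<alpha> \<beta> m \<delta> by (intro smoothing_const_pos) (auto simp: d_def)
  \<comment> \<open>Looking back from t to t - \<delta> multiplies the decay factor by exp (lam *
    \<delta>).\<close>
  define e where "e = exp (lam * \<delta>)"
  have e: "e \<ge> 1" using lam \<delta> by (simp add: e_def)
  define C where "C = C1 * (C0 * (e + d + 1) + 1)"
  have d0: "d \<ge> 0" by (simp add: d_def)
  have Cp: "C > 0" unfolding C_def using C0 C1 e d0 by (intro mult_pos_pos add_pos_pos add_nonneg_pos) (auto intro: mult_pos_pos)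
  have q: "real (Suc k) * (p - 2) + 2 = 2 * m + p" "real (Suc k) * (p - 2) + p = 2 * m + 2 * p - 2"
    unfolding m(2) by (simp_all add: algebra_simps)
  show ?case
    unfolding q
  proof (intro exI[of _ C] conjI allI impI)
    show "C > 0" by (rule Cp)
    fix g u0 u t assume rs: "rd_solution D lam p l \<kappa> \<alpha> \<beta> \<sigma> f g u0 u"
      and gi': "integrable ?L (\<lambda>x. \<bar>g x\<bar> powr ((2 * m + 2 * p - 2) / (p - 1)))" and t: "\<epsilon> < t"
    interpret rd_solution D lam p l \<kappa> \<alpha> \<beta> \<sigma> f g u0 u by (rule rs)
    let ?r = "(2 * m + p) / (p - 1)" and ?r' = "(2 * m + 2 * p - 2) / (p - 1)"
    define I where "I = (\<integral>x. \<bar>g x\<bar> powr ?r' \<partial>?L)"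
    have I: "I \<ge> 0" by (simp add: I_def)
    have rr: "0 \<le> ?r" "?r \<le> ?r'" using p m by (auto intro!: divide_right_mono)
    have gle: "\<bar>g x\<bar> powr ?r \<le> \<bar>g x\<bar> powr ?r' + 1" for x by (rule powr_le_powr_plus_1[OF _ rr]) simp
    have gm[measurable]: "g \<in> borel_measurable ?L" using g_sq by (rule square_integrableD)
    have gb: "integrable ?L (\<lambda>x. \<bar>g x\<bar> powr ?r' + 1)" using gi' by simp
    have gi: "integrable ?L (\<lambda>x. \<bar>g x\<bar> powr ?r)"
      by (rule Bochner_Integration.integrable_bound[OF gb]) (use gle in \<open>auto intro!: AE_I2\<close>)
    have "(\<integral>x. \<bar>g x\<bar> powr ?r \<partial>?L) \<le> (\<integral>x. \<bar>g x\<bar> powr ?r' + 1 \<partial>?L)" by (rule integral_mono[OF gi gb gle])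
    also have "\<dots> = I + d" using gi' by (simp add: I_def d_def)
    finally have GI: "ennreal (\<integral>x. \<bar>g x\<bar> powr ?r \<partial>?L) \<le> ennreal (I + d)" by (rule ennreal_leI)
    have ts: "t - \<delta> > \<delta>" "\<delta> < t" using t Suc.prems by (auto simp: \<delta>_def)
    let ?X = "ennreal (exp (- lam * t)) * Lnorm_pow D 2 u0"
    have ee: "ennreal (exp (- lam * (t - \<delta>))) = ennreal e * ennreal (exp (- lam * t))"
      by (simp add: e_def ennreal_mult[symmetric] exp_add[symmetric] algebra_simps)
    have A: "Lnorm_pow D (2 * m + 2) (u (t - \<delta>)) \<le> ennreal C0 * (ennreal e * ?X + ennreal (I + d) + 1)"
      using IH[OF rs gi ts(1)] GI unfolding ee
      by (elim order_trans, intro mult_left_mono add_mono) (auto simp: mult.assoc)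
    show "Lnorm_pow D (2 * m + p) (u t) \<le> ennreal C * (?X + ennreal (\<integral>x. \<bar>g x\<bar> powr ?r' \<partial>?L) + 1)"
    proof (cases ?X)
      case top
      then show ?thesis using Cp by (simp add: ennreal_mult_top)
    next
      case (real x)
      have "Lnorm_pow D (2 * m + p) (u t) \<le> ennreal C1 * (Lnorm_pow D (2 * m + 2) (u (t - \<delta>)) + ennreal I + 1)"
        using smoothing[OF m(1) \<delta> ts(2) gi'] by (simp add: C1_def I_def d_def)
      also have "\<dots> \<le> ennreal C1 * (ennreal C0 * (ennreal e * ennreal x + ennreal (I + d) + 1) + ennreal I + 1)"
        using A unfolding real(2) by (intro mult_left_mono add_mono) auto
      also have "\<dots> = ennreal (C1 * (C0 * (e * x + (I + d) + 1) + I + 1))"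
      proof -
        have p1: "0 \<le> e * x" "0 \<le> I + d" using e real(1) I d0 by auto
        then have p2: "0 \<le> C0 * (e * x + (I + d) + 1)" using C0 by (intro mult_nonneg_nonneg) auto
        have "ennreal (C1 * (C0 * (e * x + (I + d) + 1) + I + 1)) = ennreal C1 * (ennreal (C0 * (e * x + (I + d) + 1)) + ennreal I + 1)"
          using C1 p2 I by (simp only: ennreal_mult ennreal_plus add_nonneg_nonneg less_imp_le zero_le_one ennreal_1)
        also have "ennreal (C0 * (e * x + (I + d) + 1)) = ennreal C0 * (ennreal (e * x) + ennreal (I + d) + 1)"
          using C0 p1 by (simp only: ennreal_mult ennreal_plus add_nonneg_nonneg less_imp_le zero_le_one ennreal_1)
        also have "ennreal (e * x) = ennreal e * ennreal x" using e real(1) by (intro ennreal_mult) auto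
        finally show ?thesis by simp
      qed
      also have "\<dots> \<le> ennreal (C * (x + I + 1))"
      proof (rule ennreal_leI)
        have "e * x + (I + d) + 1 \<le> (e + d + 1) * (x + I + 1)"
          using e d0 real(1) I by (simp add: algebra_simps)
        note a = mult_left_mono[OF this less_imp_le[OF C0]]
        have b: "I + 1 \<le> 1 * (x + I + 1)" using real(1) by simp
        from add_mono[OF a b]
        have "C0 * (e * x + (I + d) + 1) + I + 1 \<le> C0 * ((e + d + 1) * (x + I + 1)) + 1 * (x + I + 1)"
          by (simp only: add.assoc)
        also have "\<dots> = (C0 * (e + d + 1) + 1) * (x + I + 1)" by (simp add: algebra_simps)
        finally show "C1 * (C0 * (e * x + (I + d) + 1) + I + 1) \<le> C * (x + I + 1)"
          unfolding C_def using C1 by (simp add: mult.assoc)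
      qed
      also have "\<dots> = ennreal C * (?X + ennreal I + 1)" using Cp real I by (simp add: ennreal_mult)
      finally show ?thesis by (simp add: I_def)
    qed
  qed
qed

theorem lemma2p1:
  fixes D :: "'a::euclidean_space set"
    and lam p l \<kappa> \<alpha> \<beta> \<sigma> :: real
    and f :: "real \<Rightarrow> real"
    and a :: "nat \<Rightarrow> real"
  assumes "bounded_smooth_domain D"
    and "lam > 0"
    and "p > 2"
    and "l > 0" "\<kappa> > 0" "\<alpha> > 0" "\<beta> > 0" "\<sigma> > 0"
    and "nonlinearity p l \<kappa> \<alpha> \<beta> \<sigma> f"
    and "a 1 = 1"
    and "\<And>k. k \<ge> 1 \<Longrightarrow> a (k + 1) = a k + (p - 2) / p"
  shows "\<forall>\<epsilon>>0. \<exists>C :: nat \<Rightarrow> real. (\<forall>k\<ge>1. C k > 0) \<and>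
    (\<forall>u0 \<in> Lspace D 2. \<forall>g \<in> Lspace D 2. \<forall>k\<ge>1. \<forall>u.
       weak_solution D lam p f g u0 u \<longrightarrow>
       (\<forall>t>\<epsilon>. Lnorm_pow D (p * a k) (u t) \<le>
          ennreal (C k) * (ennreal (exp (- lam * t)) * Lnorm_pow D 2 u0
            + Lnorm_pow D (p * a (k + 1) / (p - 1)) g + 1)))"
proof (intro allI impI)
  fix \<epsilon> :: real assume \<epsilon>: "\<epsilon> > 0"
  have D: "open D" "bounded D" using assms(1) by (auto simp: bounded_smooth_domain_def)
  \<comment> \<open>The recursion for p * a k is linear: it starts at p = (p - 2) + 2 and adds p - 2
    each time, so level k here is level k of \<open>iterated_bound\<close>.\<close>
  have pa: "p * a k = real k * (p - 2) + 2" if "k \<ge> 1" for k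
    using that
  proof (induction k rule: dec_induct)
    case base then show ?case using assms(10) by simp
  next
    case (step k)
    have "p * a (Suc k) = p * a k + p * ((p - 2) / p)" using assms(11)[of k] step by (simp add: distrib_left)
    also have "p * ((p - 2) / p) = p - 2" using assms(3) by simp
    finally show ?case using step by (simp add: algebra_simps)
  qed
  have ex: "\<forall>k. \<exists>C>0. \<forall>g u0 u. rd_solution D lam p l \<kappa> \<alpha> \<beta> \<sigma> f g u0 u \<longrightarrow>
    integrable (lebesgue_on D) (\<lambda>x. \<bar>g x\<bar> powr ((real k * (p - 2) + p) / (p - 1))) \<longrightarrow>
    (\<forall>t>\<epsilon>. Lnorm_pow D (real k * (p - 2) + 2) (u t) \<le> ennreal C * (ennreal (exp (- lam * t)) * Lnorm_pow D 2 u0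
      + ennreal (\<integral>x. \<bar>g x\<bar> powr ((real k * (p - 2) + p) / (p - 1)) \<partial>lebesgue_on D) + 1))"
    using iterated_bound[OF D assms(2,3,6,7) \<epsilon>] by blast
  obtain C where C: "\<And>k. C k > 0" and bound: "\<And>k g u0 u t. rd_solution D lam p l \<kappa> \<alpha> \<beta> \<sigma> f g u0 u \<Longrightarrow>
    integrable (lebesgue_on D) (\<lambda>x. \<bar>g x\<bar> powr ((real k * (p - 2) + p) / (p - 1))) \<Longrightarrow> t > \<epsilon> \<Longrightarrow>
    Lnorm_pow D (real k * (p - 2) + 2) (u t) \<le> ennreal (C k) * (ennreal (exp (- lam * t)) * Lnorm_pow D 2 u0
      + ennreal (\<integral>x. \<bar>g x\<bar> powr ((real k * (p - 2) + p) / (p - 1)) \<partial>lebesgue_on D) + 1)"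
    using choice[OF ex] by blast
  show "\<exists>C :: nat \<Rightarrow> real. (\<forall>k\<ge>1. C k > 0) \<and>
    (\<forall>u0 \<in> Lspace D 2. \<forall>g \<in> Lspace D 2. \<forall>k\<ge>1. \<forall>u.
       weak_solution D lam p f g u0 u \<longrightarrow>
       (\<forall>t>\<epsilon>. Lnorm_pow D (p * a k) (u t) \<le>
          ennreal (C k) * (ennreal (exp (- lam * t)) * Lnorm_pow D 2 u0
            + Lnorm_pow D (p * a (k + 1) / (p - 1)) g + 1)))"
  proof (intro exI[of _ C] conjI ballI allI impI)
    show "C k > 0" for k by (rule C)
    fix u0 g u t and k :: nat
    assume g: "g \<in> Lspace D 2" and k: "1 \<le> k" and w: "weak_solution D lam p f g u0 u" and t: "\<epsilon> < t"
    have sol: "rd_solution D lam p l \<kappa> \<alpha> \<beta> \<sigma> f g u0 u"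
      by unfold_locales (use D assms g w in auto)
    have q: "p * a k = real k * (p - 2) + 2" by (rule pa[OF k])
    have q': "p * a (k + 1) / (p - 1) = (real k * (p - 2) + p) / (p - 1)"
      using pa[of "k + 1"] by (simp add: algebra_simps)
    have gm: "g \<in> borel_measurable (lebesgue_on D)" using g by (simp add: Lspace_def)
    show "Lnorm_pow D (p * a k) (u t) \<le> ennreal (C k) * (ennreal (exp (- lam * t)) * Lnorm_pow D 2 u0
            + Lnorm_pow D (p * a (k + 1) / (p - 1)) g + 1)"
    proof (cases "Lnorm_pow D (p * a (k + 1) / (p - 1)) g = top")
      \<comment> \<open>The right-hand side is infinite since C k > 0.\<close>
      case True
      then show ?thesis using C[of k] by (simp add: ennreal_mult_top)
    next
      case False
      then have fin: "(\<integral>\<^sup>+x. ennreal (\<bar>g x\<bar> powr ((real k * (p - 2) + p) / (p - 1))) \<partial>lebesgue_on D) < \<infinity>"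
        unfolding q' Lnorm_pow_def by (simp add: less_top)
      have gi: "integrable (lebesgue_on D) (\<lambda>x. \<bar>g x\<bar> powr ((real k * (p - 2) + p) / (p - 1)))"
        by (rule integrableI_nonneg[OF _ _ fin]) (use gm in auto)
      have "Lnorm_pow D (p * a (k + 1) / (p - 1)) g = ennreal (\<integral>x. \<bar>g x\<bar> powr ((real k * (p - 2) + p) / (p - 1)) \<partial>lebesgue_on D)"
        unfolding q' Lnorm_pow_def by (rule nn_integral_eq_integral[OF gi]) auto
      then show ?thesis using bound[OF sol gi t] unfolding q by simp
    qed
  qed
qed

end
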